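(* For every integer $t\ge 1$, with $T_t=t(t+1)/2$, one has $\dim K_{T_t}\ge t-1$; in particular the family of clique complexes $(K_n)_{n\ge1}$ has unbounded simplicial dimension. Nevertheless, for every $n\ge 1$, $$K_n\simeq \bigvee^{b_n}S^2,\qquad b_n=\chi(K_n)-1,$$ that is, $K_n$ is homotopy equivalent to a wedge of $b_n$ two-dimensional spheres.
   Context: For $n\ge 1$, $G_n$ is the simple graph whose vertices are the integer partitions of $n$; two distinct partitions $\lambda,\mu$ of $n$ are adjacent if $\mu$ can be obtained from $\lambda$ by an elementary transfer: decreasing one part of $\lambda$ by $1$ (deleting it if it becomes $0$), and either increasing a different part by $1$ or creating a new part of size $1$, followed by reordering. $K_n=\mathrm{Cl}(G_n)$ is the clique complex of $G_n$: its simplices are the nonempty cliques of $G_n$, a clique with $k+1$ vertices being a simplex of dimension $k$; $\dim K_n$ is the maximal dimension of a simplex. Homotopy statements refer to geometric realizations. $\chi$ is the Euler characteristic. An empty wedge is understood as a point. *)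

theory Defs
  imports "HOL-Analysis.Analysis" "HOL-Library.Multiset" "HOL-Library.Ramsey"
begin

definition partitions_of :: "nat \<Rightarrow> nat multiset set" where
  "partitions_of n = {p. 0 \<notin># p \<and> sum_mset p = n}"

definition decr_part :: "nat \<Rightarrow> nat multiset" where
  "decr_part a = (if a = 1 then {#} else {#a - 1#})"

text \<open>
  The two parts involved are different as occurrences: their sizes may coincide, so the second
  one is picked from what remains after removing one copy of the first.
\<close>

definition elementary_transfer :: "nat multiset \<Rightarrow> nat multiset \<Rightarrow> bool" where
  "elementary_transfer p q \<longleftrightarrow>
     (\<exists>a. a \<in># p \<and>
        ((\<exists>b. b \<in># p - {#a#} \<and> q = p - {#a#} - {#b#} + decr_part a + {#b + 1#}) \<or>
         q = p - {#a#} + decr_part a + {#1#}))"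

definition partition_edges :: "nat \<Rightarrow> nat multiset set set" where
  "partition_edges n =
     {{p, q} | p q. p \<in> partitions_of n \<and> q \<in> partitions_of n \<and> p \<noteq> q \<and> elementary_transfer p q}"

text \<open>An abstract simplicial complex is given by its set of nonempty finite simplices.\<close>

definition clique_complex :: "'a set \<Rightarrow> 'a set set \<Rightarrow> 'a set set" where
  "clique_complex V E = {s. s \<noteq> {} \<and> finite s \<and> s \<subseteq> V \<and> clique s E}"

definition partition_complex :: "nat \<Rightarrow> nat multiset set set" where
  "partition_complex n = clique_complex (partitions_of n) (partition_edges n)"

text \<open>Dimension and Euler characteristic are meaningful for finite nonempty complexes only.\<close>

definition complex_dim :: "'a set set \<Rightarrow> nat" where
  "complex_dim K = Max ((\<lambda>s. card s - 1) ` K)"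

definition euler_char :: "'a set set \<Rightarrow> int" where
  "euler_char K = (\<Sum>s\<in>K. (-1) ^ (card s - 1))"

text \<open>
  Points of the realization are given by barycentric coordinates. The topology of pointwise
  convergence is the usual one for finite complexes; infinite complexes would need the weak
  topology.
\<close>

definition geometric_realization :: "'a set set \<Rightarrow> ('a \<Rightarrow> real) topology" where
  "geometric_realization K = subtopology (powertop_real UNIV)
     {x. (\<forall>v. 0 \<le> x v) \<and> {v. x v \<noteq> 0} \<in> K \<and> (\<Sum>v | x v \<noteq> 0. x v) = 1}"

text \<open>
  \<open>None\<close> represents the common base point. The wedge carries the quotient topology of the disjoint
  union; as \<open>None\<close> is always a point, the empty wedge is a one-point space.
\<close>

definition wedge_incl :: "('i \<Rightarrow> 'a) \<Rightarrow> 'i \<Rightarrow> 'a \<Rightarrow> ('i \<times> 'a) option" where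
  "wedge_incl b i x = (if x = b i then None else Some (i, x))"

definition wedge_topology ::
    "('i \<Rightarrow> 'a topology) \<Rightarrow> ('i \<Rightarrow> 'a) \<Rightarrow> 'i set \<Rightarrow> ('i \<times> 'a) option topology" where
  "wedge_topology X b I = topology (\<lambda>U.
     U \<subseteq> insert None (\<Union>i\<in>I. wedge_incl b i ` topspace (X i)) \<and>
     (\<forall>i\<in>I. openin (X i) {x \<in> topspace (X i). wedge_incl b i x \<in> U}))"

lemma openin_wedge_topology:
  "openin (wedge_topology X b I) U \<longleftrightarrow>
     U \<subseteq> insert None (\<Union>i\<in>I. wedge_incl b i ` topspace (X i)) \<and>
     (\<forall>i\<in>I. openin (X i) {x \<in> topspace (X i). wedge_incl b i x \<in> U})"
proof -
  let ?S = "insert None (\<Union>i\<in>I. wedge_incl b i ` topspace (X i))"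
  let ?L = "\<lambda>U. U \<subseteq> ?S \<and> (\<forall>i\<in>I. openin (X i) {x \<in> topspace (X i). wedge_incl b i x \<in> U})"
  have "istopology ?L"
    unfolding istopology_def
  proof (intro conjI allI impI)
    fix S T assume S: "?L S" and T: "?L T"
    show "S \<inter> T \<subseteq> ?S" using S by blast
    show "\<forall>i\<in>I. openin (X i) {x \<in> topspace (X i). wedge_incl b i x \<in> S \<inter> T}"
    proof
      fix i assume "i \<in> I"
      then have "openin (X i) ({x \<in> topspace (X i). wedge_incl b i x \<in> S} \<inter>
                               {x \<in> topspace (X i). wedge_incl b i x \<in> T})"
        using S T by (intro openin_Int) auto
      moreover have "{x \<in> topspace (X i). wedge_incl b i x \<in> S} \<inter>
                     {x \<in> topspace (X i). wedge_incl b i x \<in> T} =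
                     {x \<in> topspace (X i). wedge_incl b i x \<in> S \<inter> T}" by blast
      ultimately show "openin (X i) {x \<in> topspace (X i). wedge_incl b i x \<in> S \<inter> T}" by simp
    qed
  next
    fix \<U> assume \<U>: "\<forall>U\<in>\<U>. ?L U"
    then show "\<Union>\<U> \<subseteq> ?S" by blast
    show "\<forall>i\<in>I. openin (X i) {x \<in> topspace (X i). wedge_incl b i x \<in> \<Union>\<U>}"
    proof
      fix i assume "i \<in> I"
      then have "openin (X i) (\<Union>U\<in>\<U>. {x \<in> topspace (X i). wedge_incl b i x \<in> U})"
        using \<U> by (intro openin_Union) auto
      moreover have "(\<Union>U\<in>\<U>. {x \<in> topspace (X i). wedge_incl b i x \<in> U}) =
                     {x \<in> topspace (X i). wedge_incl b i x \<in> \<Union>\<U>}" by blast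
      ultimately show "openin (X i) {x \<in> topspace (X i). wedge_incl b i x \<in> \<Union>\<U>}" by simp
    qed
  qed
  then show ?thesis
    by (simp add: wedge_topology_def)
qed

lemma topspace_wedge_topology:
  "topspace (wedge_topology X b I) = insert None (\<Union>i\<in>I. wedge_incl b i ` topspace (X i))"
proof (rule antisym)
  show "topspace (wedge_topology X b I) \<subseteq> insert None (\<Union>i\<in>I. wedge_incl b i ` topspace (X i))"
    using openin_topspace[of "wedge_topology X b I"] unfolding openin_wedge_topology by (rule conjunct1)
  have "openin (wedge_topology X b I) (insert None (\<Union>i\<in>I. wedge_incl b i ` topspace (X i)))"
    unfolding openin_wedge_topology
  proof (intro conjI ballI)
    fix i assume "i \<in> I"
    then have "{x \<in> topspace (X i). wedge_incl b i x \<in> insert None (\<Union>i\<in>I. wedge_incl b i ` topspace (X i))}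
               = topspace (X i)" by blast
    then show "openin (X i) {x \<in> topspace (X i). wedge_incl b i x \<in> insert None (\<Union>i\<in>I. wedge_incl b i ` topspace (X i))}"
      by simp
  qed simp
  then show "insert None (\<Union>i\<in>I. wedge_incl b i ` topspace (X i)) \<subseteq> topspace (wedge_topology X b I)"
    by (rule openin_subset)
qed

lemma quotient_map_wedge_topology:
  assumes "I \<noteq> {}" and "\<And>i. i \<in> I \<Longrightarrow> b i \<in> topspace (X i)"
  shows "quotient_map (sum_topology X I) (wedge_topology X b I) (\<lambda>(i, x). wedge_incl b i x)"
proof -
  have 1: "(\<lambda>(i, x). wedge_incl b i x) ` topspace (sum_topology X I) = topspace (wedge_topology X b I)"
  proof -
    obtain i where i: "i \<in> I" using assms by blast
    have "None = wedge_incl b i (b i)" by (simp add: wedge_incl_def)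
    then have "None \<in> (\<Union>i\<in>I. wedge_incl b i ` topspace (X i))" using i assms by blast
    then have "insert None (\<Union>i\<in>I. wedge_incl b i ` topspace (X i)) =
               (\<Union>i\<in>I. wedge_incl b i ` topspace (X i))"
      by (rule insert_absorb)
    then show ?thesis
      unfolding topspace_wedge_topology topspace_sum_topology by force
  qed
  show ?thesis
    unfolding quotient_map_def
  proof (intro conjI allI impI 1)
    fix U assume U: "U \<subseteq> topspace (wedge_topology X b I)"
    show "openin (sum_topology X I) {x \<in> topspace (sum_topology X I). (\<lambda>(i, x). wedge_incl b i x) x \<in> U}
          = openin (wedge_topology X b I) U"
      using U unfolding openin_sum_topology openin_wedge_topology topspace_wedge_topology
      by auto
  qed
qed

definition wedge_of_2_spheres :: "nat \<Rightarrow> (nat \<times> (nat \<Rightarrow> real)) option topology" where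
  "wedge_of_2_spheres m = wedge_topology (\<lambda>_. nsphere 2) (\<lambda>_ j. if j = 0 then 1 else 0) {..<m}"

end

theory Submission
  imports Defs "HOL-Library.Nat_Bijection"
begin

text \<open>
  Identify a partition with its Young diagram. Two partitions of \<open>n\<close> are adjacent iff their diagrams
  meet in \<open>n - 1\<close> cells, so each clique consists of diagrams that contain a common diagram of size
  \<open>n - 1\<close> or lie in a common diagram of size \<open>n + 1\<close>. Add the diagrams of these two sizes as
  vertices: collapsing the resulting flag complex in one way leaves \<open>K\<^sub>n\<close>, and collapsing it in
  another way leaves the order complex of three consecutive levels of Young's lattice. As the lattice
  is distributive, this two-dimensional order complex is shellable. Without the triangles that
  close a sphere in the shelling it collapses to a simplex, and contracting what is left turns each of
  these triangles into a sphere.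
\<close>

section \<open>Collapsing along cones\<close>

text \<open>Cliques have unbounded size and come in two kinds, so they offer no evident shelling;
  the added diagrams serve as apices. One move is used throughout: if adding a fixed vertex outside
  \<open>s\<close> to any simplex containing \<open>s\<close> yields a simplex again, all simplices
  containing \<open>s\<close> may be deleted. It preserves the homotopy type and, by pairing
  simplices, the Euler characteristic, so the number of spheres comes out without homology. For the
  shelling, each covering of down-sets is labelled by the code of the inserted cell, as in an
  EL-labelling. The three levels are a truncation, so descents at the lowest and highest member of a
  chain matter too; hence the fiction that chains continue at both ends. Chains are ordered by the
  total of all codes in their members, because exchanging a member at a descent visibly lowers this
  total.\<close>

definition fin_complex :: "'a set set \<Rightarrow> bool" where
  "fin_complex K \<longleftrightarrow> finite K \<and>
     (\<forall>s\<in>K. finite s \<and> s \<noteq> {} \<and> (\<forall>t. t \<subseteq> s \<longrightarrow> t \<noteq> {} \<longrightarrow> t \<in> K))"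

lemma fin_complexD:
  assumes "fin_complex K"
  shows "finite K" "\<And>s. s \<in> K \<Longrightarrow> finite s" "{} \<notin> K"
    "\<And>s t. s \<in> K \<Longrightarrow> t \<subseteq> s \<Longrightarrow> t \<noteq> {} \<Longrightarrow> t \<in> K"
  using assms unfolding fin_complex_def by blast+

lemma fin_complex_removal:
  assumes "fin_complex K"
  shows "fin_complex {t \<in> K. \<not> s \<subseteq> t}"
  using assms unfolding fin_complex_def by (simp, blast)

text \<open>Any simplex containing the support may witness the total mass 1. This spares computing
  the exact support of a point that has been moved.\<close>

lemma topspace_realization:
  assumes "fin_complex K"
  shows "x \<in> topspace (geometric_realization K) \<longleftrightarrow>
    (\<forall>v. 0 \<le> x v) \<and> (\<exists>s\<in>K. {v. x v \<noteq> 0} \<subseteq> s \<and> sum x s = 1)" (is "?l \<longleftrightarrow> ?r")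
proof
  assume ?l
  then show ?r
    unfolding geometric_realization_def by auto
next
  assume ?r
  then obtain s where s: "\<forall>v. 0 \<le> x v" "s \<in> K" "{v. x v \<noteq> 0} \<subseteq> s" "sum x s = 1" by blast
  have "finite s" using assms s fin_complexD(2) by blast
  then have "sum x {v. x v \<noteq> 0} = 1"
    using sum.mono_neutral_left[OF \<open>finite s\<close> s(3), of x] s(4) by simp
  moreover from this have "{v. x v \<noteq> 0} \<noteq> {}" by force
  then have "{v. x v \<noteq> 0} \<in> K" by (rule fin_complexD(4)[OF assms s(2,3)])
  ultimately show ?l
    using s(1) unfolding geometric_realization_def by simp
qed

lemma realization_support:
  assumes "x \<in> topspace (geometric_realization K)"
  shows "{v. x v \<noteq> 0} \<in> K" "0 \<le> x v" "sum x {v. x v \<noteq> 0} = 1"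
  using assms unfolding geometric_realization_def by auto

lemma realization_sum:
  assumes "x \<in> topspace (geometric_realization K)" "{v. x v \<noteq> 0} \<subseteq> s" "finite s"
  shows "sum x s = 1"
  using realization_support(3)[OF assms(1)] sum.mono_neutral_left[OF assms(3,2), of x] by auto

lemma realization_subcomplex:
  assumes "L \<subseteq> K"
  shows "geometric_realization L = subtopology (geometric_realization K) (topspace (geometric_realization L))"
proof -
  have "topspace (geometric_realization L) \<subseteq> topspace (geometric_realization K)"
    using assms by (auto simp: geometric_realization_def)
  then show ?thesis
    unfolding geometric_realization_def
    by (simp add: subtopology_subtopology Int_absorb1)
qed

lemma continuous_map_into_realization:
  assumes "\<And>v. continuous_map X euclideanreal (\<lambda>z. f z v)"
    "\<And>z. z \<in> topspace X \<Longrightarrow> f z \<in> topspace (geometric_realization K)"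
  shows "continuous_map X (geometric_realization K) f"
proof -
  have "continuous_map X (powertop_real UNIV) f"
    using assms(1) by (simp add: continuous_map_componentwise_UNIV)
  then show ?thesis
    using assms(2) unfolding geometric_realization_def
    by (auto simp: continuous_map_in_subtopology)
qed

lemma continuous_map_coordinate:
  "continuous_map (geometric_realization K) euclideanreal (\<lambda>x. x v)"
  unfolding geometric_realization_def
  by (intro continuous_map_from_subtopology continuous_map_product_projection) auto

lemma continuous_map_Min:
  fixes f :: "'i \<Rightarrow> 'a \<Rightarrow> real"
  assumes "finite s" "s \<noteq> {}" "\<And>v. v \<in> s \<Longrightarrow> continuous_map X euclideanreal (f v)"
  shows "continuous_map X euclideanreal (\<lambda>x. Min ((\<lambda>v. f v x) ` s))"
  using assms
proof (induction s rule: finite_ne_induct)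
  case (insert v s)
  then have "continuous_map X euclideanreal (\<lambda>x. min (f v x) (Min ((\<lambda>v. f v x) ` s)))"
    by (intro continuous_map_real_min) auto
  then show ?case using insert by simp
qed auto

lemma continuous_map_snd_coordinate:
  "continuous_map (prod_topology Z (geometric_realization K)) euclideanreal (\<lambda>p. snd p v)"
  using continuous_map_compose[OF continuous_map_snd continuous_map_coordinate]
  by (simp add: o_def)

lemma continuous_map_fst_interval:
  "continuous_map (prod_topology (top_of_set S) X) euclideanreal fst"
  using continuous_map_fst continuous_map_into_fulltopology by blast

text \<open>If the link of \<open>s\<close> is a cone with apex \<open>v\<close>, the open star of \<open>s\<close> can be pushed away
  from \<open>s\<close>: subtract the least barycentric coordinate on \<open>s\<close> from all vertices of \<open>s\<close> and give
  the mass to \<open>v\<close>.\<close>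

lemma cone_removal_homotopy_equivalent:
  fixes K :: "'a set set"
  assumes K: "fin_complex K" and s: "s \<noteq> {}" "finite s" "v \<notin> s"
    and cone: "\<And>t. t \<in> K \<Longrightarrow> s \<subseteq> t \<Longrightarrow> insert v t \<in> K"
  shows "geometric_realization K homotopy_equivalent_space geometric_realization {t \<in> K. \<not> s \<subseteq> t}"
proof -
  let ?L = "{t \<in> K. \<not> s \<subseteq> t}"
  let ?X = "geometric_realization K" and ?Y = "geometric_realization ?L"
  define m :: "('a \<Rightarrow> real) \<Rightarrow> real" where "m = (\<lambda>x. Min (x ` s))"
  define H :: "real \<times> ('a \<Rightarrow> real) \<Rightarrow> 'a \<Rightarrow> real" where
    "H = (\<lambda>p u. snd p u - (if u \<in> s then fst p * m (snd p) else 0)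
          + (if u = v then fst p * m (snd p) * card s else 0))"
  have L: "fin_complex ?L" by (rule fin_complex_removal[OF K])
  have mle: "m x \<le> x u" if "u \<in> s" for x u
    using that s unfolding m_def by auto
  have mex: "\<exists>u\<in>s. x u = m x" for x
  proof -
    have "m x \<in> x ` s" unfolding m_def using s by (intro Min_in) auto
    then show ?thesis by auto
  qed
  have m0: "0 \<le> m x" if "x \<in> topspace ?X" for x
    using mex[of x] realization_support(2)[OF that] by metis
  have mpos: "s \<subseteq> {u. x u \<noteq> 0}" if "x \<in> topspace ?X" "m x \<noteq> 0" for x
  proof
    fix u assume "u \<in> s"
    then show "u \<in> {u. x u \<noteq> 0}" using mle[of u x] m0[OF that(1)] that(2) by auto
  qed
  have H0: "H (r, x) = x" if "r * m x = 0" for r x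
    using that unfolding H_def by (auto intro!: ext)
  have nonneg: "0 \<le> H (r, x) u" if "x \<in> topspace ?X" "r \<in> {0..1}" for r x u
  proof -
    have "r * m x \<le> x u" if "u \<in> s"
      using mle[OF that, of x] m0[OF \<open>x \<in> _\<close>] \<open>r \<in> _\<close> mult_left_le_one_le[of "m x" r] by force
    then show ?thesis
      using s m0[OF that(1)] that(2) realization_support(2)[OF that(1), of u]
      unfolding H_def by auto
  qed
  \<comment> \<open>A positive minimum puts \<open>s\<close> inside the support, so by
    \<open>cone\<close> the support together with \<open>v\<close> is a simplex. The mass taken from
    the \<open>card s\<close> vertices of \<open>s\<close> equals the mass given to
    \<open>v\<close>.\<close>
  have HX: "H (r, x) \<in> topspace ?X" if x: "x \<in> topspace ?X" and r: "r \<in> {0..1}" for r x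
  proof (cases "m x = 0")
    case True
    then show ?thesis using H0[of r x] x by simp
  next
    case False
    let ?t = "insert v {u. x u \<noteq> 0}"
    have st: "s \<subseteq> {u. x u \<noteq> 0}" using mpos[OF x False] .
    then have t: "?t \<in> K" using cone realization_support(1)[OF x] by blast
    have ft: "finite ?t" using fin_complexD(2)[OF K t] .
    have "sum x ?t = 1" using realization_sum[OF x _ ft] by blast
    moreover have "(\<Sum>u\<in>?t. if u \<in> s then r * m x else 0) = card s * (r * m x)"
    proof -
      have "?t \<inter> {u. u \<in> s} = s" using st by auto
      then show ?thesis using ft by (simp add: sum.If_cases)
    qed
    moreover have "(\<Sum>u\<in>?t. if u = v then r * m x * card s else 0) = r * m x * card s"
      using ft by (subst sum.delta) auto
    ultimately have "sum (H (r, x)) ?t = 1"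
      unfolding H_def fst_conv snd_conv sum.distrib sum_subtractf by simp
    moreover have "{u. H (r, x) u \<noteq> 0} \<subseteq> ?t"
      using st unfolding H_def by auto
    ultimately show ?thesis
      using nonneg[OF x r] t topspace_realization[OF K] by blast
  qed
  have H1: "H (1, x) \<in> topspace ?Y" if x: "x \<in> topspace ?X" for x
  proof -
    have 1: "H (1, x) \<in> topspace ?X" using HX x by auto
    \<comment> \<open>A vertex attaining the minimum loses its whole coordinate at time 1, and it is
      not \<open>v\<close>.\<close>
    obtain u where u: "u \<in> s" "x u = m x" using mex by blast
    have "H (1, x) u = 0" using u s unfolding H_def by auto
    then have "\<not> s \<subseteq> {u. H (1, x) u \<noteq> 0}" using u by auto
    then show ?thesis
      using 1 unfolding geometric_realization_def by auto
  qed
  have Y: "m x = 0" if "x \<in> topspace ?Y" for x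
  proof -
    have "\<not> s \<subseteq> {u. x u \<noteq> 0}" using realization_support(1)[OF that] by blast
    moreover have "x \<in> topspace ?X" using that unfolding geometric_realization_def by auto
    ultimately show ?thesis using mpos by blast
  qed
  have cm: "continuous_map (prod_topology (top_of_set {0..1}) ?X) euclideanreal (\<lambda>p. m (snd p))"
    unfolding m_def using s by (intro continuous_map_Min continuous_map_snd_coordinate)
  have cH: "continuous_map (prod_topology (top_of_set {0..1}) ?X) euclideanreal (\<lambda>p. H p u)" for u
  proof -
    have "continuous_map (prod_topology (top_of_set {0..1}) ?X) euclideanreal
       (\<lambda>p. snd p u - (if u \<in> s then 1 else 0) * (fst p * m (snd p))
          + (if u = v then real (card s) else 0) * (fst p * m (snd p)))"
      using cm by (intro continuous_intros continuous_map_snd_coordinate continuous_map_fst_interval) auto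
    then show ?thesis
      unfolding H_def by (rule continuous_map_eq) auto
  qed
  have cHX: "continuous_map (prod_topology (top_of_set {0..1}) ?X) ?X H"
    using cH HX by (intro continuous_map_into_realization) auto
  have "continuous_map ?X (prod_topology (top_of_set {0..1}) ?X) (\<lambda>x. (1::real, x))"
    by (auto simp: continuous_map_pairwise o_def)
  then have c1: "continuous_map ?X euclideanreal (\<lambda>x. H (1, x) u)" for u
    using continuous_map_compose[OF _ cH] by (fastforce simp: o_def)
  have r: "continuous_map ?X ?Y (\<lambda>x. H (1, x))"
    using c1 H1 by (intro continuous_map_into_realization) auto
  have i: "continuous_map ?Y ?X id"
  proof (rule continuous_map_into_realization)
    fix x assume "x \<in> topspace ?Y"
    then show "id x \<in> topspace ?X" by (auto simp: geometric_realization_def)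
  qed (simp add: continuous_map_coordinate)
  have "retraction_maps ?X ?Y (\<lambda>x. H (1, x)) id"
    unfolding retraction_maps_def using r i Y H0 by auto
  moreover have "homotopic_with (\<lambda>x. True) ?X ?X (id \<circ> (\<lambda>x. H (1, x))) id"
  proof (rule homotopic_with_symD, subst homotopic_with, simp, intro exI[of _ H] conjI ballI)
    show "continuous_map (prod_topology (top_of_set {0..1}) ?X) ?X H" by (rule cHX)
  qed (simp_all add: H0)
  ultimately show ?thesis
    using deformation_retraction_imp_homotopy_equivalent_space by blast
qed

text \<open>The simplices containing \<open>s\<close> cancel in pairs \<open>t\<close>,
  \<open>insert v t\<close>. As \<open>s\<close> is nonempty and avoids \<open>v\<close>, deleting
  \<open>v\<close> never leaves the empty set.\<close>

lemma cone_removal_euler_char: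
  fixes K :: "'a set set"
  assumes K: "fin_complex K" and s: "s \<noteq> {}" "finite s" "v \<notin> s"
    and cone: "\<And>t. t \<in> K \<Longrightarrow> s \<subseteq> t \<Longrightarrow> insert v t \<in> K"
  shows "euler_char K = euler_char {t \<in> K. \<not> s \<subseteq> t}"
proof -
  let ?f = "\<lambda>t::'a set. (-1::int) ^ (card t - 1)"
  let ?A = "{t \<in> K. s \<subseteq> t \<and> v \<notin> t}" and ?B = "{t \<in> K. s \<subseteq> t \<and> v \<in> t}" and ?C = "{t \<in> K. \<not> s \<subseteq> t}"
  note fK = fin_complexD[OF K]
  have "sum ?f ?B = sum (\<lambda>t. ?f (insert v t)) ?A"
  proof (rule sum.reindex_bij_witness[of _ "insert v" "\<lambda>t. t - {v}"])
    fix t assume t: "t \<in> ?B"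
    then show "insert v (t - {v}) = t" by auto
    have "s \<subseteq> t - {v}" using t s by auto
    moreover from this have "t - {v} \<in> K" using fK(4)[of t "t - {v}"] t s by blast
    ultimately show "t - {v} \<in> ?A" by auto
    show "?f (insert v (t - {v})) = ?f t" using t by (simp add: insert_absorb)
  qed (use cone in auto)
  also have "\<dots> = (\<Sum>t\<in>?A. - ?f t)"
  proof (rule sum.cong)
    fix t assume t: "t \<in> ?A"
    then have "finite t" "t \<noteq> {}" using fK(2)[of t] fK(3) by auto
    then obtain k where "card t = Suc k" by (metis card_gt_0_iff gr0_conv_Suc)
    then show "?f (insert v t) = - ?f t" using t \<open>finite t\<close> by simp
  qed simp
  finally have 1: "sum ?f ?B + sum ?f ?A = 0" by (simp add: sum_negf)
  have "K = ?B \<union> (?A \<union> ?C)" by blast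
  then have "sum ?f K = sum ?f (?B \<union> (?A \<union> ?C))" by simp
  also have "\<dots> = sum ?f ?B + (sum ?f ?A + sum ?f ?C)"
    using fK(1) by (subst sum.union_disjoint; (subst sum.union_disjoint)?) auto
  finally show ?thesis unfolding euler_char_def using 1 by simp
qed

text \<open>\<open>euler_char\<close> counts simplices, and its homotopy invariance is a theorem of
  homology; carrying the equality along every step avoids that theorem.\<close>

definition cx_equiv :: "'a set set \<Rightarrow> 'b set set \<Rightarrow> bool" where
  "cx_equiv K L \<longleftrightarrow> geometric_realization K homotopy_equivalent_space geometric_realization L
     \<and> euler_char K = euler_char L"

lemma cx_equiv_trans: "cx_equiv K L \<Longrightarrow> cx_equiv L M \<Longrightarrow> cx_equiv K M"
  unfolding cx_equiv_def using homotopy_eqv_trans by metis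

lemma cx_equiv_sym: "cx_equiv K L \<Longrightarrow> cx_equiv L K"
  unfolding cx_equiv_def using homotopy_equivalent_space_sym by metis

lemma cx_equiv_refl: "cx_equiv K K"
  unfolding cx_equiv_def by (simp add: homotopy_equivalent_space_refl)

lemma cone_removal:
  assumes "fin_complex K" "s \<noteq> {}" "finite s" "v \<notin> s"
    "\<And>t. t \<in> K \<Longrightarrow> s \<subseteq> t \<Longrightarrow> insert v t \<in> K"
  shows "cx_equiv K {t \<in> K. \<not> s \<subseteq> t}"
  unfolding cx_equiv_def
  using cone_removal_homotopy_equivalent[OF assms] cone_removal_euler_char[OF assms] by blast

text \<open>As no apex lies in a removed simplex, the removals do not disturb each other.\<close>

lemma cone_removals:
  assumes K: "fin_complex K" and S: "finite S"
    and "\<And>s. s \<in> S \<Longrightarrow> s \<noteq> {} \<and> finite s"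
    and "\<And>s s'. s \<in> S \<Longrightarrow> s' \<in> S \<Longrightarrow> a s \<notin> s'"
    and "\<And>s t. s \<in> S \<Longrightarrow> t \<in> K \<Longrightarrow> s \<subseteq> t \<Longrightarrow> insert (a s) t \<in> K"
  shows "cx_equiv K {t \<in> K. \<forall>s\<in>S. \<not> s \<subseteq> t}"
  using S assms(3-)
proof (induction S rule: finite_induct)
  case empty
  then show ?case by (simp add: cx_equiv_refl)
next
  case (insert s S)
  let ?L = "{t \<in> K. \<forall>s\<in>S. \<not> s \<subseteq> t}"
  have fL: "fin_complex ?L" using K unfolding fin_complex_def by auto
  have cone: "insert (a s) t \<in> ?L" if "t \<in> ?L" "s \<subseteq> t" for t
  proof -
    have "\<not> s' \<subseteq> insert (a s) t" if "s' \<in> S" for s'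
      using insert.prems(2)[of s s'] that \<open>t \<in> ?L\<close> by auto
    then show ?thesis using insert.prems(3)[of s t] that by auto
  qed
  have s: "s \<noteq> {}" "finite s" "a s \<notin> s"
    using insert.prems(1)[of s] insert.prems(2)[of s s] by auto
  have "cx_equiv ?L {t \<in> ?L. \<not> s \<subseteq> t}"
    using cone by (intro cone_removal[OF fL s])
  moreover have "{t \<in> ?L. \<not> s \<subseteq> t} = {t \<in> K. \<forall>s\<in>insert s S. \<not> s \<subseteq> t}" by auto
  moreover have "cx_equiv K ?L" using insert.IH insert.prems by simp
  ultimately show ?case using cx_equiv_trans by auto
qed

section \<open>Quotients by contractible subspaces and the triangle modulo its boundary\<close>

lemma compact_space_interval: "compact_space (top_of_set {0..1::real})"
  by (simp add: compact_space_subtopology)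

lemma quotient_map_factor:
  assumes "quotient_map X Y f" "continuous_map X Z h"
    and "\<And>x y. x \<in> topspace X \<Longrightarrow> y \<in> topspace X \<Longrightarrow> f x = f y \<Longrightarrow> h x = h y"
  shows "\<exists>g. continuous_map Y Z g \<and> (\<forall>x\<in>topspace X. g (f x) = h x)"
proof (rule quotient_map_lift_exists[OF assms])
  fix g assume "continuous_map Y Z g" "\<And>x. x \<in> topspace X \<Longrightarrow> g (f x) = h x"
  then show ?thesis by blast
qed

text \<open>\<open>q\<close> identifies \<open>A\<close> to a point and nothing else. As
  \<open>\<Phi>\<close> is constant on \<open>A\<close> at time 1, its end map factors through
  \<open>q\<close> and gives the homotopy inverse; as \<open>\<Phi>\<close> keeps \<open>A\<close>
  inside \<open>A\<close> at all times, the homotopy itself descends to \<open>Y\<close>.\<close>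

lemma quotient_homotopy_equivalent:
  fixes \<Phi> :: "real \<times> 'a \<Rightarrow> 'a"
  assumes X: "compact_space X" and Y: "Hausdorff_space Y"
    and q: "continuous_map X Y q" "q ` topspace X = topspace Y"
    and q_eq: "\<And>x x'. x \<in> topspace X \<Longrightarrow> x' \<in> topspace X \<Longrightarrow>
                 q x = q x' \<longleftrightarrow> x = x' \<or> (x \<in> A \<and> x' \<in> A)"
    and \<Phi>: "continuous_map (prod_topology (top_of_set {0..1}) X) X \<Phi>"
    and \<Phi>0: "\<And>x. x \<in> topspace X \<Longrightarrow> \<Phi> (0, x) = x"
    and \<Phi>A: "\<And>r x. r \<in> {0..1} \<Longrightarrow> x \<in> A \<Longrightarrow> \<Phi> (r, x) \<in> A"
    and \<Phi>1: "\<And>x. x \<in> A \<Longrightarrow> \<Phi> (1, x) = a"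
  shows "X homotopy_equivalent_space Y"
proof -
  let ?I = "top_of_set {0..1::real}"
  have \<Phi>X: "\<Phi> (r, x) \<in> topspace X" if "r \<in> {0..1}" "x \<in> topspace X" for r x
    using continuous_map_funspace[OF \<Phi>] that by auto
  have qq: "quotient_map X Y q"
    using continuous_imp_quotient_map[OF q(1) X Y q(2)] .
  have "continuous_map X (prod_topology ?I X) (\<lambda>x. (1::real, x))"
    by (auto simp: continuous_map_pairwise o_def)
  from continuous_map_compose[OF this \<Phi>]
  have c1: "continuous_map X X (\<lambda>x. \<Phi> (1, x))" by (simp add: o_def)
  have well: "\<Phi> (1, x) = \<Phi> (1, x')" if "x \<in> topspace X" "x' \<in> topspace X" "q x = q x'" for x x'
    using q_eq[OF that(1,2)] that(3) \<Phi>1 by auto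
  obtain g where g: "continuous_map Y X g" "\<And>x. x \<in> topspace X \<Longrightarrow> g (q x) = \<Phi> (1, x)"
    using quotient_map_factor[OF qq c1 well] by blast
  let ?Q = "\<lambda>p. (fst p :: real, q (snd p))"
  have cQ: "continuous_map (prod_topology ?I X) (prod_topology ?I Y) ?Q"
    using continuous_map_compose[OF continuous_map_snd q(1)]
    by (auto simp: continuous_map_pairwise o_def continuous_map_fst)
  \<comment> \<open>The product with the interval is still a quotient map because its source is
    compact and its target Hausdorff.\<close>
  have qQ: "quotient_map (prod_topology ?I X) (prod_topology ?I Y) ?Q"
  proof (rule continuous_imp_quotient_map[OF cQ])
    show "compact_space (prod_topology ?I X)"
      using X compact_space_interval by (simp add: compact_space_prod_topology)
    show "Hausdorff_space (prod_topology ?I Y)"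
      using Y by (simp add: Hausdorff_space_prod_topology Hausdorff_space_subtopology)
    show "?Q ` topspace (prod_topology ?I X) = topspace (prod_topology ?I Y)"
      using q(2) by (force simp: image_iff)
  qed
  have c\<Phi>: "continuous_map (prod_topology ?I X) Y (\<lambda>p. q (\<Phi> p))"
    using continuous_map_compose[OF \<Phi> q(1)] by (simp add: o_def)
  have well': "q (\<Phi> p) = q (\<Phi> p')"
    if p: "p \<in> topspace (prod_topology ?I X)" "p' \<in> topspace (prod_topology ?I X)" "?Q p = ?Q p'" for p p'
  proof -
    obtain r x r' x' where rx: "p = (r, x)" "p' = (r', x')" by fastforce
    have r: "r' = r" "r \<in> {0..1}" "x \<in> topspace X" "x' \<in> topspace X" "q x = q x'"
      using p unfolding rx by auto
    then have "x = x' \<or> (x \<in> A \<and> x' \<in> A)" using q_eq by blast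
    then show ?thesis
    proof
      assume "x \<in> A \<and> x' \<in> A"
      then have "\<Phi> p \<in> A" "\<Phi> p' \<in> A" using \<Phi>A r unfolding rx by auto
      moreover have "\<Phi> p \<in> topspace X" "\<Phi> p' \<in> topspace X" using \<Phi>X r unfolding rx by auto
      ultimately show ?thesis using q_eq by blast
    qed (use r rx in auto)
  qed
  obtain h where h: "continuous_map (prod_topology ?I Y) Y h"
      "\<And>p. p \<in> topspace (prod_topology ?I X) \<Longrightarrow> h (?Q p) = q (\<Phi> p)"
    using quotient_map_factor[OF qQ c\<Phi> well'] by blast
  have h': "h (r, q x) = q (\<Phi> (r, x))" if "r \<in> {0..1}" "x \<in> topspace X" for r x
    using h(2)[of "(r, x)"] that by auto
  have hX: "homotopic_with (\<lambda>x. True) X X id (g \<circ> q)"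
    by (subst homotopic_with, simp, intro exI[of _ \<Phi>]) (use \<Phi> \<Phi>0 g(2) in auto)
  have hY: "homotopic_with (\<lambda>x. True) Y Y id (q \<circ> g)"
  proof (subst homotopic_with, simp, intro exI[of _ h] conjI ballI h(1))
    fix y assume "y \<in> topspace Y"
    then obtain x where x: "x \<in> topspace X" "y = q x" using q(2) by blast
    show "h (0, y) = id y" using h'[of 0 x] x \<Phi>0 by simp
    show "h (1, y) = (q \<circ> g) y" using h'[of 1 x] x g(2) by simp
  qed simp
  show ?thesis
    unfolding homotopy_equivalent_space_def
    using q(1) g(1) homotopic_with_symD[OF hX] homotopic_with_symD[OF hY] by blast
qed

section \<open>Compactness of realizations and separation in wedges\<close>

lemma compact_space_realization:
  assumes "fin_complex K"
  shows "compact_space (geometric_realization K)"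
proof -
  let ?P = "powertop_real (UNIV :: 'a set)"
  \<comment> \<open>The closed simplex on \<open>s\<close>, a closed subset of a Tychonoff cube; the
    realization is a finite union of these.\<close>
  define C where "C = (\<lambda>s::'a set. {x. (\<forall>v. x v \<in> {0..1}) \<and> (\<forall>v. v \<notin> s \<longrightarrow> x v = (0::real)) \<and> sum x s = 1})"
  have 1: "compactin ?P (C s)" if "s \<in> K" for s
  proof -
    have "compactin ?P (PiE UNIV (\<lambda>_. {0..1}))"
      by (simp add: compactin_PiE)
    moreover have "closedin ?P {x. x v = 0}" for v
      using closedin_continuous_map_preimage[OF continuous_map_product_projection[of v UNIV "\<lambda>_. euclideanreal"], of "{0}"]
      by simp
    then have "closedin ?P ({x. sum x s = 1} \<inter> (\<Inter>v\<in>-s. {x. x v = 0}))"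
    \<comment> \<open>If \<open>s\<close> is everything, the intersection over \<open>-s\<close> has
      no members and \<open>closedin_INT\<close> does not apply.\<close>
    proof (cases "s = UNIV")
      case False
      have "continuous_map ?P euclideanreal (\<lambda>x. sum x s)"
        using fin_complexD(2)[OF assms that]
        by (intro continuous_map_sum continuous_map_product_projection) auto
      then have "closedin ?P {x. sum x s = 1}"
        using closedin_continuous_map_preimage[of ?P euclideanreal "\<lambda>x. sum x s" "{1}"] by simp
      then show ?thesis using False \<open>\<And>v. closedin ?P {x. x v = 0}\<close>
        by (intro closedin_Int closedin_INT) auto
    next
      case True
      have "continuous_map ?P euclideanreal (\<lambda>x. sum x s)"
        using fin_complexD(2)[OF assms that]
        by (intro continuous_map_sum continuous_map_product_projection) auto
      then have "closedin ?P {x. sum x s = 1}"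
        using closedin_continuous_map_preimage[of ?P euclideanreal "\<lambda>x. sum x s" "{1}"] by simp
      then show ?thesis using True by simp
    qed
    ultimately have "compactin ?P (PiE UNIV (\<lambda>_. {0..1}) \<inter> ({x. sum x s = 1} \<inter> (\<Inter>v\<in>-s. {x. x v = 0})))"
      by (rule compact_Int_closedin)
    moreover have "PiE UNIV (\<lambda>_. {0..1}) \<inter> ({x. sum x s = 1} \<inter> (\<Inter>v\<in>-s. {x. x v = 0})) = C s"
      unfolding C_def by (auto simp: PiE_UNIV_domain)
    ultimately show ?thesis by simp
  qed
  have "topspace (geometric_realization K) = \<Union>(C ` K)"
  proof (intro set_eqI iffI)
    fix x assume x: "x \<in> topspace (geometric_realization K)"
    note rs = realization_support[OF x]
    have "finite {v. x v \<noteq> 0}" using fin_complexD(2)[OF assms rs(1)] .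
    then have "x v \<le> 1" for v
      using member_le_sum[of v "{v. x v \<noteq> 0}" x] rs(2,3) by (cases "x v = 0") auto
    then show "x \<in> \<Union>(C ` K)" using rs unfolding C_def by auto
  next
    fix x assume "x \<in> \<Union>(C ` K)"
    then obtain s where "s \<in> K" "\<forall>v. x v \<in> {0..1}" "\<forall>v. v \<notin> s \<longrightarrow> x v = 0" "sum x s = 1"
      unfolding C_def by auto
    then show "x \<in> topspace (geometric_realization K)"
      by (subst topspace_realization[OF assms]) auto
  qed
  moreover have "compactin ?P (\<Union>(C ` K))"
    using 1 fin_complexD(1)[OF assms] by (intro compactin_Union) auto
  ultimately show ?thesis
    unfolding geometric_realization_def by (simp add: compact_space_subtopology)
qed

lemma Hausdorff_space_by_maps:
  assumes "\<And>x y. x \<in> topspace X \<Longrightarrow> y \<in> topspace X \<Longrightarrow> x \<noteq> y \<Longrightarrow>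
     \<exists>f. continuous_map X Z f \<and> f x \<noteq> f y" and Z: "Hausdorff_space Z"
  shows "Hausdorff_space X"
  unfolding Hausdorff_space_def
proof (intro allI impI)
  fix x y assume xy: "x \<in> topspace X \<and> y \<in> topspace X \<and> x \<noteq> y"
  then obtain f where f: "continuous_map X Z f" "f x \<noteq> f y" using assms(1) by blast
  have "f x \<in> topspace Z" "f y \<in> topspace Z"
    using continuous_map_funspace[OF f(1)] xy by auto
  then obtain U V where UV: "openin Z U" "openin Z V" "f x \<in> U" "f y \<in> V" "disjnt U V"
    using Z f(2) unfolding Hausdorff_space_def by metis
  let ?p = "\<lambda>U. {x \<in> topspace X. f x \<in> U}"
  have "openin X (?p U)" "openin X (?p V)"
    using openin_continuous_map_preimage[OF f(1)] UV by auto
  moreover have "x \<in> ?p U" "y \<in> ?p V" "disjnt (?p U) (?p V)"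
    using UV xy by (auto simp: disjnt_def)
  ultimately show "\<exists>U V. openin X U \<and> openin X V \<and> x \<in> U \<and> y \<in> V \<and> disjnt U V" by blast
qed

text \<open>The retractions \<open>\<rho> i\<close>, which collapse all summands but the
  \<open>i\<close>-th to the base point, are continuous and together separate points.\<close>

lemma Hausdorff_wedge_topology:
  fixes X :: "'a topology" and I :: "'i set"
  assumes b: "b \<in> topspace X" and X: "Hausdorff_space X"
  shows "Hausdorff_space (wedge_topology (\<lambda>_. X) (\<lambda>_. b) I)"
proof (rule Hausdorff_space_by_maps[OF _ X])
  let ?W = "wedge_topology (\<lambda>_. X) (\<lambda>_. b) I"
  define \<rho> :: "'i \<Rightarrow> ('i \<times> 'a) option \<Rightarrow> 'a" where "\<rho> = (\<lambda>i y. case y of None \<Rightarrow> b | Some (j, x) \<Rightarrow> if j = i then x else b)"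
  have \<rho>w: "\<rho> i (wedge_incl (\<lambda>_. b) j x) = (if j = i then x else b)" for i j x
    unfolding \<rho>_def wedge_incl_def by auto
  have c: "continuous_map ?W X (\<rho> i)" for i
    unfolding continuous_map_def
  proof (intro conjI allI impI)
    show "\<rho> i \<in> topspace ?W \<rightarrow> topspace X"
      unfolding topspace_wedge_topology using b \<rho>w by (auto simp: \<rho>_def)
    fix U assume U: "openin X U"
    \<comment> \<open>On summand \<open>i\<close> the retraction is the identity; on the others it
      is constant, so the preimage is everything or nothing.\<close>
    have "{x \<in> topspace X. wedge_incl (\<lambda>_. b) j x \<in> {y \<in> topspace ?W. \<rho> i y \<in> U}} =
       (if j = i then U else if b \<in> U then topspace X else {})" if "j \<in> I" for j
      unfolding topspace_wedge_topology using that openin_subset[OF U] by (auto simp: \<rho>w)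
    then show "openin ?W {y \<in> topspace ?W. \<rho> i y \<in> U}"
      unfolding openin_wedge_topology using U
      by (simp add: topspace_wedge_topology) blast
  qed
  fix y z assume yz: "y \<in> topspace ?W" "z \<in> topspace ?W" "y \<noteq> z"
  have ne: "x \<noteq> b" if "Some (i, x) \<in> topspace ?W" for i x
    using that unfolding topspace_wedge_topology wedge_incl_def by (auto split: if_splits)
  have "\<exists>i. \<rho> i y \<noteq> \<rho> i z"
  proof (cases y)
    case None
    then obtain i x where "z = Some (i, x)" using yz by (cases z) auto
    then show ?thesis using None ne yz by (intro exI[of _ i]) (auto simp: \<rho>_def)
  next
    case (Some p)
    then obtain i x where y: "y = Some (i, x)" by (cases p) auto
    then show ?thesis using ne yz
      by (intro exI[of _ i]) (auto simp: \<rho>_def split: option.splits)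
  qed
  then show "\<exists>f. continuous_map ?W X f \<and> f y \<noteq> f z" using c by blast
qed

text \<open>Stereographic projection: for points of the triangle, given by barycentric coordinates, the
  interior is identified with the plane by \<open>((p - 1/3) / m, (q - 1/3) / m)\<close>, where \<open>m\<close>
  vanishes on the boundary only. The last summand of \<open>Q\<close> vanishes on the triangle; it
  keeps the denominator positive at points outside the triangle.\<close>

definition triangle_sphere :: "real \<Rightarrow> real \<Rightarrow> real \<Rightarrow> nat \<Rightarrow> real" where
  "triangle_sphere p q r = (\<lambda>j.
     let m = 3 * min p (min q r); Q = (p - 1/3)\<^sup>2 + (q - 1/3)\<^sup>2 + (1 - p - q - r)\<^sup>2 in
     (if j = 0 then Q - m\<^sup>2 else if j = 1 then 2 * m * (p - 1/3) else if j = 2 then 2 * m * (q - 1/3) else 0)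
       / (Q + m\<^sup>2))"

text \<open>If every square vanished, then \<open>p = q = r = 1/3\<close>, and the minimum would be
  \<open>1/3\<close> instead of 0.\<close>

lemma triangle_sphere_denominator:
  fixes p q r :: real
  shows "0 < (p - 1/3)\<^sup>2 + (q - 1/3)\<^sup>2 + (1 - p - q - r)\<^sup>2 + (3 * min p (min q r))\<^sup>2"
proof (rule ccontr)
  assume "\<not> ?thesis"
  then have "(p - 1/3)\<^sup>2 + (q - 1/3)\<^sup>2 + (1 - p - q - r)\<^sup>2 + (3 * min p (min q r))\<^sup>2 = 0"
    by (smt (verit) zero_le_power2)
  moreover have "a = 0 \<and> b = 0 \<and> c = 0 \<and> d = 0" if "a\<^sup>2 + b\<^sup>2 + c\<^sup>2 + d\<^sup>2 = 0" for a b c d :: real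
    using that by (simp add: add_nonneg_eq_0_iff)
  ultimately have 0: "p - 1/3 = 0" "q - 1/3 = 0" "1 - p - q - r = 0" "3 * min p (min q r) = 0"
    by blast+
  have "p = 1/3" "q = 1/3" using 0 by simp_all
  moreover from this have "r = 1/3" using 0 by simp
  ultimately have "min p (min q r) = 1/3" by (simp only: min.idem)
  then show False using 0 by simp
qed

text \<open>The two alternatives cover points of the triangle and points of the complex outside its
  interior. Either way the least coordinate times \<open>1 - p - q - r\<close> is 0, which is the
  only error term in the identity for the stereographic formula.\<close>

lemma triangle_sphere_in_nsphere:
  assumes "p + q + r = 1 \<or> min p (min q r) = 0"
  shows "triangle_sphere p q r \<in> topspace (nsphere 2)"
proof -
  define m where "m = 3 * min p (min q r)"
  define d where "d = 1 - p - q - r"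
  define Q where "Q = (p - 1/3)\<^sup>2 + (q - 1/3)\<^sup>2 + d\<^sup>2"
  have N: "Q + m\<^sup>2 > 0"
    using triangle_sphere_denominator[of p q r] unfolding Q_def m_def d_def .
  have md: "m * d = 0" using assms unfolding m_def d_def by auto
  have "(Q - m\<^sup>2)\<^sup>2 + (2 * m * (p - 1/3))\<^sup>2 + (2 * m * (q - 1/3))\<^sup>2 = (Q + m\<^sup>2)\<^sup>2 - 4 * (m * d)\<^sup>2"
    unfolding Q_def by (simp add: power2_eq_square algebra_simps)
  then have *: "(Q - m\<^sup>2)\<^sup>2 + (2 * m * (p - 1/3))\<^sup>2 + (2 * m * (q - 1/3))\<^sup>2 = (Q + m\<^sup>2)\<^sup>2"
    using md by simp
  have ts: "triangle_sphere p q r j = (if j = 0 then Q - m\<^sup>2 else if j = 1 then 2 * m * (p - 1/3)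
      else if j = 2 then 2 * m * (q - 1/3) else 0) / (Q + m\<^sup>2)" for j
    unfolding triangle_sphere_def Let_def Q_def m_def d_def by simp
  have "(\<Sum>i\<le>2. (triangle_sphere p q r i)\<^sup>2) =
      ((Q - m\<^sup>2)\<^sup>2 + (2 * m * (p - 1/3))\<^sup>2 + (2 * m * (q - 1/3))\<^sup>2) / (Q + m\<^sup>2)\<^sup>2"
    by (simp add: ts numeral_2_eq_2 power_divide add_divide_distrib)
  also have "\<dots> = 1" unfolding * using N by simp
  finally show ?thesis
    unfolding nsphere by (simp add: ts)
qed

abbreviation sphere_base :: "nat \<Rightarrow> real" where
  "sphere_base \<equiv> \<lambda>j. if j = 0 then 1 else 0"

lemma triangle_sphere_eq_base_iff:
  "triangle_sphere p q r = sphere_base \<longleftrightarrow> min p (min q r) = 0"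
proof
  assume "triangle_sphere p q r = sphere_base"
  then have "triangle_sphere p q r 0 = 1" by simp
  then show "min p (min q r) = 0"
    using triangle_sphere_denominator[of p q r]
    unfolding triangle_sphere_def Let_def by (simp add: divide_eq_eq)
next
  assume *: "min p (min q r) = 0"
  show "triangle_sphere p q r = sphere_base"
    using triangle_sphere_denominator[of p q r]
    unfolding triangle_sphere_def Let_def * by (auto intro!: ext)
qed

text \<open>The sphere determines the plane point, hence \<open>(p', q', r')\<close> is displaced
  from the barycentre by \<open>c\<close> times the displacement of \<open>(p, q, r)\<close>, where
  \<open>c\<close> is the ratio of the least coordinates. The displacement of the least coordinate
  scales by \<open>c\<close> as well, and comparing the two relations gives
  \<open>c = 1\<close>.\<close>

lemma triangle_sphere_inj:
  assumes "0 < min p (min q r)" "p + q + r = 1" "0 < min p' (min q' r')" "p' + q' + r' = 1"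
    and eq: "triangle_sphere p q r = triangle_sphere p' q' r'"
  shows "p = p' \<and> q = q' \<and> r = r'"
proof -
  have ratio: "(triangle_sphere p q r 1) / (1 - triangle_sphere p q r 0) = (p - 1/3) / (3 * min p (min q r))"
       "(triangle_sphere p q r 2) / (1 - triangle_sphere p q r 0) = (q - 1/3) / (3 * min p (min q r))"
    if "0 < min p (min q r)" for p q r
  proof -
    define m where "m = 3 * min p (min q r)"
    define Q where "Q = (p - 1/3)\<^sup>2 + (q - 1/3)\<^sup>2 + (1 - p - q - r)\<^sup>2"
    have N: "Q + m\<^sup>2 > 0"
      using triangle_sphere_denominator[of p q r] unfolding Q_def m_def .
    have "m > 0" using that unfolding m_def by simp
    have ts: "triangle_sphere p q r j = (if j = 0 then Q - m\<^sup>2 else if j = 1 then 2 * m * (p - 1/3)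
        else if j = 2 then 2 * m * (q - 1/3) else 0) / (Q + m\<^sup>2)" for j
      unfolding triangle_sphere_def Let_def Q_def m_def by simp
    have 1: "1 - triangle_sphere p q r 0 = 2 * m\<^sup>2 / (Q + m\<^sup>2)"
      using N by (simp add: ts field_simps)
    show "(triangle_sphere p q r 1) / (1 - triangle_sphere p q r 0) = (p - 1/3) / (3 * min p (min q r))"
       "(triangle_sphere p q r 2) / (1 - triangle_sphere p q r 0) = (q - 1/3) / (3 * min p (min q r))"
      unfolding 1 unfolding ts m_def[symmetric] using N \<open>m > 0\<close> by (simp_all add: power2_eq_square)
  qed
  define k k' where "k = min p (min q r)" and "k' = min p' (min q' r')"
  have k: "k > 0" "k' > 0" using assms unfolding k_def k'_def by auto
  define c where "c = k' / k"
  have "(p - 1/3) / (3 * k) = (p' - 1/3) / (3 * k')" "(q - 1/3) / (3 * k) = (q' - 1/3) / (3 * k')"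
    using ratio[OF assms(1)] ratio[OF assms(3)] eq unfolding k_def k'_def by simp_all
  then have pq: "p' - 1/3 = c * (p - 1/3)" "q' - 1/3 = c * (q - 1/3)"
    using k unfolding c_def by (simp_all add: field_simps)
  have "r' - 1/3 = - (p' - 1/3) - (q' - 1/3)" using assms by simp
  also have "\<dots> = c * (r - 1/3)"
  proof -
    have "r = 1 - p - q" using assms(2) by simp
    show ?thesis unfolding pq \<open>r = _\<close> by (simp add: algebra_simps)
  qed
  finally have r: "r' - 1/3 = c * (r - 1/3)" .
  have c0: "c > 0" using k unfolding c_def by simp
  have aff: "min x (min y z) - 1/3 = min (x - 1/3) (min (y - 1/3) (z - 1/3))" for x y z :: real
    by (simp add: min_diff_distrib_left)
  have "k' - 1/3 = c * (k - 1/3)"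
    unfolding k_def k'_def aff pq r using c0 by (simp add: min_mult_distrib_left)
  then have "k' - 1/3 = k' - c / 3" using k unfolding c_def by (simp add: field_simps)
  then have "c = 1" by simp
  then show ?thesis using pq r by simp
qed

lemma triangle_sphere_surj:
  assumes z: "z \<in> topspace (nsphere 2)" and "z \<noteq> sphere_base"
  obtains p q r where "0 < min p (min q r)" "p + q + r = 1" "triangle_sphere p q r = z"
proof -
  have s: "(z 0)\<^sup>2 + (z 1)\<^sup>2 + (z 2)\<^sup>2 = 1" and z3: "\<And>j. j > 2 \<Longrightarrow> z j = 0"
    using z unfolding nsphere by (auto simp: numeral_2_eq_2)
  have "z 0 \<noteq> 1"
  proof
    assume "z 0 = 1"
    then have "(z 1)\<^sup>2 + (z 2)\<^sup>2 = 0" using s by simp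
    then have "z 1 = 0" "z 2 = 0" by (simp_all add: add_nonneg_eq_0_iff)
    have "z j = sphere_base j" for j
    proof -
      consider "j = 0" | "j = 1" | "j = 2" | "j > 2" by linarith
      then show ?thesis using \<open>z 0 = 1\<close> \<open>z 1 = 0\<close> \<open>z 2 = 0\<close> z3 by cases auto
    qed
    then show False using assms(2) by blast
  qed
  moreover have "(z 0)\<^sup>2 \<le> 1" using s by (smt (verit) zero_le_power2)
  then have "z 0 \<le> 1" by (simp add: abs_square_le_1)
  ultimately have z0: "z 0 < 1" by simp
  \<comment> \<open>The stereographic image of \<open>z\<close>, completed to a displacement from
    the barycentre with coordinate sum 0.\<close>
  define w1 w2 w3 where "w1 = z 1 / (1 - z 0)" and "w2 = z 2 / (1 - z 0)" and "w3 = - w1 - w2"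
  define u where "u = min w1 (min w2 w3)"
  \<comment> \<open>The scale must be three times the least coordinate it produces, i.e.
    \<open>m = 3 * (1/3 + m * u)\<close>; this is the solution.\<close>
  define m where "m = 1 / (1 - 3 * u)"
  have "u \<le> 0" unfolding u_def w3_def by (auto simp: min_def)
  then have m: "m > 0" "3 * m * u = m - 1" unfolding m_def by (auto simp: field_simps)
  define p q r where "p = 1/3 + m * w1" and "q = 1/3 + m * w2" and "r = 1/3 + m * w3"
  have "min p (min q r) = 1/3 + m * u"
    unfolding p_def q_def r_def u_def using m
    by (simp add: min_add_distrib_right min_mult_distrib_left)
  then have k: "3 * min p (min q r) = m" using m by simp
  have pqr: "p + q + r = 1" unfolding p_def q_def r_def w3_def by (simp add: algebra_simps)
  define W where "W = w1\<^sup>2 + w2\<^sup>2"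
  have "(z 1)\<^sup>2 + (z 2)\<^sup>2 = (1 + z 0) * (1 - z 0)" using s by (simp add: power2_eq_square algebra_simps)
  then have W: "W = (1 + z 0) / (1 - z 0)"
    unfolding W_def w1_def w2_def using z0
    by (simp add: power_divide add_divide_distrib[symmetric]) (simp add: power2_eq_square)
  have W1: "W + 1 = 2 / (1 - z 0)" "W - 1 = 2 * z 0 / (1 - z 0)"
    unfolding W using z0 by (simp_all add: field_simps)
  have Q: "(p - 1/3)\<^sup>2 + (q - 1/3)\<^sup>2 + (1 - p - q - r)\<^sup>2 = m\<^sup>2 * W"
    unfolding W_def using pqr unfolding p_def q_def
    by (simp add: power_mult_distrib algebra_simps)
  have "triangle_sphere p q r j = z j" for j
  proof -
    have d: "m\<^sup>2 * W + m\<^sup>2 = m\<^sup>2 * (W + 1)" "m\<^sup>2 * W - m\<^sup>2 = m\<^sup>2 * (W - 1)" by (simp_all add: algebra_simps)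
    have e: "2 * m * (p - 1/3) = m\<^sup>2 * (2 * w1)" "2 * m * (q - 1/3) = m\<^sup>2 * (2 * w2)"
      unfolding p_def q_def by (simp_all add: power2_eq_square)
    have ts: "triangle_sphere p q r j = (if j = 0 then (W - 1) / (W + 1) else if j = 1 then 2 * w1 / (W + 1)
      else if j = 2 then 2 * w2 / (W + 1) else 0)"
      unfolding triangle_sphere_def Let_def k Q d e using m by simp
    consider "j = 0" | "j = 1" | "j = 2" | "j > 2" by linarith
    then show ?thesis
      using z3 z0 unfolding ts W1 w1_def w2_def by cases auto
  qed
  then have "triangle_sphere p q r = z" by (rule ext)
  then show thesis using that[of p q r] pqr k m by linarith
qed

section \<open>Attaching triangles to a contractible complex\<close>

lemma sphere_base_in_nsphere: "sphere_base \<in> topspace (nsphere 2)"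
  unfolding nsphere by (auto simp: numeral_2_eq_2)

lemma Hausdorff_space_nsphere: "Hausdorff_space (nsphere n)"
  unfolding nsphere by (intro Hausdorff_space_subtopology) (simp add: Hausdorff_space_product_topology)

lemma continuous_map_into_supercomplex:
  assumes "continuous_map Z (geometric_realization L) f" "L \<subseteq> K"
  shows "continuous_map Z (geometric_realization K) f"
  using assms(1) realization_subcomplex[OF assms(2)] continuous_map_into_fulltopology by metis

text \<open>Maximality makes \<open>K - T\<close> a complex and ensures that at each point at most
  one member of \<open>T\<close> has a nonzero least coordinate.\<close>

locale maximal_triangles =
  fixes K T :: "'a set set"
  assumes K: "fin_complex K" and T: "T \<subseteq> K" "\<And>t. t \<in> T \<Longrightarrow> card t = 3"
    and maximal: "\<And>s t. t \<in> T \<Longrightarrow> s \<in> K \<Longrightarrow> t \<subseteq> s \<Longrightarrow> s = t"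
begin

abbreviation X where "X \<equiv> geometric_realization K"
abbreviation A where "A \<equiv> geometric_realization (K - T)"
abbreviation I where "I \<equiv> top_of_set {0..1::real}"
abbreviation W where "W \<equiv> wedge_topology (\<lambda>_::nat. nsphere 2) (\<lambda>_. sphere_base) {..<card T}"

definition min_coord :: "'a set \<Rightarrow> ('a \<Rightarrow> real) \<Rightarrow> real" where "min_coord t x = Min (x ` t)"

lemma finite_T: "finite T" using T(1) fin_complexD(1)[OF K] finite_subset by blast

lemma finite_triangle: "finite t" "t \<noteq> {}" if "t \<in> T" for t
  using T(2)[OF that] by (auto intro: card_ge_0_finite)

lemma fin_complex_diff: "fin_complex (K - T)"
  using K maximal T(1) unfolding fin_complex_def by (blast intro: finite_subset)

lemma topspace_A_iff: "x \<in> topspace A \<longleftrightarrow> x \<in> topspace X \<and> {v. x v \<noteq> 0} \<notin> T" for x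
  unfolding geometric_realization_def by auto

lemma barycentre: "\<exists>x\<in>topspace (geometric_realization L). {v. x v \<noteq> 0} = s"
  if L: "fin_complex L" "s \<in> L" for s and L :: "'a set set"
proof -
  have s: "finite s" "s \<noteq> {}" using fin_complexD[OF L(1)] L(2) by blast+
  define x where "x = (\<lambda>v. if v \<in> s then 1 / real (card s) else 0)"
  have supp: "{v. x v \<noteq> 0} = s" unfolding x_def using s by auto
  moreover have "sum x s = 1" unfolding x_def using s by simp
  moreover have "0 \<le> x v" for v unfolding x_def by simp
  ultimately have "x \<in> topspace (geometric_realization L)"
    using L(2) unfolding geometric_realization_def by simp
  then show ?thesis using supp by blast
qed

lemma min_coord_attained: "\<exists>v\<in>t. x v = min_coord t x" if "t \<in> T" for t x
proof -
  have "min_coord t x \<in> x ` t" unfolding min_coord_def using finite_triangle[OF that] by (intro Min_in) auto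
  then show ?thesis by auto
qed

lemma min_coord_le: "min_coord t x \<le> x v" if "t \<in> T" "v \<in> t" for t x v
  unfolding min_coord_def using finite_triangle[OF that(1)] that(2) by auto

lemma min_coord_eq_0: "min_coord t x = 0" if "t \<in> T" "x \<in> topspace X" "{v. x v \<noteq> 0} \<noteq> t" for t x
proof -
  have "\<not> t \<subseteq> {v. x v \<noteq> 0}"
    using maximal[OF that(1) realization_support(1)[OF that(2)]] that(3) by blast
  then obtain v where "v \<in> t" "x v = 0" by blast
  then have "min_coord t x \<le> 0" using min_coord_le[OF that(1), of v x] by simp
  moreover have "min_coord t x \<ge> 0"
    using min_coord_attained[OF that(1), of x] realization_support(2)[OF that(2)] by metis
  ultimately show ?thesis by simp
qed

lemma min_coord_pos: "0 < min_coord t x" if "t \<in> T" "x \<in> topspace X" "{v. x v \<noteq> 0} = t" for t x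
proof -
  obtain v where "v \<in> t" "x v = min_coord t x" using min_coord_attained[OF \<open>t \<in> T\<close>] by blast
  then have "min_coord t x \<noteq> 0" using that(3) by auto
  then show ?thesis using realization_support(2)[OF that(2), of v] \<open>x v = min_coord t x\<close> by simp
qed

lemma sum_single: "(\<Sum>t\<in>{t\<in>T. P t}. f t) = (if P s then f s else 0)"
  if "s \<in> T" "\<And>t. t \<in> T \<Longrightarrow> t \<noteq> s \<Longrightarrow> f t = 0" for P s and f :: "'a set \<Rightarrow> real"
proof -
  have "(\<Sum>t\<in>{t\<in>T. P t}. f t) = (\<Sum>t\<in>T. if P t then f t else 0)"
    using finite_T by (simp add: sum.inter_filter)
  also have "\<dots> = (\<Sum>t\<in>T. if t = s then (if P s then f s else 0) else 0)"
    using that(2) by (intro sum.cong) auto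
  finally show ?thesis using finite_T that(1) by simp
qed
text \<open>At most one summand is nonzero at a point of \<open>X\<close>, so this is the least
  coordinate in the triangle carrying the point. Writing it as a sum makes continuity
  immediate.\<close>

definition total_min :: "('a \<Rightarrow> real) \<Rightarrow> real" where "total_min x = (\<Sum>t\<in>T. min_coord t x)"

text \<open>\<open>push\<close> moves the points of a triangle away from its barycentre. At time \<open>r\<close> those with least
  coordinate at most \<open>r / 4\<close> have arrived at the boundary; from then on the homotopy below follows
  the contraction of the subcomplex \<open>A\<close>.\<close>

definition push_amount :: "real \<times> ('a \<Rightarrow> real) \<Rightarrow> 'a set \<Rightarrow> real" where
  "push_amount p t = min (min_coord t (snd p)) (fst p / 4)"

definition push :: "real \<times> ('a \<Rightarrow> real) \<Rightarrow> 'a \<Rightarrow> real" where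
  "push p v = (snd p v - (\<Sum>t\<in>{t\<in>T. v \<in> t}. push_amount p t)) / (1 - 3 * (\<Sum>t\<in>T. push_amount p t))"

lemma total_min_fixes: "total_min x = 0" if "x \<in> topspace A" for x
  using that min_coord_eq_0 unfolding total_min_def topspace_A_iff by (intro sum.neutral) auto

lemma total_min_in_triangle: "total_min x = min_coord t x" if "t \<in> T" "x \<in> topspace X" "{v. x v \<noteq> 0} = t" for t x
  using sum_single[of t "\<lambda>t. min_coord t x" "\<lambda>_. True"] min_coord_eq_0[OF _ that(2)] that(1,3) unfolding total_min_def by simp

lemma push_fixes: "push (r, x) = x" if "x \<in> topspace A" "r \<in> {0..1}" for r x
proof -
  have x: "x \<in> topspace X" "{v. x v \<noteq> 0} \<notin> T" using that(1) topspace_A_iff by auto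
  have "push_amount (r, x) t = 0" if "t \<in> T" for t
  proof -
    have "min_coord t x = 0" using min_coord_eq_0[OF that x(1)] x(2) that by blast
    then show ?thesis using \<open>r \<in> _\<close> unfolding push_amount_def by simp
  qed
  then show ?thesis unfolding push_def by simp
qed

lemma push_amount_other: "push_amount (r, x) t' = 0" if "x \<in> topspace X" "{v. x v \<noteq> 0} = t" "r \<in> {0..1}" "t' \<in> T" "t' \<noteq> t" for r x t t'
  using min_coord_eq_0[OF that(4,1)] that unfolding push_amount_def by auto

lemma sum_push_amount: "(\<Sum>t\<in>T. push_amount (r, x) t) = push_amount (r, x) t"
  if "t \<in> T" "x \<in> topspace X" "{v. x v \<noteq> 0} = t" "r \<in> {0..1}" for t r x
  using sum_single[of t "push_amount (r, x)" "\<lambda>_. True"] push_amount_other[OF that(2,3,4)] that(1) by simp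

text \<open>The least coordinate reaches \<open>1/3\<close> at a barycentre, where subtracting all
  of it would leave no mass to rescale. The cap \<open>1/4\<close> keeps the denominator of
  \<open>push\<close> at \<open>1/4\<close> or more.\<close>

lemma push_amount_le: "push_amount (r, x) t \<le> 1/4" "push_amount (r, x) t \<le> min_coord t x" if "r \<in> {0..1}" for r x t
  using that unfolding push_amount_def by auto

lemma push_in_triangle: "push (r, x) = (\<lambda>v. (x v - (if v \<in> t then push_amount (r, x) t else 0)) / (1 - 3 * push_amount (r, x) t))"
  if "t \<in> T" "x \<in> topspace X" "{v. x v \<noteq> 0} = t" "r \<in> {0..1}" for t r x
  unfolding push_def sum_push_amount[OF that] using sum_single[of t "push_amount (r, x)"] push_amount_other[OF that(2,3,4)] that(1)
  by (auto intro!: ext)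

lemma push_support: "{v. push (r, x) v \<noteq> 0} \<subseteq> t"
  if "t \<in> T" "x \<in> topspace X" "{v. x v \<noteq> 0} = t" "r \<in> {0..1}" for t r x
  unfolding push_in_triangle[OF that] using that(3) by auto

lemma push_in_X: "push (r, x) \<in> topspace X" if x: "x \<in> topspace X" and r: "r \<in> {0..1}" for r x
proof (cases "{v. x v \<noteq> 0} \<in> T")
  case False
  then have "x \<in> topspace A" using x topspace_A_iff by blast
  then show ?thesis using push_fixes r x by simp
next
  case True
  then obtain t where t: "t \<in> T" "{v. x v \<noteq> 0} = t" by blast
  define d where "d = push_amount (r, x) t"
  have d: "d \<le> 1/4" "\<And>v. v \<in> t \<Longrightarrow> d \<le> x v"
    using push_amount_le[OF r, where x = x and t = t] min_coord_le[OF t(1), where x = x] unfolding d_def by force+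
  note push = push_in_triangle[OF t(1) x t(2) r, folded d_def]
  have "0 \<le> push (r, x) v" for v
    unfolding push using d realization_support(2)[OF x, of v] by (auto intro!: divide_nonneg_nonneg)
  moreover have "sum (push (r, x)) t = 1"
  proof -
    have "sum (push (r, x)) t = (sum x t - 3 * d) / (1 - 3 * d)"
      unfolding push using T(2)[OF t(1)]
      by (simp add: sum_divide_distrib[symmetric] sum_subtractf)
    also have "sum x t = 1" using realization_support(3)[OF x] t(2) by simp
    finally show ?thesis using d(1) by simp
  qed
  ultimately show ?thesis
    using push_support[OF t(1) x t(2) r] t(1) T(1) topspace_realization[OF K] by blast
qed

text \<open>By \<open>rM\<close> the cap \<open>r / 4\<close> is not active, so a least coordinate
  drops to 0. The new support is a proper face of the triangle, hence not in \<open>T\<close> by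
  maximality.\<close>

lemma push_into_A: "push (r, x) \<in> topspace A" if x: "x \<in> topspace X" and r: "r \<in> {0..1}" and rM: "4 * total_min x \<le> r" for r x
proof (cases "{v. x v \<noteq> 0} \<in> T")
  case False
  then have "x \<in> topspace A" using x topspace_A_iff by blast
  then show ?thesis using push_fixes r by simp
next
  case True
  then obtain t where t: "t \<in> T" "{v. x v \<noteq> 0} = t" by blast
  have "push_amount (r, x) t = min_coord t x" using rM total_min_in_triangle[OF t(1) x t(2)] unfolding push_amount_def by auto
  then obtain v where v: "v \<in> t" "push (r, x) v = 0"
    unfolding push_in_triangle[OF t(1) x t(2) r] using min_coord_attained[OF t(1), of x] by force
  have "{v. push (r, x) v \<noteq> 0} \<notin> T"
    using maximal[of "{v. push (r, x) v \<noteq> 0}" t] t(1) T(1) push_support[OF t(1) x t(2) r] v by blast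
  then show ?thesis using push_in_X[OF x r] topspace_A_iff by blast
qed

lemma continuous_map_min_coord: "continuous_map (prod_topology I X) euclideanreal (\<lambda>p. min_coord t (snd p))" if "t \<in> T" for t
  unfolding min_coord_def using finite_triangle[OF that] by (intro continuous_map_Min continuous_map_snd_coordinate)

lemma continuous_map_total_min: "continuous_map (prod_topology I X) euclideanreal (\<lambda>p. total_min (snd p))"
  unfolding total_min_def using finite_T continuous_map_min_coord by (intro continuous_map_sum) auto

lemma continuous_map_push_amount: "continuous_map (prod_topology I X) euclideanreal (\<lambda>p. push_amount p t)" if "t \<in> T" for t
  unfolding push_amount_def using continuous_map_min_coord[OF that]
  by (intro continuous_map_real_min continuous_map_real_divide continuous_map_fst_interval) auto

lemma continuous_map_push: "continuous_map (prod_topology I X) euclideanreal (\<lambda>p. push p v)" for v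
proof -
  have "1 - 3 * (\<Sum>t\<in>T. push_amount p t) \<noteq> 0" if p: "p \<in> topspace (prod_topology I X)" for p
  proof -
    obtain r x where rx: "p = (r, x)" "r \<in> {0..1}" "x \<in> topspace X" using p by auto
    show ?thesis
    proof (cases "{v. x v \<noteq> 0} \<in> T")
      case True
      then show ?thesis using sum_push_amount[OF True rx(3) refl rx(2)] push_amount_le(1)[OF rx(2), of x "{v. x v \<noteq> 0}"] rx(1)
        by auto
    next
      case False
      then have "push_amount p t = 0" if "t \<in> T" for t
      proof -
        have "min_coord t x = 0" using min_coord_eq_0[OF that rx(3)] False that by blast
        then show ?thesis using rx unfolding push_amount_def by simp
      qed
      then show ?thesis by simp
    qed
  qed
  then show ?thesis
    unfolding push_def using finite_T continuous_map_push_amount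
    by (intro continuous_map_real_divide continuous_map_diff continuous_map_snd_coordinate
        continuous_map_sum continuous_map_real_mult) auto
qed

text \<open>An explicit instance of homotopy extension: the contraction of \<open>A\<close> is
  extended to all of \<open>X\<close>, in the form that \<open>quotient_homotopy_equivalent\<close>
  asks for.\<close>

lemma homotopy_to_constant:
  assumes "contractible_space A"
  shows "\<exists>\<Phi> a. continuous_map (prod_topology I X) X \<Phi> \<and>
    (\<forall>x\<in>topspace X. \<Phi> (0, x) = x) \<and>
    (\<forall>r\<in>{0..1}. \<forall>x\<in>topspace A. \<Phi> (r, x) \<in> topspace A) \<and>
    (\<forall>x\<in>topspace A. \<Phi> (1, x) = a)"
proof -
  obtain a H where H: "continuous_map (prod_topology I A) A H"
    and H0: "\<And>x. x \<in> topspace A \<Longrightarrow> H (0, x) = x" and H1: "\<And>x. H (1, x) = a"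
    using assms unfolding contractible_space_def homotopic_with_def by auto
  have HA: "H (r, x) \<in> topspace A" if "r \<in> {0..1}" "x \<in> topspace A" for r x
    using continuous_map_funspace[OF H] that by auto
  \<comment> \<open>The clock of \<open>H\<close> starts when the point arrives in \<open>A\<close>,
    at time \<open>4 * total_min\<close>. It reads 0 there, so the branches agree; on
    \<open>A\<close> it starts at once. Points with least coordinate above \<open>1/4\<close> do not
    arrive before time 1.\<close>
  define \<Phi> where "\<Phi> = (\<lambda>p. if 4 * total_min (snd p) \<le> fst p then H (fst p - 4 * total_min (snd p), push p) else push p)"
  have total_min_nonneg: "0 \<le> total_min x" if "x \<in> topspace X" for x
    using total_min_fixes[of x] total_min_in_triangle[of _ x] min_coord_pos[of _ x] that topspace_A_iff[of x] by (metis less_eq_real_def)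
  have cont_\<Phi>: "continuous_map (prod_topology I X) X \<Phi>"
    unfolding \<Phi>_def
  proof (rule continuous_map_cases_le)
    let ?P = "prod_topology I X"
    let ?P1 = "subtopology ?P {x \<in> topspace ?P. 4 * total_min (snd x) \<le> fst x}"
    show "continuous_map ?P euclideanreal (\<lambda>p. 4 * total_min (snd p))"
      using continuous_map_total_min by (intro continuous_intros) auto
    show "continuous_map ?P euclideanreal fst" by (rule continuous_map_fst_interval)
    have "continuous_map ?P X push"
      using continuous_map_push push_in_X by (intro continuous_map_into_realization) auto
    then show "continuous_map (subtopology ?P {x \<in> topspace ?P. fst x \<le> 4 * total_min (snd x)}) X push"
      by (rule continuous_map_from_subtopology)
    have 1: "continuous_map ?P1 A push"
      using continuous_map_push push_into_A
      by (intro continuous_map_into_realization continuous_map_from_subtopology) auto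
    have "continuous_map ?P euclideanreal (\<lambda>p. fst p - 4 * total_min (snd p))"
      using continuous_map_total_min by (intro continuous_intros continuous_map_fst_interval) auto
    moreover have "fst p - 4 * total_min (snd p) \<in> {0..1}" if "p \<in> topspace ?P1" for p
      using that total_min_nonneg[of "snd p"] by auto
    ultimately have 2: "continuous_map ?P1 I (\<lambda>p. fst p - 4 * total_min (snd p))"
      by (auto simp: continuous_map_in_subtopology intro: continuous_map_from_subtopology)
    have "continuous_map ?P1 A (H \<circ> (\<lambda>p. (fst p - 4 * total_min (snd p), push p)))"
      using 1 2 by (intro continuous_map_compose[OF _ H]) (simp add: continuous_map_pairwise o_def)
    then have "continuous_map ?P1 X (H \<circ> (\<lambda>p. (fst p - 4 * total_min (snd p), push p)))"
      by (rule continuous_map_into_supercomplex) auto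
    then show "continuous_map ?P1 X (\<lambda>p. H (fst p - 4 * total_min (snd p), push p))" by (simp add: o_def)
    fix p assume "p \<in> topspace ?P" "4 * total_min (snd p) = fst p"
    then show "H (fst p - 4 * total_min (snd p), push p) = push p"
      using push_into_A[of "snd p" "fst p"] H0 by auto
  qed
  have \<Phi>0: "\<Phi> (0, x) = x" if x: "x \<in> topspace X" for x
  proof (cases "x \<in> topspace A")
    case True
    then show ?thesis using total_min_fixes H0 push_fixes unfolding \<Phi>_def by auto
  next
    case False
    then obtain t where t: "t \<in> T" "{v. x v \<noteq> 0} = t" using x topspace_A_iff by blast
    have min_coord: "min_coord t x > 0" by (rule min_coord_pos[OF t(1) x t(2)])
    then have "push_amount (0, x) t = 0" unfolding push_amount_def by simp
    then have "push (0, x) = x" using push_in_triangle[OF t(1) x t(2), of 0] by (auto intro!: ext)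
    then show ?thesis using min_coord total_min_in_triangle[OF t(1) x t(2)] unfolding \<Phi>_def by auto
  qed
  have \<Phi>A: "\<Phi> (r, x) = H (r, x)" if "r \<in> {0..1}" "x \<in> topspace A" for r x
    using that total_min_fixes push_fixes unfolding \<Phi>_def by auto
  show ?thesis
  proof (intro exI[of _ \<Phi>] exI[of _ a] conjI ballI cont_\<Phi>)
    show "\<Phi> (0, x) = x" if "x \<in> topspace X" for x by (rule \<Phi>0[OF that])
    show "\<Phi> (r, x) \<in> topspace A" if "r \<in> {0..1}" "x \<in> topspace A" for r x
      using \<Phi>A[OF that] HA[OF that] by simp
    show "\<Phi> (1, x) = a" if "x \<in> topspace A" for x using \<Phi>A[of 1 x] that H1 by simp
  qed
qed

text \<open>Each open triangle of \<open>T\<close> is wrapped around its own sphere minus the base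
  point by \<open>triangle_sphere\<close>, and \<open>A\<close> goes to the base point.
  \<open>ne\<close> makes \<open>A\<close> nonempty, so the base point is attained.\<close>

lemma quotient_onto_wedge:
  assumes ne: "K \<noteq> T"
  shows "\<exists>q. continuous_map X W q \<and> q ` topspace X = topspace W \<and>
    (\<forall>x\<in>topspace X. \<forall>x'\<in>topspace X. q x = q x' \<longleftrightarrow> x = x' \<or> (x \<in> topspace A \<and> x' \<in> topspace A))"
proof -
  obtain e where e: "bij_betw e {..<card T} T"
    using ex_bij_betw_nat_finite[OF finite_T] unfolding atLeast0LessThan by blast
  have "\<exists>v. \<forall>i\<in>{..<card T}. e i = {v i 0, v i 1, v i (2::nat)}"
  proof -
    have "\<exists>v. e i = {v 0, v 1, v (2::nat)}" if "i \<in> {..<card T}" for i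
    proof -
      have "card (e i) = 3" using T(2) e that unfolding bij_betw_def by blast
      then obtain x y z where "e i = {x, y, z}" unfolding card_3_iff by blast
      then show ?thesis by (intro exI[of _ "\<lambda>j. if j = 0 then x else if j = 1 then y else z"]) auto
    qed
    then show ?thesis by metis
  qed
  then obtain v where v: "\<And>i. i < card T \<Longrightarrow> e i = {v i 0, v i 1, v i (2::nat)}" by blast
  have eT: "e i \<in> T" if "i < card T" for i using e that unfolding bij_betw_def by auto
  have v_distinct: "v i 0 \<noteq> v i 1" "v i 0 \<noteq> v i 2" "v i 1 \<noteq> v i 2" if "i < card T" for i
    using T(2)[OF eT[OF that]] unfolding v[OF that] by (auto simp: card_insert_if split: if_splits)
  define \<phi> where "\<phi> = (\<lambda>i (x :: 'a \<Rightarrow> real). triangle_sphere (x (v i 0)) (x (v i 1)) (x (v i (2::nat))))"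
  have min_coord_eq: "min (x (v i 0)) (min (x (v i 1)) (x (v i 2))) = min_coord (e i) x" if "i < card T" for i and x :: "'a \<Rightarrow> real"
    unfolding min_coord_def v[OF that] by (simp add: min.assoc)
  have sum3: "x (v i 0) + x (v i 1) + x (v i 2) = 1"
    if "i < card T" "x \<in> topspace X" "{v. x v \<noteq> 0} = e i" for i and x :: "'a \<Rightarrow> real"
    using realization_support(3)[OF that(2)] v_distinct[OF that(1)] unfolding that(3) v[OF that(1)] by simp
  have \<phi>_S: "\<phi> i x \<in> topspace (nsphere 2)" if "i < card T" "x \<in> topspace X" for i and x :: "'a \<Rightarrow> real"
    unfolding \<phi>_def
    using sum3[OF that] min_coord_eq_0[OF eT[OF that(1)] that(2)] min_coord_eq[OF that(1), of x]
    by (intro triangle_sphere_in_nsphere) auto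
  have \<phi>_base: "\<phi> i x = sphere_base \<longleftrightarrow> {v. x v \<noteq> 0} \<noteq> e i" if "i < card T" "x \<in> topspace X" for i and x :: "'a \<Rightarrow> real"
    unfolding \<phi>_def triangle_sphere_eq_base_iff min_coord_eq[OF that(1)]
    using min_coord_eq_0[OF eT[OF that(1)] that(2)] min_coord_pos[OF eT[OF that(1)] that(2)] by force
  have cont_\<phi>: "continuous_map X (nsphere 2) (\<phi> i)" if i: "i < card T" for i
  proof -
    have "continuous_map X euclideanreal (\<lambda>x. \<phi> i x j)" for j
    proof -
      have "continuous_map X euclideanreal (\<lambda>x. 3 * min (x (v i 0)) (min (x (v i 1)) (x (v i 2))))"
        by (intro continuous_map_real_mult continuous_map_real_min continuous_map_coordinate) auto
      note cs = this continuous_map_coordinate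
      have N: "(x (v i 0) - 1/3)\<^sup>2 + (x (v i 1) - 1/3)\<^sup>2 + (1 - x (v i 0) - x (v i 1) - x (v i 2))\<^sup>2
           + (3 * min (x (v i 0)) (min (x (v i 1)) (x (v i 2))))\<^sup>2 \<noteq> 0"
        for x :: "'a \<Rightarrow> real"
        using triangle_sphere_denominator[of "x (v i 0)" "x (v i 1)" "x (v i 2)"] by simp
      consider "j = 0" | "j = 1" | "j = 2" | "j > 2" by linarith
      then show ?thesis
        unfolding \<phi>_def triangle_sphere_def Let_def using cs N
        by cases (auto intro!: continuous_intros cs)
    qed
    then have "continuous_map X (powertop_real UNIV) (\<phi> i)"
      by (simp add: continuous_map_componentwise_UNIV)
    then show ?thesis
      using \<phi>_S[OF i] unfolding nsphere by (auto simp: continuous_map_in_subtopology)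
  qed
  define ix where "ix = (\<lambda>x. inv_into {..<card T} e {v::'a. x v \<noteq> (0::real)})"
  define q where "q = (\<lambda>x. if {v. x v \<noteq> 0} \<in> T then Some (ix x, \<phi> (ix x) x) else None)"
  have q_eq: "q x = wedge_incl (\<lambda>_. sphere_base) i (\<phi> i x)"
    if "i < card T" "x \<in> topspace X" "{v. x v \<noteq> 0} = e i" for i and x :: "'a \<Rightarrow> real"
  proof -
    have "ix x = i" unfolding ix_def that(3) using e that(1) unfolding bij_betw_def by simp
    then show ?thesis
      using eT[OF that(1)] \<phi>_base[OF that(1,2)] that(3) unfolding q_def wedge_incl_def by auto
  qed
  have supp_T: "\<exists>i<card T. {v. x v \<noteq> 0} = e i" if "{v. x v \<noteq> 0} \<in> T" for x :: "'a \<Rightarrow> real"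
    using that e unfolding bij_betw_def by auto
  have q_W: "q x \<in> topspace W" if "x \<in> topspace X" for x
  proof (cases "{v. x v \<noteq> 0} \<in> T")
    case True
    then obtain i where i: "i < card T" "{v. x v \<noteq> 0} = e i" using supp_T by blast
    then show ?thesis
      using q_eq[OF i(1) that i(2)] \<phi>_S[OF i(1) that] unfolding topspace_wedge_topology by auto
  qed (simp add: q_def topspace_wedge_topology)
  have cont_q: "continuous_map X W q"
    unfolding continuous_map_def
  proof (intro conjI allI impI)
    show "q \<in> topspace X \<rightarrow> topspace W" using q_W by blast
    fix U assume "openin W U"
    then have U: "openin (nsphere 2) {x \<in> topspace (nsphere 2). wedge_incl (\<lambda>_. sphere_base) i x \<in> U}" if "i < card T" for i
      using that unfolding openin_wedge_topology by blast
    define V where "V = (\<lambda>i. {x \<in> topspace X. wedge_incl (\<lambda>_. sphere_base) i (\<phi> i x) \<in> U})"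
    have V: "openin X (V i)" if "i < card T" for i
    proof -
      have "V i = {x \<in> topspace X. \<phi> i x \<in> {x \<in> topspace (nsphere 2). wedge_incl (\<lambda>_. sphere_base) i x \<in> U}}"
        unfolding V_def using \<phi>_S[OF that] by auto
      then show ?thesis using openin_continuous_map_preimage[OF cont_\<phi>[OF that] U[OF that]] by simp
    qed
    have V_iff: "x \<in> V i \<longleftrightarrow> (if {v. x v \<noteq> 0} = e i then q x \<in> U else None \<in> U)"
      if "i < card T" "x \<in> topspace X" for i and x :: "'a \<Rightarrow> real"
      using q_eq[OF that] \<phi>_base[OF that] that unfolding V_def by (auto simp: wedge_incl_def)
    have q_None: "q x = None" if "{v. x v \<noteq> 0} \<notin> T" for x using that unfolding q_def by simp
    show "openin X {x \<in> topspace X. q x \<in> U}"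
    \<comment> \<open>\<open>\<phi> i\<close> sends everything outside the open triangle
      \<open>e i\<close> to the base point. Hence \<open>V i\<close> contains all or none of these
      points, and the preimage is the intersection or the union of the \<open>V i\<close>.\<close>
    proof (cases "None \<in> U")
      case True
      have "{x \<in> topspace X. q x \<in> U} = (\<Inter>i\<in>{..<card T}. V i) \<inter> topspace X"
      proof (intro set_eqI iffI)
        fix x assume "x \<in> {x \<in> topspace X. q x \<in> U}"
        then show "x \<in> (\<Inter>i\<in>{..<card T}. V i) \<inter> topspace X" using V_iff True by auto
      next
        fix x assume x: "x \<in> (\<Inter>i\<in>{..<card T}. V i) \<inter> topspace X"
        show "x \<in> {x \<in> topspace X. q x \<in> U}"
        proof (cases "{v. x v \<noteq> 0} \<in> T")
          case True
          then obtain i where "i < card T" "{v. x v \<noteq> 0} = e i" using supp_T by blast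
          then show ?thesis using V_iff[of i x] x by auto
        qed (use q_None True x in auto)
      qed
      then show ?thesis using V openin_INT[of "{..<card T}" X V] by (simp add: Int_commute)
    next
      case False
      have "{x \<in> topspace X. q x \<in> U} = (\<Union>i\<in>{..<card T}. V i)"
      proof (intro set_eqI iffI)
        fix x assume x: "x \<in> {x \<in> topspace X. q x \<in> U}"
        then have "{v. x v \<noteq> 0} \<in> T" using q_None False by (metis mem_Collect_eq)
        then obtain i where "i < card T" "{v. x v \<noteq> 0} = e i" using supp_T by blast
        then show "x \<in> (\<Union>i\<in>{..<card T}. V i)" using V_iff[of i x] x by auto
      next
        fix x assume "x \<in> (\<Union>i\<in>{..<card T}. V i)"
        then obtain i where i: "i < card T" "x \<in> V i" by auto
        moreover have "x \<in> topspace X" using i unfolding V_def by blast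
        ultimately show "x \<in> {x \<in> topspace X. q x \<in> U}"
          using V_iff[of i x] False by (auto split: if_splits)
      qed
      then show ?thesis using V by auto
    qed
  qed
  have q_onto: "q ` topspace X = topspace W"
  proof (intro equalityI subsetI)
    fix y assume "y \<in> topspace W"
    then consider "y = None" | i z where "i < card T" "z \<in> topspace (nsphere 2)" "y = wedge_incl (\<lambda>_. sphere_base) i z" "z \<noteq> sphere_base"
      unfolding topspace_wedge_topology wedge_incl_def by (auto split: if_splits)
    then show "y \<in> q ` topspace X"
    proof cases
      case 1
      obtain s where "s \<in> K - T" using ne T(1) by blast
      then obtain x where "x \<in> topspace A" using barycentre[OF fin_complex_diff] by blast
      then show ?thesis using 1 topspace_A_iff[of x] unfolding q_def by (force simp: image_iff)
    next
      case (2 i z)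
      obtain a b c where abc: "0 < min a (min b c)" "a + b + c = 1" "triangle_sphere a b c = z"
        using triangle_sphere_surj[OF 2(2,4)] by blast
      define x where "x = (\<lambda>u. if u = v i 0 then a else if u = v i 1 then b else if u = v i 2 then c else 0)"
      have x: "x (v i 0) = a" "x (v i 1) = b" "x (v i 2) = c"
        using v_distinct[OF 2(1)] unfolding x_def by auto
      have supp: "{u. x u \<noteq> 0} = e i"
        using abc(1) unfolding x_def v[OF 2(1)] by (auto simp: min_def split: if_splits)
      have "sum x (e i) = x (v i 0) + x (v i 1) + x (v i 2)"
        using v_distinct[OF 2(1)] unfolding v[OF 2(1)] by simp
      then have "sum x (e i) = 1" unfolding x using abc(2) by simp
      moreover have "0 \<le> x u" for u using abc(1) unfolding x_def by (auto simp: min_def split: if_splits)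
      ultimately have X: "x \<in> topspace X"
        using supp eT[OF 2(1)] T(1) topspace_realization[OF K] by blast
      have "\<phi> i x = z" unfolding \<phi>_def x using abc(3) .
      then show ?thesis using q_eq[OF 2(1) X supp] 2(3) X by force
    qed
  qed (use q_W in auto)
  have q_inj: "q x = q x' \<longleftrightarrow> x = x' \<or> (x \<in> topspace A \<and> x' \<in> topspace A)"
    if x: "x \<in> topspace X" "x' \<in> topspace X" for x x'
  proof
    assume eq: "q x = q x'"
    show "x = x' \<or> (x \<in> topspace A \<and> x' \<in> topspace A)"
    proof (cases "{v. x v \<noteq> 0} \<in> T")
      case False
      then have "{v. x' v \<noteq> 0} \<notin> T" using eq unfolding q_def by (auto split: if_splits)
      then show ?thesis using False x topspace_A_iff by blast
    next
      case True
      then have T': "{v. x' v \<noteq> 0} \<in> T" using eq unfolding q_def by (auto split: if_splits)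
      obtain i where i: "i < card T" "{v. x v \<noteq> 0} = e i" using True supp_T by blast
      obtain i' where i': "i' < card T" "{v. x' v \<noteq> 0} = e i'" using T' supp_T by blast
      have "wedge_incl (\<lambda>_. sphere_base) i (\<phi> i x) = wedge_incl (\<lambda>_. sphere_base) i' (\<phi> i' x')"
        using q_eq i i' x eq by metis
      then have ii: "i' = i" "\<phi> i x = \<phi> i x'"
        using \<phi>_base[OF i(1) x(1)] \<phi>_base[OF i'(1) x(2)] i i' unfolding wedge_incl_def
        by (auto split: if_splits)
      have vs: "x (v i 0) = x' (v i 0) \<and> x (v i 1) = x' (v i 1) \<and> x (v i 2) = x' (v i 2)"
      proof (rule triangle_sphere_inj)
        show "0 < min (x (v i 0)) (min (x (v i 1)) (x (v i 2)))"
          unfolding min_coord_eq[OF i(1)] by (rule min_coord_pos[OF eT[OF i(1)] x(1) i(2)])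
        show "0 < min (x' (v i 0)) (min (x' (v i 1)) (x' (v i 2)))"
          unfolding min_coord_eq[OF i(1)] by (rule min_coord_pos[OF eT[OF i(1)] x(2) i'(2)[unfolded ii(1)]])
        show "x (v i 0) + x (v i 1) + x (v i 2) = 1" by (rule sum3[OF i(1) x(1) i(2)])
        show "x' (v i 0) + x' (v i 1) + x' (v i 2) = 1"
          by (rule sum3[OF i(1) x(2) i'(2)[unfolded ii(1)]])
        show "triangle_sphere (x (v i 0)) (x (v i 1)) (x (v i 2)) =
            triangle_sphere (x' (v i 0)) (x' (v i 1)) (x' (v i 2))"
          using ii(2) unfolding \<phi>_def .
      qed
      have "x u = x' u" for u
      proof (cases "u \<in> e i")
        case True
        then consider "u = v i 0" | "u = v i 1" | "u = v i 2" unfolding v[OF i(1)] by blast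
        then show ?thesis using vs by cases metis+
      next
        case False
        have "x u = 0" using False i(2) by blast
        moreover have "x' u = 0" using False i'(2) ii(1) by blast
        ultimately show ?thesis by simp
      qed
      then show ?thesis by blast
    qed
  next
    assume "x = x' \<or> (x \<in> topspace A \<and> x' \<in> topspace A)"
    then show "q x = q x'" using topspace_A_iff unfolding q_def by auto
  qed
  show ?thesis using cont_q q_onto q_inj by blast
qed

lemma realization_homotopy_equivalent_wedge:
  assumes A: "contractible_space A" and ne: "K \<noteq> T"
  shows "X homotopy_equivalent_space wedge_of_2_spheres (card T)"
proof -
  obtain \<Phi> a where \<Phi>: "continuous_map (prod_topology I X) X \<Phi>"
    "\<And>x. x \<in> topspace X \<Longrightarrow> \<Phi> (0, x) = x"
    "\<And>r x. r \<in> {0..1} \<Longrightarrow> x \<in> topspace A \<Longrightarrow> \<Phi> (r, x) \<in> topspace A"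
    "\<And>x. x \<in> topspace A \<Longrightarrow> \<Phi> (1, x) = a"
    using homotopy_to_constant[OF A] by metis
  obtain q where q: "continuous_map X W q" "q ` topspace X = topspace W"
    "\<And>x x'. x \<in> topspace X \<Longrightarrow> x' \<in> topspace X \<Longrightarrow>
       q x = q x' \<longleftrightarrow> x = x' \<or> (x \<in> topspace A \<and> x' \<in> topspace A)"
    using quotient_onto_wedge[OF ne] by metis
  have "Hausdorff_space W"
    by (rule Hausdorff_wedge_topology[OF sphere_base_in_nsphere Hausdorff_space_nsphere])
  from quotient_homotopy_equivalent[OF compact_space_realization[OF K] this q \<Phi>]
  show ?thesis unfolding wedge_of_2_spheres_def .
qed

end

section \<open>Shellable complexes of dimension two\<close>

text \<open>Barycentric coordinates are carried along \<open>f\<close> and extended by 0. This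
  passes from partitions to their diagrams.\<close>

lemma cx_equiv_rename:
  fixes f :: "'a \<Rightarrow> 'b"
  assumes K: "fin_complex K" and f: "inj_on f (\<Union>K)"
  shows "cx_equiv K ((`) f ` K)"
proof -
  let ?L = "(`) f ` K" and ?V = "\<Union>K"
  have fins: "finite s" if "s \<in> K" for s using fin_complexD(2)[OF K that] .
  have L: "fin_complex ?L"
    unfolding fin_complex_def
  proof (intro conjI ballI allI impI)
    show "finite ?L" using fin_complexD(1)[OF K] by simp
    fix t assume "t \<in> ?L"
    then obtain s where s: "s \<in> K" "t = f ` s" by blast
    show "finite t" "t \<noteq> {}" using fins[OF s(1)] fin_complexD(3)[OF K] s by auto
    fix u assume u: "u \<subseteq> t" "u \<noteq> {}"
    then obtain s' where s': "s' \<subseteq> s" "u = f ` s'" using s(2) by (metis subset_imageE)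
    then have "s' \<in> K" using fin_complexD(4)[OF K s(1)] u(2) by blast
    then show "u \<in> ?L" using s' by blast
  qed
  define F :: "('a \<Rightarrow> real) \<Rightarrow> 'b \<Rightarrow> real" where
    "F = (\<lambda>x w. if w \<in> f ` ?V then x (inv_into ?V f w) else 0)"
  define G :: "('b \<Rightarrow> real) \<Rightarrow> 'a \<Rightarrow> real" where
    "G = (\<lambda>y v. if v \<in> ?V then y (f v) else 0)"
  have F_f: "F x (f v) = x v" if "v \<in> ?V" for x v
    using that f unfolding F_def by simp
  have FX: "F x \<in> topspace (geometric_realization ?L)" if x: "x \<in> topspace (geometric_realization K)" for x
  proof -
    let ?s = "{v. x v \<noteq> 0}"
    have s: "?s \<in> K" using realization_support(1)[OF x] .
    have "{w. F x w \<noteq> 0} \<subseteq> f ` ?s"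
    proof
      fix w assume w: "w \<in> {w. F x w \<noteq> 0}"
      then have "w \<in> f ` ?V" unfolding F_def by (auto split: if_splits)
      then obtain v where "v \<in> ?V" "w = f v" by blast
      then show "w \<in> f ` ?s" using w F_f[of v x] by simp
    qed
    moreover have "sum (F x) (f ` ?s) = sum x ?s"
    proof -
      have "inj_on f ?s" using f s by (meson Union_upper inj_on_subset)
      then have "sum (F x) (f ` ?s) = (\<Sum>v\<in>?s. F x (f v))" by (simp add: sum.reindex)
      also have "\<dots> = sum x ?s" by (intro sum.cong refl F_f) (use s in blast)
      finally show ?thesis .
    qed
    moreover have "0 \<le> F x w" for w using realization_support(2)[OF x] unfolding F_def by auto
    ultimately show ?thesis
      using realization_support(3)[OF x] s unfolding topspace_realization[OF L] by auto
  qed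
  have GX: "G y \<in> topspace (geometric_realization K)" if y: "y \<in> topspace (geometric_realization ?L)" for y
  proof -
    obtain s where s: "s \<in> K" "{w. y w \<noteq> 0} = f ` s" using realization_support(1)[OF y] by blast
    have sub: "{v. G y v \<noteq> 0} \<subseteq> s"
    proof
      fix v assume "v \<in> {v. G y v \<noteq> 0}"
      then have v: "v \<in> ?V" "y (f v) \<noteq> 0" unfolding G_def by (auto split: if_splits)
      then obtain u where "u \<in> s" "f u = f v" using s(2) by (metis (mono_tags, lifting) image_iff mem_Collect_eq)
      then show "v \<in> s" using inj_onD[OF f, of u v] v(1) s(1) by blast
    qed
    have "sum (G y) s = sum y (f ` s)"
    proof -
      have "inj_on f s" using f s by (meson Union_upper inj_on_subset)
      then have "sum y (f ` s) = (\<Sum>v\<in>s. y (f v))" by (simp add: sum.reindex)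
      also have "\<dots> = sum (G y) s" by (intro sum.cong refl) (use s(1) in \<open>auto simp: G_def\<close>)
      finally show ?thesis by simp
    qed
    then have "sum (G y) s = 1" using realization_support(3)[OF y] s(2) by simp
    moreover have "0 \<le> G y v" for v using realization_support(2)[OF y] unfolding G_def by auto
    ultimately show ?thesis
      using s(1) sub unfolding topspace_realization[OF K] by blast
  qed
  have "continuous_map (geometric_realization K) euclideanreal (\<lambda>x. F x w)" for w
    unfolding F_def by (cases "w \<in> f ` ?V") (simp_all add: continuous_map_coordinate)
  then have "continuous_map (geometric_realization K) (geometric_realization ?L) F"
    using FX by (intro continuous_map_into_realization)
  moreover have "continuous_map (geometric_realization ?L) euclideanreal (\<lambda>y. G y v)" for v
    unfolding G_def by (cases "v \<in> ?V") (simp_all add: continuous_map_coordinate)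
  then have "continuous_map (geometric_realization ?L) (geometric_realization K) G"
    using GX by (intro continuous_map_into_realization)
  moreover have "G (F x) = x" if x: "x \<in> topspace (geometric_realization K)" for x
  proof
    fix v
    have "{v. x v \<noteq> 0} \<subseteq> ?V" using realization_support(1)[OF x] by blast
    then show "G (F x) v = x v" using F_f[of v x] unfolding G_def by auto
  qed
  moreover have "F (G y) = y" if y: "y \<in> topspace (geometric_realization ?L)" for y
  proof
    fix w
    have "{w. y w \<noteq> 0} \<subseteq> f ` ?V" using realization_support(1)[OF y] by blast
    moreover have "F (G y) (f v) = y (f v)" if "v \<in> ?V" for v
      using F_f[OF that, of "G y"] that unfolding G_def by auto
    ultimately show "F (G y) w = y w" unfolding F_def by (cases "w \<in> f ` ?V") auto
  qed
  ultimately have "homeomorphic_maps (geometric_realization K) (geometric_realization ?L) F G"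
    unfolding homeomorphic_maps_def by blast
  then have "geometric_realization K homotopy_equivalent_space geometric_realization ?L"
    using homeomorphic_imp_homotopy_equivalent_space homeomorphic_space_def by blast
  moreover have "euler_char ?L = euler_char K"
  proof -
    have "inj_on ((`) f) K" using f by (rule inj_on_image)
    then have "euler_char ?L = (\<Sum>s\<in>K. (-1) ^ (card (f ` s) - 1))"
      unfolding euler_char_def by (simp add: sum.reindex)
    also have "\<dots> = euler_char K"
      unfolding euler_char_def
    proof (rule sum.cong)
      fix s assume "s \<in> K"
      then have "card (f ` s) = card s" using f by (intro card_image) (meson Union_upper inj_on_subset)
      then show "(-1::int) ^ (card (f ` s) - 1) = (-1) ^ (card s - 1)" by simp
    qed simp
    finally show ?thesis .
  qed
  ultimately show ?thesis unfolding cx_equiv_def by simp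
qed

lemma contractible_point_realization: "contractible_space (geometric_realization {{v}})"
proof -
  have "{x. (\<forall>u. 0 \<le> x u) \<and> {u. x u \<noteq> 0} \<in> {{v}} \<and> (\<Sum>u | x u \<noteq> 0. x u) = 1} = {\<lambda>u. if u = v then 1 else (0::real)}"
    (is "?l = {?e}")
  proof (intro equalityI subsetI)
    fix x assume "x \<in> ?l"
    then have x: "{u. x u \<noteq> 0} = {v}" "(\<Sum>u | x u \<noteq> 0. x u) = 1" by auto
    have "x v = 1" using x(2) unfolding x(1) by simp
    moreover have "x u = 0" if "u \<noteq> v" for u using x(1) that by blast
    ultimately show "x \<in> {?e}" by auto
  next
    fix x assume "x \<in> {?e}"
    moreover have "{u. ?e u \<noteq> 0} = {v}" by auto
    ultimately show "x \<in> ?l" by auto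
  qed
  then show ?thesis
    unfolding geometric_realization_def by (simp add: contractible_space_subtopology_singleton)
qed

text \<open>A fixed vertex \<open>v\<close> is an apex for every other vertex, so all of these can
  be removed at once.\<close>

lemma simplex_contractible:
  assumes "finite s" "s \<noteq> {}"
  shows "contractible_space (geometric_realization {t. t \<noteq> {} \<and> t \<subseteq> s})"
    and "euler_char {t. t \<noteq> {} \<and> t \<subseteq> s} = 1"
proof -
  let ?K = "{t. t \<noteq> {} \<and> t \<subseteq> s}"
  obtain v where v: "v \<in> s" using assms(2) by blast
  have "fin_complex ?K"
    unfolding fin_complex_def using assms(1) finite_subset by auto
  then have "cx_equiv ?K {t \<in> ?K. \<forall>u\<in>(\<lambda>u. {u}) ` (s - {v}). \<not> u \<subseteq> t}"
  proof (rule cone_removals[where a = "\<lambda>_. v"])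
    show "finite ((\<lambda>u. {u}) ` (s - {v}))" using assms(1) by simp
  qed (use v in auto)
  moreover have "{t \<in> ?K. \<forall>u\<in>(\<lambda>u. {u}) ` (s - {v}). \<not> u \<subseteq> t} = {{v}}"
    using v by auto
  ultimately have *: "cx_equiv ?K {{v}}" by simp
  then show "contractible_space (geometric_realization ?K)"
    using homotopy_equivalent_space_contractibility[of "geometric_realization ?K" "geometric_realization {{v}}"]
      contractible_point_realization
    unfolding cx_equiv_def by simp
  show "euler_char ?K = 1" using * unfolding cx_equiv_def euler_char_def by simp
qed

text \<open>\<open>R i\<close> is the minimal new face of the facet \<open>fac i\<close> in the shelling order given by \<open>\<Phi>\<close>. The
  facets with \<open>R i = fac i\<close> close a sphere; removing them leaves a complex in which the other
  facets can be collapsed one by one, in reverse order.\<close>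

locale shelling_2dim =
  fixes I :: "'i set" and fac R :: "'i \<Rightarrow> 'a set" and \<Phi> :: "'i \<Rightarrow> nat"
  assumes fin_I: "finite I" and card_fac: "\<And>i. i \<in> I \<Longrightarrow> card (fac i) = 3"
    and R_fac: "\<And>i. i \<in> I \<Longrightarrow> R i \<subseteq> fac i"
    and first: "\<And>i j t. i \<in> I \<Longrightarrow> j \<in> I \<Longrightarrow> R i \<subseteq> t \<Longrightarrow> t \<subseteq> fac i \<Longrightarrow> t \<subseteq> fac j \<Longrightarrow> i = j \<or> \<Phi> i < \<Phi> j"
    and covered: "\<And>j t. t = {} \<or> j \<in> I \<and> t \<subseteq> fac j \<Longrightarrow> \<exists>i\<in>I. R i \<subseteq> t \<and> t \<subseteq> fac i"
begin

definition cx :: "'a set set" where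
  "cx = {t. t \<noteq> {} \<and> (\<exists>i\<in>I. t \<subseteq> fac i)}"

definition critical :: "'i set" where
  "critical = {i \<in> I. R i = fac i}"

text \<open>Every face lies in exactly one interval from \<open>R i\<close> to \<open>fac i\<close>.
  For an initial segment \<open>G\<close> of the noncritical facets, the intervals of
  \<open>G\<close> fill the subcomplex generated by the facets of \<open>G\<close>.\<close>

definition part :: "'i set \<Rightarrow> 'a set set" where
  "part G = {t. t \<noteq> {} \<and> (\<exists>i\<in>G. R i \<subseteq> t \<and> t \<subseteq> fac i)}"

lemma finite_fac: "i \<in> I \<Longrightarrow> finite (fac i)"
  using card_fac by (metis card.infinite zero_neq_numeral)

lemma fac_eq: "i \<in> I \<Longrightarrow> j \<in> I \<Longrightarrow> fac i \<subseteq> fac j \<Longrightarrow> fac i = fac j"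
  using card_fac finite_fac by (metis card_subset_eq)

lemma fac_inj:
  assumes "i \<in> I" "j \<in> I" "fac i \<subseteq> fac j"
  shows "i = j"
proof -
  have eq: "fac i = fac j" using fac_eq assms by blast
  have "i = j \<or> \<Phi> i < \<Phi> j" using first[of i j "fac i"] assms R_fac by blast
  moreover have "j = i \<or> \<Phi> j < \<Phi> i" using first[of j i "fac i"] assms R_fac eq by blast
  ultimately show ?thesis using less_asym by blast
qed

lemma unique: "i \<in> I \<Longrightarrow> j \<in> I \<Longrightarrow> R i \<subseteq> t \<Longrightarrow> t \<subseteq> fac i \<Longrightarrow> R j \<subseteq> t \<Longrightarrow> t \<subseteq> fac j \<Longrightarrow> i = j"
  using first[of i j t] first[of j i t] by (metis less_asym)

definition lower :: "'i set \<Rightarrow> bool" where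
  "lower G \<longleftrightarrow> G \<subseteq> I - critical \<and> (\<forall>i\<in>G. \<forall>j\<in>I - critical. \<Phi> j < \<Phi> i \<longrightarrow> j \<in> G)"

text \<open>A face of a facet in \<open>G\<close> belongs to the interval of that facet or of an
  earlier one. An earlier critical facet is impossible: its interval is the facet alone, which would
  then be contained in another facet.\<close>

lemma fin_complex_part:
  assumes G: "lower G"
  shows "fin_complex (part G)"
  unfolding fin_complex_def
proof (intro conjI ballI allI impI)
  have GI: "G \<subseteq> I" using G unfolding lower_def by blast
  have "part G \<subseteq> (\<Union>i\<in>I. Pow (fac i))" using GI unfolding part_def by blast
  then show "finite (part G)" using fin_I finite_fac by (auto intro: finite_subset)
  fix s assume "s \<in> part G"
  then obtain i where i: "i \<in> G" "R i \<subseteq> s" "s \<subseteq> fac i" and "s \<noteq> {}" unfolding part_def by blast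
  then have iI: "i \<in> I" using GI by blast
  show "finite s" using finite_fac[OF iI] i(3) finite_subset by blast
  show "s \<noteq> {}" by fact
  fix t assume t: "t \<subseteq> s" "t \<noteq> {}"
  then obtain j where j: "j \<in> I" "R j \<subseteq> t" "t \<subseteq> fac j" using covered[of t i] iI i(3) by blast
  have ji: "j = i \<or> \<Phi> j < \<Phi> i" using first[OF j(1) iI j(2,3)] t(1) i(3) by blast
  have "j = i" if "j \<in> critical"
    using that j t(1) i(3) fac_inj[OF j(1) iI] unfolding critical_def by blast
  then have "j \<in> G" using ji i(1) j(1) G unfolding lower_def by blast
  then show "t \<in> part G" using j t(2) unfolding part_def by blast
qed

text \<open>The interval of a critical facet contains only that facet.\<close>

lemma part_noncritical: "part (I - critical) = cx - fac ` critical"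
proof (intro equalityI subsetI)
  fix t assume "t \<in> part (I - critical)"
  then obtain i where i: "i \<in> I" "i \<notin> critical" "t \<subseteq> fac i" "t \<noteq> {}" unfolding part_def by blast
  have "t \<noteq> fac j" if "j \<in> critical" for j
    using fac_inj[of j i] i that unfolding critical_def by blast
  then show "t \<in> cx - fac ` critical" using i unfolding cx_def by blast
next
  fix t assume t: "t \<in> cx - fac ` critical"
  then obtain j where "t \<noteq> {}" "j \<in> I" "t \<subseteq> fac j" unfolding cx_def by blast
  moreover from this obtain i where i: "i \<in> I" "R i \<subseteq> t" "t \<subseteq> fac i" using covered by blast
  moreover have "i \<notin> critical" using i t unfolding critical_def by blast
  ultimately show "t \<in> part (I - critical)" unfolding part_def by blast
qed

text \<open>The empty set lies in the interval of some facet, and \<open>first\<close>, applied to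
  the empty set, puts this facet before all others.\<close>

lemma first_facet:
  obtains i0 where "i0 \<in> I - critical" "R i0 = {}" "\<And>i. i \<in> I \<Longrightarrow> i \<noteq> i0 \<Longrightarrow> \<Phi> i0 < \<Phi> i"
proof -
  obtain i0 where i0: "i0 \<in> I" "R i0 = {}" using covered[of "{}"] by blast
  have "i0 \<notin> critical" using i0 card_fac[of i0] unfolding critical_def by auto
  moreover have "\<Phi> i0 < \<Phi> i" if "i \<in> I" "i \<noteq> i0" for i
    using first[of i0 i "{}"] i0 that by auto
  ultimately show ?thesis using that i0 by blast
qed

text \<open>Take the latest facet \<open>f\<close> of \<open>G\<close>. It is noncritical, so it has
  a vertex outside \<open>R f\<close>, and this vertex is an apex for \<open>R f\<close>. Removing
  the faces above \<open>R f\<close> deletes precisely the interval of \<open>f\<close>.\<close>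

lemma collapse:
  assumes "lower G" "i0 \<in> G" "R i0 = {}" "\<And>i. i \<in> I \<Longrightarrow> i \<noteq> i0 \<Longrightarrow> \<Phi> i0 < \<Phi> i"
  shows "cx_equiv (part G) (part {i0})"
  using assms(1,2)
proof (induction "card G" arbitrary: G rule: less_induct)
  case less
  show ?case
  proof (cases "G = {i0}")
    case True
    then show ?thesis by (simp add: cx_equiv_refl)
  next
    case False
    have GI: "G \<subseteq> I" "finite G" using less.prems fin_I finite_subset unfolding lower_def by auto
    define m where "m = Max (\<Phi> ` G)"
    have "m \<in> \<Phi> ` G" unfolding m_def using GI less.prems by (intro Max_in) auto
    then obtain f where f: "f \<in> G" "\<Phi> f = m" by blast
    have fmax: "\<Phi> i \<le> \<Phi> f" if "i \<in> G" for i
      unfolding f(2) m_def using GI that by (intro Max_ge) auto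
    have "f \<noteq> i0"
    proof
      assume "f = i0"
      obtain i where "i \<in> G" "i \<noteq> i0" using False less.prems(2) by blast
      then show False using assms(4)[of i] fmax[of i] GI \<open>f = i0\<close> by auto
    qed
    have fI: "f \<in> I" "f \<notin> critical" using f less.prems unfolding lower_def by auto
    have i0I: "i0 \<in> I" using less.prems GI by blast
    have Rf: "R f \<noteq> {}"
      using unique[OF fI(1) i0I, of "{}"] assms(3) \<open>f \<noteq> i0\<close> by auto
    have "R f \<subset> fac f" using R_fac[OF fI(1)] fI unfolding critical_def by blast
    then obtain v where v: "v \<in> fac f" "v \<notin> R f" by blast
    \<comment> \<open>By \<open>first\<close>, another facet containing \<open>R f\<close> would
      come after \<open>f\<close>, but \<open>f\<close> is the latest in \<open>G\<close>.\<close>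
    have only: "i = f" if "i \<in> G" "R f \<subseteq> t" "t \<subseteq> fac i" for i t
    proof -
      have "f = i \<or> \<Phi> f < \<Phi> i"
        using first[OF fI(1), of i "R f"] that GI R_fac[OF fI(1)] by blast
      then show ?thesis using fmax[OF that(1)] by auto
    qed
    have "cx_equiv (part G) {t \<in> part G. \<not> R f \<subseteq> t}"
    proof (rule cone_removal[OF fin_complex_part[OF less.prems(1)] Rf _ v(2)])
      show "finite (R f)" using R_fac[OF fI(1)] finite_fac[OF fI(1)] finite_subset by blast
      fix t assume t: "t \<in> part G" "R f \<subseteq> t"
      then obtain i where "i \<in> G" "t \<subseteq> fac i" unfolding part_def by blast
      then have "t \<subseteq> fac f" using only[of i t] t(2) by blast
      then show "insert v t \<in> part G" using t(2) v f(1) unfolding part_def by blast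
    qed
    moreover have "{t \<in> part G. \<not> R f \<subseteq> t} = part (G - {f})"
    proof (intro equalityI subsetI)
      fix t assume "t \<in> part (G - {f})"
      then obtain i where i: "i \<in> G" "i \<noteq> f" "R i \<subseteq> t" "t \<subseteq> fac i" "t \<noteq> {}" unfolding part_def by blast
      then show "t \<in> {t \<in> part G. \<not> R f \<subseteq> t}" using only[of i t] unfolding part_def by blast
    qed (auto simp: part_def)
    moreover have "cx_equiv (part (G - {f})) (part {i0})"
    proof (rule less.hyps)
      show "card (G - {f}) < card G" using GI(2) f(1) by (rule card_Diff1_less)
      show "lower (G - {f})"
        using less.prems(1) fmax unfolding lower_def by (auto simp: not_less[symmetric])
      show "i0 \<in> G - {f}" using less.prems(2) \<open>f \<noteq> i0\<close> by simp
    qed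
    ultimately show ?thesis using cx_equiv_trans by auto
  qed
qed

lemma fin_complex_cx: "fin_complex cx"
proof -
  have "cx \<subseteq> (\<Union>i\<in>I. Pow (fac i))" unfolding cx_def by blast
  then have "finite cx" using fin_I finite_fac by (auto intro: finite_subset)
  moreover have "finite s" if "s \<in> cx" for s
    using that finite_fac finite_subset unfolding cx_def by blast
  moreover have "t \<in> cx" if "s \<in> cx" "t \<subseteq> s" "t \<noteq> {}" for s t
    using that unfolding cx_def by blast
  moreover have "{} \<notin> cx" unfolding cx_def by blast
  ultimately show ?thesis unfolding fin_complex_def by blast
qed

text \<open>Without the critical triangles the complex collapses to the first facet, so it is
  contractible with Euler characteristic 1. Each critical triangle adds one sphere and, having even
  dimension, adds 1 to the Euler characteristic.\<close>

theorem wedge: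
  "\<exists>b. int b = euler_char cx - 1 \<and> geometric_realization cx homotopy_equivalent_space wedge_of_2_spheres b"
proof -
  let ?T = "fac ` critical"
  obtain i0 where i0: "i0 \<in> I - critical" "R i0 = {}" "\<And>i. i \<in> I \<Longrightarrow> i \<noteq> i0 \<Longrightarrow> \<Phi> i0 < \<Phi> i"
    using first_facet by blast
  have "lower (I - critical)" unfolding lower_def by blast
  from collapse[OF this i0]
  have eq: "cx_equiv (cx - ?T) (part {i0})" unfolding part_noncritical by simp
  have p0: "part {i0} = {t. t \<noteq> {} \<and> t \<subseteq> fac i0}" using i0 unfolding part_def by auto
  have fi0: "finite (fac i0)" "fac i0 \<noteq> {}" using finite_fac card_fac[of i0] i0(1) by auto
  have contr: "contractible_space (geometric_realization (cx - ?T))"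
    using eq simplex_contractible(1)[OF fi0]
      homotopy_equivalent_space_contractibility[of "geometric_realization (cx - ?T)" "geometric_realization (part {i0})"]
    unfolding cx_equiv_def p0 by simp
  have T_cx: "?T \<subseteq> cx" unfolding cx_def critical_def using card_fac by force
  interpret maximal_triangles cx ?T
  proof
    show "fin_complex cx" by (rule fin_complex_cx)
    show "card t = 3" if "t \<in> ?T" for t using that card_fac unfolding critical_def by auto
    fix s t assume t: "t \<in> ?T" "s \<in> cx" "t \<subseteq> s"
    then obtain i j where ij: "i \<in> I" "t = fac i" "j \<in> I" "s \<subseteq> fac j"
      unfolding cx_def critical_def by blast
    then have "fac i = fac j" using fac_eq t(3) by blast
    then show "s = t" using ij t(3) by blast
  qed (rule T_cx)
  have "fac i0 \<in> part (I - critical)" using i0(1,2) fi0(2) unfolding part_def by blast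
  then have "cx \<noteq> ?T" unfolding part_noncritical by blast
  then have "geometric_realization cx homotopy_equivalent_space wedge_of_2_spheres (card ?T)"
    by (rule realization_homotopy_equivalent_wedge[OF contr])
  moreover have "euler_char cx = 1 + int (card ?T)"
  proof -
    have fin: "finite cx" "finite ?T" using fin_complex_cx finite_T unfolding fin_complex_def by auto
    have "euler_char cx = euler_char (cx - ?T) + euler_char ?T"
      unfolding euler_char_def using sum.subset_diff[OF T_cx fin(1)] by blast
    moreover have "euler_char (cx - ?T) = 1"
      using eq simplex_contractible(2)[OF fi0] unfolding cx_equiv_def p0 by simp
    moreover have "euler_char ?T = (\<Sum>t\<in>?T. 1)"
      unfolding euler_char_def
    proof (rule sum.cong)
      fix t assume "t \<in> ?T"
      then have "card t = 3" using card_fac unfolding critical_def by auto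
      then show "(-1::int) ^ (card t - 1) = 1" by simp
    qed simp
    ultimately show ?thesis by simp
  qed
  ultimately show ?thesis by (intro exI[of _ "card ?T"]) simp
qed

end

section \<open>Three consecutive levels of a lattice of down-sets\<close>

text \<open>\<open>X - X'\<close> lies in \<open>X - A\<close>, \<open>X' - X\<close> lies in
  \<open>B - X\<close>, and both have the same size. So \<open>X\<close> is the unique set of least
  sum among the sets of its size between \<open>A\<close> and \<open>B\<close>.\<close>

lemma sum_less_by_exchange:
  fixes X X' :: "nat set"
  assumes "finite X" "finite X'" "card X = card X'" and "A \<subseteq> X'" "X' \<subseteq> B"
    and less: "\<And>a b. a \<in> X - A \<Longrightarrow> b \<in> B - X \<Longrightarrow> a < b"
  shows "X = X' \<or> \<Sum>X < \<Sum>X'"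
proof (cases "X = X'")
  case False
  let ?C = "X - X'" and ?D = "X' - X"
  have cards: "card ?C = card ?D"
    using assms(1-3) by (metis Int_commute card_Diff_subset_Int finite_Int)
  have "?C \<noteq> {}"
    using False assms(1-3) by (metis Diff_eq_empty_iff card_subset_eq)
  then have "?D \<noteq> {}" using cards assms(1,2) by (metis card_eq_0_iff finite_Diff)
  have CD: "a < b" if "a \<in> ?C" "b \<in> ?D" for a b
    using that assms(4,5) by (intro less) auto
  define m where "m = Max ?C"
  have m: "m \<in> ?C" unfolding m_def using assms(1) \<open>?C \<noteq> {}\<close> by (intro Max_in) auto
  have "\<Sum>?C \<le> (\<Sum>a\<in>?C. m)" unfolding m_def using assms(1) by (intro sum_mono) auto
  also have "\<dots> = (\<Sum>b\<in>?D. m)" using cards by simp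
  also have "\<dots> < \<Sum>?D" using assms(2) \<open>?D \<noteq> {}\<close> CD[OF m] by (intro sum_strict_mono) auto
  finally have "\<Sum>?C < \<Sum>?D" .
  moreover have "\<Sum>X = \<Sum>(X \<inter> X') + \<Sum>?C" "\<Sum>X' = \<Sum>(X \<inter> X') + \<Sum>?D"
    using sum.Int_Diff[OF assms(1), of id X'] sum.Int_Diff[OF assms(2), of id X]
    by (simp_all add: Int_commute)
  ultimately show ?thesis by simp
qed simp

text \<open>The order of the natural numbers is a linear extension of the relation, so the elements
  themselves can serve as labels: least and greatest candidates are always safe to insert or
  remove.\<close>

locale down_sets =
  fixes below :: "nat \<Rightarrow> nat \<Rightarrow> bool"
  assumes below_less: "below a b \<Longrightarrow> a < b"
begin

definition down_closed :: "nat set \<Rightarrow> bool" where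
  "down_closed A \<longleftrightarrow> (\<forall>b\<in>A. \<forall>a. below a b \<longrightarrow> a \<in> A)"

definition level :: "nat \<Rightarrow> nat set set" where
  "level m = {A. finite A \<and> down_closed A \<and> card A = m}"

lemma levelD: "A \<in> level m \<Longrightarrow> finite A" "A \<in> level m \<Longrightarrow> down_closed A" "A \<in> level m \<Longrightarrow> card A = m"
  unfolding level_def by auto

lemma down_closed_Int: "down_closed A \<Longrightarrow> down_closed B \<Longrightarrow> down_closed (A \<inter> B)"
  unfolding down_closed_def by blast

lemma down_closed_Un: "down_closed A \<Longrightarrow> down_closed B \<Longrightarrow> down_closed (A \<union> B)"
  unfolding down_closed_def by blast

text \<open>Anything below \<open>x\<close> is in \<open>B\<close> and smaller than
  \<open>x\<close>, so by minimality it is already in \<open>A\<close>.\<close>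

lemma down_closed_insert_least:
  assumes "down_closed A" "down_closed B" "x \<in> B" "\<And>z. z \<in> B - A \<Longrightarrow> x \<le> z"
  shows "down_closed (insert x A)"
  using assms below_less unfolding down_closed_def by (metis DiffI insert_iff not_le)

lemma down_closed_remove_greatest:
  assumes "down_closed A" "\<And>z. z \<in> A \<Longrightarrow> z \<le> x"
  shows "down_closed (A - {x})"
  using assms below_less unfolding down_closed_def by (metis DiffE DiffI insertI1 not_le singletonD)

lemma insert_missing:
  assumes "A \<in> level m"
  obtains x where "x \<notin> A" "insert x A \<in> level (Suc m)"
proof
  let ?x = "LEAST z. z \<notin> A"
  have "\<exists>z. z \<notin> A" using levelD(1)[OF assms] ex_new_if_finite by blast
  then show "?x \<notin> A" by (rule LeastI_ex)
  moreover have "down_closed (insert ?x A)"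
    using levelD(2)[OF assms]
    by (intro down_closed_insert_least[of A UNIV]) (auto simp: down_closed_def Least_le)
  ultimately show "insert ?x A \<in> level (Suc m)"
    using levelD[OF assms] unfolding level_def by simp
qed

lemma insert_between:
  assumes "A \<in> level m" "B \<in> level l" "A \<subset> B"
  obtains x where "x \<in> B - A" "insert x A \<in> level (Suc m)"
proof
  let ?x = "Min (B - A)"
  have "B - A \<noteq> {}" "finite (B - A)" using assms(3) levelD(1)[OF assms(2)] by auto
  then show x: "?x \<in> B - A" by (rule Min_in[rotated])
  have "down_closed (insert ?x A)"
    using levelD(2)[OF assms(1)] levelD(2)[OF assms(2)] x \<open>finite (B - A)\<close>
    by (intro down_closed_insert_least[of A B]) auto
  then show "insert ?x A \<in> level (Suc m)"
    using levelD[OF assms(1)] x unfolding level_def by simp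
qed

lemma remove_max:
  assumes "A \<in> level (Suc m)"
  obtains x where "x \<in> A" "A - {x} \<in> level m" "\<And>z. z \<in> A \<Longrightarrow> z \<le> x"
proof
  let ?x = "Max A"
  have "A \<noteq> {}" "finite A" using levelD[OF assms] by auto
  then show x: "?x \<in> A" by (rule Max_in[rotated])
  show max: "z \<le> ?x" if "z \<in> A" for z using \<open>finite A\<close> that by (rule Max_ge)
  show "A - {?x} \<in> level m"
    using down_closed_remove_greatest[of A ?x] levelD[OF assms] x max unfolding level_def by simp
qed

lemma initial_segment_level: "{..<m} \<in> level m"
  unfolding level_def down_closed_def using below_less by force

end

locale graded_down_sets = down_sets +
  fixes n :: nat
  assumes finite_level: "finite (level m)"
begin

text \<open>A flag \<open>(N, x, y)\<close> is the maximal chain obtained from \<open>N\<close> by inserting first \<open>x\<close>, then \<open>y\<close>.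
  Continue the chain downwards and upwards so that all other labels are inserted in increasing
  order. A member of the chain is needed if the sequence of labels has a descent there: only then
  another choice of this member has smaller weight.\<close>

type_synonym flag = "nat set \<times> nat \<times> nat"

definition flags :: "flag set" where
  "flags = {(N, x, y). x \<notin> N \<and> y \<notin> insert x N \<and>
     N \<in> level n \<and> insert x N \<in> level (n + 1) \<and> insert y (insert x N) \<in> level (n + 2)}"

fun chain_of :: "flag \<Rightarrow> nat set set" where
  "chain_of (N, x, y) = {N, insert x N, insert y (insert x N)}"

fun needed :: "flag \<Rightarrow> nat set set" where
  "needed (N, x, y) =
     (if \<forall>a\<in>N. a < x then {} else {N}) \<union>
     (if x < y then {} else {insert x N}) \<union>
     (if \<forall>z. z \<notin> insert y (insert x N) \<longrightarrow> y < z then {} else {insert y (insert x N)})"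

fun weight :: "flag \<Rightarrow> nat" where
  "weight (N, x, y) = \<Sum>N + \<Sum>(insert x N) + \<Sum>(insert y (insert x N))"

lemma finite_flags: "finite flags"
proof -
  have "flags \<subseteq> (\<Union>N\<in>level n. {N} \<times> (\<Union>(level (n + 1)) \<times> \<Union>(level (n + 2))))"
    unfolding flags_def by blast
  moreover have "finite (\<Union>(level m))" for m using finite_level levelD(1) by blast
  ultimately show ?thesis using finite_level by (auto intro: finite_subset)
qed

lemma card_chain_of:
  assumes "i \<in> flags"
  shows "card (chain_of i) = 3"
proof -
  obtain N x y where i: "i = (N, x, y)" by (cases i)
  have "x \<notin> N" "y \<notin> insert x N" using assms unfolding i flags_def by auto
  then have "N \<noteq> insert x N" "N \<noteq> insert y (insert x N)" "insert x N \<noteq> insert y (insert x N)" by auto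
  then show ?thesis unfolding i by simp
qed

text \<open>Where a member of \<open>i\<close> is missing from \<open>t\<close> the labels ascend.
  So each member of \<open>i\<close> arises by inserting smallest possible elements, and it has the
  least sum among sets of its size between its nearest neighbours in \<open>t\<close>, with the
  empty set and \<open>UNIV\<close> standing in at the ends. The members of \<open>j\<close> lie
  between the same neighbours.\<close>

lemma weight_less:
  assumes i: "i \<in> flags" "j \<in> flags" and t: "needed i \<subseteq> t" "t \<subseteq> chain_of i" "t \<subseteq> chain_of j"
  shows "i = j \<or> weight i < weight j"
proof -
  obtain N x y where ie: "i = (N, x, y)" by (cases i)
  obtain N' x' y' where je: "j = (N', x', y')" by (cases j)
  define L P L' P' where "L = insert x N" and "P = insert y L" and "L' = insert x' N'" and "P' = insert y' L'"
  note defs = L_def P_def L'_def P'_def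
  have lev: "N \<in> level n" "L \<in> level (n + 1)" "P \<in> level (n + 2)"
      "N' \<in> level n" "L' \<in> level (n + 1)" "P' \<in> level (n + 2)"
    and nin: "x \<notin> N" "y \<notin> L" "x' \<notin> N'" "y' \<notin> L'"
    using i unfolding ie je flags_def defs by auto
  note fin = lev[THEN levelD(1)] and cards = lev[THEN levelD(3)]
  have t': "t \<subseteq> {N, L, P}" "t \<subseteq> {N', L', P'}" using t(2,3) unfolding ie je by (auto simp: defs)
  have same: "N \<in> t \<Longrightarrow> N' = N" "L \<in> t \<Longrightarrow> L' = L" "P \<in> t \<Longrightarrow> P' = P"
    using t'(2) cards by auto
  have 1: "N \<in> t \<or> (\<forall>a\<in>N. a < x)" and 2: "L \<in> t \<or> x < y" and 3: "P \<in> t \<or> (\<forall>z. z \<notin> P \<longrightarrow> y < z)"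
    using t(1) unfolding ie defs by (auto split: if_splits)
  have sub': "N' \<subseteq> L'" "L' \<subseteq> P'" unfolding defs by auto
  have N: "N = N' \<or> \<Sum>N < \<Sum>N'"
  proof (cases "N \<in> t")
    case False
    \<comment> \<open>The nearest member of \<open>t\<close> above \<open>N\<close>, which
      \<open>j\<close> shares. With none, the ascents reach up to the labels outside
      \<open>P\<close>.\<close>
    let ?B = "if L \<in> t then L else if P \<in> t then P else UNIV"
    have "N' \<subseteq> ?B" using same sub' by auto
    moreover have "a < b" if "a \<in> N" "b \<in> ?B - N" for a b
    proof -
      have ax: "a < x" using 1 False that by blast
      show ?thesis
      proof (cases "L \<in> t")
        case True
        then show ?thesis using that ax unfolding L_def by auto
      next
        case L: False
        then have xy: "x < y" using 2 by blast
        show ?thesis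
        proof (cases "P \<in> t")
          case True
          then show ?thesis using that ax xy L unfolding P_def L_def by auto
        next
          case False
          then have "b \<notin> P \<longrightarrow> y < b" using 3 by blast
          then show ?thesis using that ax xy unfolding P_def L_def by auto
        qed
      qed
    qed
    ultimately show ?thesis
      using fin cards by (intro sum_less_by_exchange[of N N' "{}" ?B]) auto
  qed (use same in auto)
  have L: "L = L' \<or> \<Sum>L < \<Sum>L'"
  proof (cases "L \<in> t")
    case False
    then have xy: "x < y" using 2 by blast
    let ?A = "if N \<in> t then N else {}" and ?B = "if P \<in> t then P else UNIV"
    have "?A \<subseteq> L'" "L' \<subseteq> ?B" using same sub' by auto
    moreover have "a < b" if "a \<in> L - ?A" "b \<in> ?B - L" for a b
    proof -
      have "a \<le> x" using 1 that unfolding L_def by (auto split: if_splits)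
      moreover have "y \<le> b" using 3 that unfolding P_def by (auto split: if_splits)
      ultimately show ?thesis using xy by simp
    qed
    ultimately show ?thesis
      using fin cards by (intro sum_less_by_exchange[of L L' ?A ?B]) auto
  qed (use same in auto)
  have P: "P = P' \<or> \<Sum>P < \<Sum>P'"
  proof (cases "P \<in> t")
    case False
    let ?A = "if L \<in> t then L else if N \<in> t then N else {}"
    have "?A \<subseteq> P'" using same sub' by auto
    moreover have "a < b" if "a \<in> P - ?A" "b \<notin> P" for a b
    proof -
      have "a \<le> y"
      proof (cases "L \<in> t")
        case True
        then show ?thesis using that unfolding P_def by auto
      next
        case False
        then have "x < y" using 2 by blast
        then show ?thesis using 1 that False unfolding P_def L_def by (auto split: if_splits)
      qed
      moreover have "y < b" using 3 False that by blast
      ultimately show ?thesis by simp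
    qed
    ultimately show ?thesis
      using fin cards by (intro sum_less_by_exchange[of P P' ?A UNIV]) auto
  qed (use same in auto)
  have "weight i = \<Sum>N + \<Sum>L + \<Sum>P" "weight j = \<Sum>N' + \<Sum>L' + \<Sum>P'"
    unfolding ie je by (simp_all add: defs)
  moreover have "i = j" if "N = N'" "L = L'" "P = P'"
  proof -
    have "x = x'" using that(1,2) nin unfolding L_def L'_def by (metis insert_ident insert_iff)
    moreover have "y = y'" using that(2,3) nin unfolding P_def P'_def by (metis insert_iff)
    ultimately show ?thesis using that(1) unfolding ie je by simp
  qed
  ultimately show ?thesis using N L P by (elim disjE) simp_all
qed

text \<open>Choose a flag of least weight through \<open>t\<close>. A descent at a member outside
  \<open>t\<close> would allow a cheaper member: remove the greatest element of \<open>L\<close> to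
  replace \<open>N\<close>, swap \<open>x\<close> and \<open>y\<close> to replace \<open>L\<close>,
  or insert the least missing number to replace \<open>P\<close>.\<close>

lemma least_flag:
  assumes j: "j \<in> flags" "t \<subseteq> chain_of j"
  shows "\<exists>i\<in>flags. needed i \<subseteq> t \<and> t \<subseteq> chain_of i"
proof -
  obtain i where i: "i \<in> flags" "t \<subseteq> chain_of i"
    and least: "\<And>k. k \<in> flags \<Longrightarrow> t \<subseteq> chain_of k \<Longrightarrow> weight i \<le> weight k"
    using ex_has_least_nat[of "\<lambda>k. k \<in> flags \<and> t \<subseteq> chain_of k" j weight] j by blast
  obtain N x y where ie: "i = (N, x, y)" by (cases i)
  define L P where "L = insert x N" and "P = insert y L"
  have lev: "N \<in> level n" "L \<in> level (n + 1)" "P \<in> level (n + 2)" and nin: "x \<notin> N" "y \<notin> L"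
    using i(1) unfolding ie flags_def L_def P_def by auto
  have t: "t \<subseteq> {N, L, P}" using i(2) unfolding ie by (simp add: L_def P_def)
  have wi: "weight i = \<Sum>N + \<Sum>L + \<Sum>P" unfolding ie by (simp add: L_def P_def)
  have "N \<in> t" if notinc: "\<not> (\<forall>a\<in>N. a < x)"
  proof (rule ccontr)
    assume "N \<notin> t"
    obtain m where m: "m \<in> L" "L - {m} \<in> level n" "\<And>z. z \<in> L \<Longrightarrow> z \<le> m"
      using remove_max[of L n] lev(2) by auto
    obtain a where "a \<in> N" "\<not> a < x" using notinc by blast
    moreover have "a \<noteq> x" using \<open>a \<in> N\<close> nin by blast
    ultimately have xm: "x < m" using m(3)[of a] unfolding L_def by simp
    let ?k = "(L - {m}, m, y)"
    have ins: "insert m (L - {m}) = L" "insert m L = L" using m(1) by blast+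
    have "?k \<in> flags" using m lev nin unfolding flags_def by (auto simp: ins P_def[symmetric])
    moreover have "t \<subseteq> chain_of ?k"
      using t \<open>N \<notin> t\<close> by (simp add: ins flip: P_def) blast
    moreover have "weight ?k < weight i"
    proof -
      have "\<Sum>L = x + \<Sum>N" unfolding L_def using nin levelD(1)[OF lev(1)] by simp
      moreover have "\<Sum>L = m + \<Sum>(L - {m})"
        using sum.remove[OF levelD(1)[OF lev(2)] m(1), of id] by simp
      ultimately show ?thesis unfolding wi using xm by (simp add: ins flip: P_def)
    qed
    ultimately show False using least[of ?k] by simp
  qed
  moreover have "L \<in> t" if "\<not> x < y"
  proof (rule ccontr)
    assume "L \<notin> t"
    have yx: "y < x" using that nin unfolding L_def by auto
    let ?k = "(N, y, x)"
    have P: "insert x (insert y N) = P" unfolding P_def L_def by blast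
    \<comment> \<open>Since \<open>y < x\<close>, \<open>y\<close> is the least element of
      \<open>P - N\<close> and may be inserted first.\<close>
    have "down_closed (insert y N)"
      using levelD(2)[OF lev(1)] levelD(2)[OF lev(3)] yx
      by (intro down_closed_insert_least[of N P]) (auto simp: P_def L_def)
    then have "insert y N \<in> level (n + 1)"
      using nin levelD[OF lev(1)] unfolding level_def L_def by simp
    then have "?k \<in> flags" using lev nin yx unfolding flags_def by (auto simp: P) (auto simp: L_def)
    moreover have "t \<subseteq> chain_of ?k" using t \<open>L \<notin> t\<close> by (simp add: P) blast
    moreover have "weight ?k < weight i"
      using yx nin levelD(1)[OF lev(1)] unfolding wi by (simp add: P) (simp add: L_def)
    ultimately show False using least[of ?k] by simp
  qed
  moreover have "P \<in> t" if notinc: "\<not> (\<forall>z. z \<notin> P \<longrightarrow> y < z)"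
  proof (rule ccontr)
    assume "P \<notin> t"
    obtain z where z: "z \<notin> P" "\<not> y < z" using notinc by blast
    then have zy: "z < y" unfolding P_def by (metis insertI1 linorder_neqE_nat)
    let ?w = "LEAST z. z \<notin> L"
    have w: "?w \<notin> L" "?w < y"
      using z zy LeastI[of "\<lambda>z. z \<notin> L" z] Least_le[of "\<lambda>z. z \<notin> L" z] unfolding P_def by auto
    let ?k = "(N, x, ?w)"
    have "down_closed (insert ?w L)"
      using levelD(2)[OF lev(2)]
      by (intro down_closed_insert_least[of L UNIV]) (auto simp: down_closed_def Least_le)
    then have "insert ?w L \<in> level (n + 2)"
      using w levelD[OF lev(2)] unfolding level_def by simp
    then have "?k \<in> flags" using lev nin w unfolding flags_def by (simp add: L_def[symmetric] del: insert_iff)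
    moreover have "t \<subseteq> chain_of ?k" using t \<open>P \<notin> t\<close> by (simp flip: L_def) blast
    moreover have "weight ?k < weight i"
      using w nin levelD(1)[OF lev(2)] unfolding wi by (simp flip: L_def) (simp add: P_def)
    ultimately show False using least[of ?k] by simp
  qed
  ultimately have "needed i \<subseteq> t" unfolding ie by (simp flip: L_def P_def)
  then show ?thesis using i by blast
qed

sublocale shelling_2dim flags chain_of needed weight
proof
  show "finite flags" by (rule finite_flags)
  show "needed i \<subseteq> chain_of i" for i by (cases i) auto
  show "\<exists>i\<in>flags. needed i \<subseteq> t \<and> t \<subseteq> chain_of i" if "t = {} \<or> j \<in> flags \<and> t \<subseteq> chain_of j" for j t
  proof (cases "t = {}")
    case True
    \<comment> \<open>Initial segments provide some flag, which settles the empty chain.\<close>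
    have "({..<n}, n, n + 1) \<in> flags"
      using initial_segment_level[of n] initial_segment_level[of "n + 1"] initial_segment_level[of "n + 2"]
      unfolding flags_def by (simp add: lessThan_Suc)
    then show ?thesis using least_flag[of _ t] True by blast
  qed (use that least_flag in blast)
qed (use card_chain_of weight_less in auto)

text \<open>Purity of the order complex. The middle member is settled first, fitting whatever outer
  members \<open>t\<close> has; the outer ones are then chosen independently of each other.\<close>

lemma chain_extends:
  assumes t: "t \<subseteq> level n \<union> level (n + 1) \<union> level (n + 2)"
    and chain: "\<And>A B. A \<in> t \<Longrightarrow> B \<in> t \<Longrightarrow> A \<subseteq> B \<or> B \<subseteq> A"
  shows "\<exists>i\<in>flags. t \<subseteq> chain_of i"
proof -
  have comp: "A \<subseteq> B" if "A \<in> t" "B \<in> t" "A \<in> level k" "B \<in> level l" "k \<le> l" for A B k l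
    using chain[OF that(1,2)] that(3-5) levelD by (metis card_seteq order.refl)
  have comp_less: "A \<subset> B" if "A \<in> t" "B \<in> t" "A \<in> level k" "B \<in> level l" "k < l" for A B k l
  proof -
    have "A \<noteq> B" using levelD(3)[OF that(3)] levelD(3)[OF that(4)] that(5) by blast
    then show ?thesis using comp[OF that(1-4)] that(5) by auto
  qed
  have eq: "A = B" if "A \<in> t" "B \<in> t" "A \<in> level k" "B \<in> level k" for A B k
    using comp that by blast
  have "\<exists>L\<in>level (n + 1). \<forall>A\<in>t. (A \<in> level n \<longrightarrow> A \<subseteq> L) \<and> (A \<in> level (n + 1) \<longrightarrow> A = L) \<and> (A \<in> level (n + 2) \<longrightarrow> L \<subseteq> A)"
  proof (cases "t \<inter> level (n + 1) = {}")
    case False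
    then obtain L where L: "L \<in> t" "L \<in> level (n + 1)" by blast
    then show ?thesis
      by (intro bexI[of _ L] ballI conjI impI)
        (use eq comp[of _ L n "n+1"] comp[of L _ "n + 1" "n + 2"] in auto)
  next
    case noL: True
    show ?thesis
    proof (cases "t \<inter> level n = {}")
      case False
      then obtain N where N: "N \<in> t" "N \<in> level n" by blast
      show ?thesis
      proof (cases "t \<inter> level (n + 2) = {}")
        case False
        then obtain P where P: "P \<in> t" "P \<in> level (n + 2)" by blast
        obtain x where x: "x \<in> P - N" "insert x N \<in> level (Suc n)"
          using insert_between[OF N(2) P(2)] comp_less[OF N(1) P(1) N(2) P(2)] by auto
        have "N \<subseteq> P" using comp[OF N(1) P(1) N(2) P(2)] by simp
        moreover have "A = N" if "A \<in> t" "A \<in> level n" for A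
          using eq[OF that(1) N(1) that(2) N(2)] .
        moreover have "A = P" if "A \<in> t" "A \<in> level (n + 2)" for A
          using eq[OF that(1) P(1) that(2) P(2)] .
        ultimately show ?thesis
          using x noL by (intro bexI[of _ "insert x N"] ballI conjI impI) (auto 4 3)
      next
        case True
        obtain x where "insert x N \<in> level (Suc n)" using insert_missing[OF N(2)] by blast
        moreover have "A = N" if "A \<in> t" "A \<in> level n" for A
          using eq[OF that(1) N(1) that(2) N(2)] .
        ultimately show ?thesis
          using True noL by (intro bexI[of _ "insert x N"] ballI conjI impI) (auto 4 3)
      qed
    next
      case noN: True
      show ?thesis
      proof (cases "t \<inter> level (n + 2) = {}")
        case False
        then obtain P where P: "P \<in> t" "P \<in> level (n + 2)" by blast
        then obtain x where "P - {x} \<in> level (n + 1)" using remove_max[of P "n + 1"] by auto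
        moreover have "A = P" if "A \<in> t" "A \<in> level (n + 2)" for A
          using eq[OF that(1) P(1) that(2) P(2)] .
        ultimately show ?thesis
          using noN noL by (intro bexI[of _ "P - {x}"] ballI conjI impI) blast+
      next
        case True
        then show ?thesis
          using noN noL by (intro bexI[OF _ initial_segment_level[of "n + 1"]] ballI conjI impI) blast+
      qed
    qed
  qed
  then obtain L where L0: "L \<in> level (n + 1)" "\<forall>A\<in>t. (A \<in> level n \<longrightarrow> A \<subseteq> L) \<and>
      (A \<in> level (n + 1) \<longrightarrow> A = L) \<and> (A \<in> level (n + 2) \<longrightarrow> L \<subseteq> A)" by (elim bexE)
  have L: "L \<in> level (n + 1)"
    "\<And>A. A \<in> t \<Longrightarrow> A \<in> level n \<Longrightarrow> A \<subseteq> L" "\<And>A. A \<in> t \<Longrightarrow> A \<in> level (n + 1) \<Longrightarrow> A = L"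
    "\<And>A. A \<in> t \<Longrightarrow> A \<in> level (n + 2) \<Longrightarrow> L \<subseteq> A"
    using L0 by simp_all
  have "\<exists>N\<in>level n. N \<subseteq> L \<and> (\<forall>A\<in>t. A \<in> level n \<longrightarrow> A = N)"
  proof (cases "t \<inter> level n = {}")
    case True
    obtain x where "L - {x} \<in> level n" using remove_max[of L n] L(1) by auto
    then show ?thesis using True by (intro bexI[of _ "L - {x}"]) auto
  next
    case False
    then obtain N where N: "N \<in> t" "N \<in> level n" by blast
    have "\<forall>A\<in>t. A \<in> level n \<longrightarrow> A = N" using eq[OF _ N(1) _ N(2)] by blast
    then show ?thesis using L(2)[OF N] N(2) by blast
  qed
  then obtain N where N: "N \<in> level n" "N \<subseteq> L" "\<And>A. A \<in> t \<Longrightarrow> A \<in> level n \<Longrightarrow> A = N" by blast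
  have "\<exists>P\<in>level (n + 2). L \<subseteq> P \<and> (\<forall>A\<in>t. A \<in> level (n + 2) \<longrightarrow> A = P)"
  proof (cases "t \<inter> level (n + 2) = {}")
    case True
    obtain x where "insert x L \<in> level (n + 2)" using insert_missing[OF L(1)] by auto
    then show ?thesis using True by (intro bexI[of _ "insert x L"]) auto
  next
    case False
    then obtain P where P: "P \<in> t" "P \<in> level (n + 2)" by blast
    have "\<forall>A\<in>t. A \<in> level (n + 2) \<longrightarrow> A = P" using eq[OF _ P(1) _ P(2)] by blast
    then show ?thesis using L(4)[OF P] P(2) by blast
  qed
  then obtain P where P: "P \<in> level (n + 2)" "L \<subseteq> P" "\<And>A. A \<in> t \<Longrightarrow> A \<in> level (n + 2) \<Longrightarrow> A = P" by blast
  have "card (L - N) = 1" "card (P - L) = 1"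
    using N(2) P(2) levelD[OF N(1)] levelD[OF L(1)] levelD[OF P(1)] by (simp_all add: card_Diff_subset)
  then obtain x y where xy: "L - N = {x}" "P - L = {y}" by (meson card_1_singletonE)
  then have "L = insert x N" "P = insert y (insert x N)" "x \<notin> N" "y \<notin> insert x N"
    using N(2) P(2) by blast+
  then have "(N, x, y) \<in> flags" "chain_of (N, x, y) = {N, L, P}"
    using N(1) L(1) P(1) unfolding flags_def by auto
  moreover have "t \<subseteq> {N, L, P}" using t N(3) L(3) P(3) by blast
  ultimately show ?thesis by metis
qed

lemma order_complex:
  "cx = {t. t \<noteq> {} \<and> t \<subseteq> level n \<union> level (n + 1) \<union> level (n + 2) \<and>
          (\<forall>A\<in>t. \<forall>B\<in>t. A \<subseteq> B \<or> B \<subseteq> A)}" (is "_ = ?r")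
proof (intro equalityI subsetI)
  fix t assume "t \<in> cx"
  then obtain N x y where i: "(N, x, y) \<in> flags" "t \<subseteq> chain_of (N, x, y)" "t \<noteq> {}"
    unfolding cx_def by auto
  have "A \<subseteq> B \<or> B \<subseteq> A" if "A \<in> chain_of (N, x, y)" "B \<in> chain_of (N, x, y)" for A B
    using that by auto
  then have "\<forall>A\<in>t. \<forall>B\<in>t. A \<subseteq> B \<or> B \<subseteq> A" using i(2) by (meson subsetD)
  moreover have "chain_of (N, x, y) \<subseteq> level n \<union> level (n + 1) \<union> level (n + 2)"
    using i(1) unfolding flags_def by auto
  then have "t \<subseteq> level n \<union> level (n + 1) \<union> level (n + 2)" using i(2) by (rule subset_trans[rotated])
  ultimately show "t \<in> ?r" using i(3) by simp
next
  fix t assume "t \<in> ?r"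
  then show "t \<in> cx" using chain_extends[of t] unfolding cx_def by blast
qed

end

section \<open>Adjacency in the middle level\<close>

context graded_down_sets
begin

text \<open>The partitions will be the middle level \<open>n + 1\<close>, hence the bounds on intersections are \<open>n\<close>.\<close>

definition mid :: "nat set set set" where
  "mid = {t. t \<noteq> {} \<and> t \<subseteq> level (n + 1) \<and> (\<forall>A\<in>t. \<forall>B\<in>t. n \<le> card (A \<inter> B))}"

text \<open>The union of comparability and of adjacency in the middle level. The flag complex
  \<open>big\<close> of this relation contains both \<open>mid\<close> and the order complex
  \<open>cx\<close>.\<close>

definition compat :: "nat set \<Rightarrow> nat set \<Rightarrow> bool" where
  "compat A B \<longleftrightarrow> A \<subseteq> B \<or> B \<subseteq> A \<or> (A \<in> level (n + 1) \<and> B \<in> level (n + 1) \<and> n \<le> card (A \<inter> B))"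

definition verts :: "nat set set" where
  "verts = level n \<union> level (n + 1) \<union> level (n + 2)"

definition big :: "nat set set set" where
  "big = {t. t \<noteq> {} \<and> t \<subseteq> verts \<and> (\<forall>A\<in>t. \<forall>B\<in>t. compat A B)}"

lemma finite_verts: "finite verts"
  unfolding verts_def using finite_level by simp

lemma compat_sym: "compat A B \<Longrightarrow> compat B A"
  unfolding compat_def by (auto simp: Int_commute)

lemma fin_complex_big: "fin_complex big"
proof -
  have "big \<subseteq> Pow verts" unfolding big_def by blast
  then have "finite big" using finite_verts finite_subset by blast
  moreover have "finite s" if "s \<in> big" for s
    using that finite_verts finite_subset unfolding big_def by blast
  moreover have "t \<in> big" if "s \<in> big" "t \<subseteq> s" "t \<noteq> {}" for s t
    using that unfolding big_def by blast
  moreover have "{} \<notin> big" unfolding big_def by blast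
  ultimately show ?thesis unfolding fin_complex_def by blast
qed

lemma insert_big:
  assumes "t \<in> big" "A \<in> verts" "\<And>B. B \<in> t \<Longrightarrow> compat A B"
  shows "insert A t \<in> big"
  using assms compat_sym unfolding big_def by (auto simp: compat_def)

lemma level_subset_eq: "A \<in> level k \<Longrightarrow> B \<in> level k \<Longrightarrow> A \<subseteq> B \<Longrightarrow> A = B"
  using levelD by (metis card_subset_eq)

lemma level_unique: "A \<in> level k \<Longrightarrow> A \<in> level l \<Longrightarrow> k = l"
  using levelD(3) by blast

lemma level_disjoint: "A \<in> level k \<Longrightarrow> k \<noteq> l \<Longrightarrow> A \<notin> level l"
  using levelD(3) by blast

lemma mid_disjoint: "A \<in> level n \<or> A \<in> level (n + 2) \<Longrightarrow> A \<notin> level (n + 1)"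
  using level_disjoint[of A n "n + 1"] level_disjoint[of A "n + 2" "n + 1"] by auto

lemma compat_less:
  assumes "compat A B" "A \<in> level k" "B \<in> level l" "k < l"
  shows "A \<subseteq> B"
proof -
  have "\<not> B \<subseteq> A"
    using card_mono[OF levelD(1)[OF assms(2)], of B] levelD(3)[OF assms(2)] levelD(3)[OF assms(3)] assms(4)
    by auto
  moreover have "\<not> (A \<in> level (n + 1) \<and> B \<in> level (n + 1))"
    using level_unique assms by blast
  ultimately show ?thesis using assms(1) unfolding compat_def by blast
qed

lemma compat_same:
  assumes "compat A B" "A \<in> level k" "B \<in> level k" "k \<noteq> n + 1"
  shows "A = B"
proof -
  have "\<not> A \<in> level (n + 1)" using level_unique assms by blast
  then show ?thesis using assms level_subset_eq unfolding compat_def by blast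
qed

lemma compat_mid:
  assumes "compat A B" "A \<in> level (n + 1)" "B \<in> level (n + 1)"
  shows "n \<le> card (A \<inter> B)"
  using assms levelD(3)[OF assms(2)] levelD(3)[OF assms(3)]
  unfolding compat_def by (auto simp: Int_absorb1 Int_absorb2)

lemma almost_subset:
  assumes "A \<in> level (n + 1)" "n \<le> card (A \<inter> B)" "d \<in> A" "d \<notin> B"
  shows "A - {d} \<subseteq> B"
proof -
  have "A \<inter> B \<subseteq> A - {d}" using assms(4) by blast
  moreover have "finite (A - {d})" "card (A - {d}) = n" using levelD[OF assms(1)] assms(3) by auto
  ultimately have "A \<inter> B = A - {d}" using assms(2) by (metis card_seteq)
  then show ?thesis by blast
qed

lemma meet_level:
  assumes "A \<in> level (n + 1)" "B \<in> level (n + 1)" "A \<noteq> B" "n \<le> card (A \<inter> B)"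
  shows "A \<inter> B \<in> level n"
proof -
  have "A \<inter> B \<subset> A" using level_subset_eq[OF assms(1,2)] assms(3) by blast
  then have "card (A \<inter> B) < n + 1" using psubset_card_mono levelD[OF assms(1)] by metis
  then show ?thesis
    using levelD(1,2)[OF assms(1)] levelD(2)[OF assms(2)] assms(4) down_closed_Int
    unfolding level_def by simp
qed

lemma common_upper:
  assumes "A \<in> level (n + 1)" "B \<in> level (n + 1)" "P \<in> level (n + 2)" "A \<subseteq> P" "B \<subseteq> P"
  shows "n \<le> card (A \<inter> B)"
proof -
  have "card (A \<union> B) \<le> n + 2" using card_mono[OF levelD(1)[OF assms(3)], of "A \<union> B"] levelD(3)[OF assms(3)] assms by simp
  moreover have "card A + card B = card (A \<union> B) + card (A \<inter> B)"
    using card_Un_Int levelD(1) assms by blast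
  ultimately show ?thesis using levelD(3) assms by simp
qed

lemma common_lower:
  assumes "A \<in> level (n + 1)" "N \<in> level n" "N \<subseteq> A" "N \<subseteq> B"
  shows "n \<le> card (A \<inter> B)"
proof -
  have "finite (A \<inter> B)" using levelD(1)[OF assms(1)] by blast
  then have "card N \<le> card (A \<inter> B)" using assms by (intro card_mono) auto
  then show ?thesis using levelD(3)[OF assms(2)] by simp
qed

section \<open>Collapse of the enlarged complex onto the middle level\<close>

definition long_edges :: "nat set set set" where
  "long_edges = {{N, P} | N P. N \<in> level n \<and> P \<in> level (n + 2) \<and> N \<subseteq> P}"

text \<open>Any middle set between \<open>N\<close> and \<open>P\<close> is an apex: the other
  members of a simplex containing both are middle sets containing \<open>N\<close>, so they meet the
  apex in at least \<open>n\<close> elements.\<close>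

lemma remove_long_edges:
  "cx_equiv big {t \<in> big. \<forall>s\<in>long_edges. \<not> s \<subseteq> t}"
proof -
  have "\<exists>L. \<forall>s\<in>long_edges. L s \<in> level (n + 1) \<and> (\<forall>A\<in>s. (A \<in> level n \<longrightarrow> A \<subseteq> L s) \<and> (A \<in> level (n + 2) \<longrightarrow> L s \<subseteq> A))"
  proof (rule bchoice, rule ballI)
    fix s assume "s \<in> long_edges"
    then obtain N P where s: "s = {N, P}" "N \<in> level n" "P \<in> level (n + 2)" "N \<subseteq> P"
      unfolding long_edges_def by blast
    then have "N \<subset> P" using levelD(3)[OF s(2)] levelD(3)[OF s(3)] by auto
    then obtain x where x: "x \<in> P - N" "insert x N \<in> level (Suc n)" using insert_between s by metis
    have "N \<notin> level (n + 2)" "P \<notin> level n" using level_disjoint[OF s(2), of "n + 2"] level_disjoint[OF s(3), of n] by simp_all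
    then show "\<exists>L. L \<in> level (n + 1) \<and> (\<forall>A\<in>s. (A \<in> level n \<longrightarrow> A \<subseteq> L) \<and> (A \<in> level (n + 2) \<longrightarrow> L \<subseteq> A))"
      using s x by (intro exI[of _ "insert x N"]) auto
  qed
  then obtain L where L0: "\<forall>s\<in>long_edges. L s \<in> level (n + 1) \<and>
      (\<forall>A\<in>s. (A \<in> level n \<longrightarrow> A \<subseteq> L s) \<and> (A \<in> level (n + 2) \<longrightarrow> L s \<subseteq> A))" by (elim exE)
  have L: "\<And>s. s \<in> long_edges \<Longrightarrow> L s \<in> level (n + 1)"
    "\<And>s A. s \<in> long_edges \<Longrightarrow> A \<in> s \<Longrightarrow> A \<in> level n \<Longrightarrow> A \<subseteq> L s"
    "\<And>s A. s \<in> long_edges \<Longrightarrow> A \<in> s \<Longrightarrow> A \<in> level (n + 2) \<Longrightarrow> L s \<subseteq> A"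
    using L0 by (metis (no_types, lifting))+
  show ?thesis
  proof (rule cone_removals[OF fin_complex_big, where a = L])
    have "long_edges \<subseteq> Pow verts" unfolding long_edges_def verts_def by auto
    then show "finite long_edges" using finite_verts finite_subset by blast
    show "s \<noteq> {} \<and> finite s" if "s \<in> long_edges" for s using that unfolding long_edges_def by auto
    show "L s \<notin> s'" if "s \<in> long_edges" "s' \<in> long_edges" for s s'
    proof -
      have "A \<in> level n \<or> A \<in> level (n + 2)" if "A \<in> s'" for A
        using that \<open>s' \<in> long_edges\<close> unfolding long_edges_def by auto
      then show ?thesis using L(1)[OF that(1)] mid_disjoint by blast
    qed
    fix s t assume st: "s \<in> long_edges" "t \<in> big" "s \<subseteq> t"
    obtain N P where s: "s = {N, P}" "N \<in> level n" "P \<in> level (n + 2)" "N \<subseteq> P"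
      using st(1) unfolding long_edges_def by blast
    have LN: "N \<subseteq> L s" "L s \<subseteq> P" using L[OF st(1)] s by auto
    have NP: "N \<in> t" "P \<in> t" using st(3) s(1) by auto
    show "insert (L s) t \<in> big"
    proof (rule insert_big[OF st(2)])
      show "L s \<in> verts" using L(1)[OF st(1)] unfolding verts_def by blast
      fix A assume A: "A \<in> t"
      have c: "compat A N" "compat A P" using A NP st(2) unfolding big_def by auto
      have "A \<in> verts" using A st(2) unfolding big_def by blast
      then consider "A \<in> level n" | "A \<in> level (n + 1)" | "A \<in> level (n + 2)" unfolding verts_def by blast
      then show "compat (L s) A"
      proof cases
        case 1
        then have "A = N" using compat_same[OF c(1)] s by simp
        then show ?thesis using LN unfolding compat_def by blast
      next
        case 2
        have "N \<subseteq> A" using compat_less[OF compat_sym[OF c(1)] s(2) 2] by simp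
        then have "n \<le> card (L s \<inter> A)" using common_lower[OF L(1)[OF st(1)] s(2)] LN by blast
        then show ?thesis using 2 L(1)[OF st(1)] unfolding compat_def by blast
      next
        case 3
        then have "A = P" using compat_same[OF c(2)] s by simp
        then show ?thesis using LN unfolding compat_def by blast
      qed
    qed
  qed
qed

text \<open>Without long edges, the other members of a simplex containing an outer set
  \<open>A\<close> are middle sets, all above \<open>A\<close> or all below it. Any middle set
  comparable with \<open>A\<close> is then an apex.\<close>

lemma remove_outer_vertices:
  "cx_equiv {t \<in> big. \<forall>s\<in>long_edges. \<not> s \<subseteq> t} mid"
proof -
  let ?K = "{t \<in> big. \<forall>s\<in>long_edges. \<not> s \<subseteq> t}" and ?S = "(\<lambda>A. {A}) ` (level n \<union> level (n + 2))"
  have K: "fin_complex ?K" using fin_complex_big unfolding fin_complex_def by auto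
  have "\<exists>L. \<forall>s\<in>?S. L s \<in> level (n + 1) \<and> (\<forall>A\<in>s. (A \<in> level n \<longrightarrow> A \<subseteq> L s) \<and> (A \<in> level (n + 2) \<longrightarrow> L s \<subseteq> A))"
  proof (rule bchoice, rule ballI)
    fix s assume "s \<in> ?S"
    then obtain A where s: "s = {A}" and A: "A \<in> level n \<or> A \<in> level (n + 2)" by blast
    from A show "\<exists>L. L \<in> level (n + 1) \<and> (\<forall>A\<in>s. (A \<in> level n \<longrightarrow> A \<subseteq> L) \<and> (A \<in> level (n + 2) \<longrightarrow> L \<subseteq> A))"
    proof
      assume A: "A \<in> level n"
      then obtain x where "insert x A \<in> level (Suc n)" using insert_missing by blast
      moreover have "A \<notin> level (n + 2)" using level_disjoint[OF A, of "n + 2"] by simp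
      ultimately show ?thesis using s by (intro exI[of _ "insert x A"]) auto
    next
      assume A: "A \<in> level (n + 2)"
      then obtain x where "A - {x} \<in> level (Suc n)" using remove_max[of A "Suc n"] by auto
      moreover have "A \<notin> level n" using level_disjoint[OF A, of n] by simp
      ultimately show ?thesis using s by (intro exI[of _ "A - {x}"]) auto
    qed
  qed
  then obtain L where L0: "\<forall>s\<in>?S. L s \<in> level (n + 1) \<and>
      (\<forall>A\<in>s. (A \<in> level n \<longrightarrow> A \<subseteq> L s) \<and> (A \<in> level (n + 2) \<longrightarrow> L s \<subseteq> A))" by (elim exE)
  have L: "\<And>s. s \<in> ?S \<Longrightarrow> L s \<in> level (n + 1)"
    "\<And>s A. s \<in> ?S \<Longrightarrow> A \<in> s \<Longrightarrow> A \<in> level n \<Longrightarrow> A \<subseteq> L s"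
    "\<And>s A. s \<in> ?S \<Longrightarrow> A \<in> s \<Longrightarrow> A \<in> level (n + 2) \<Longrightarrow> L s \<subseteq> A"
    using L0 by (metis (no_types, lifting))+
  have "cx_equiv ?K {t \<in> ?K. \<forall>s\<in>?S. \<not> s \<subseteq> t}"
  proof (rule cone_removals[OF K, where a = L])
    show "finite ?S" using finite_level by blast
    show "L s \<notin> s'" if "s \<in> ?S" "s' \<in> ?S" for s s'
    proof -
      have "A \<in> level n \<or> A \<in> level (n + 2)" if "A \<in> s'" for A
        using that \<open>s' \<in> ?S\<close> by auto
      then show ?thesis using L(1)[OF that(1)] mid_disjoint by blast
    qed
    fix s t assume st: "s \<in> ?S" "t \<in> ?K" "s \<subseteq> t"
    then obtain A where A: "s = {A}" "A \<in> level n \<or> A \<in> level (n + 2)" "A \<in> t" by blast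
    have Ls: "L s \<in> level (n + 1)" using L(1)[OF st(1)] .
    have "insert (L s) t \<in> big"
    proof (rule insert_big)
      show "t \<in> big" using st(2) by blast
      show "L s \<in> verts" using Ls unfolding verts_def by blast
      fix B assume B: "B \<in> t"
      have c: "compat A B" "compat B A" using A(3) B st(2) unfolding big_def by auto
      have "B \<in> verts" using B st(2) unfolding big_def by blast
      from A(2) show "compat (L s) B"
      proof
        assume lev: "A \<in> level n"
        have AL: "A \<subseteq> L s" using L(2)[OF st(1)] A(1) lev by blast
        have "B \<notin> level (n + 2)"
        proof
          assume P: "B \<in> level (n + 2)"
          then have "A \<subseteq> B" using compat_less[OF c(1) lev P] by simp
          then have "{A, B} \<in> long_edges" using lev P unfolding long_edges_def by blast
          then show False using st(2) A(3) B by auto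
        qed
        then consider "B \<in> level n" | "B \<in> level (n + 1)" using \<open>B \<in> verts\<close> unfolding verts_def by blast
        then show ?thesis
        proof cases
          case 1
          then have "A = B" using compat_same[OF c(1) lev] by simp
          then show ?thesis using AL unfolding compat_def by blast
        next
          case 2
          have "A \<subseteq> B" using compat_less[OF c(1) lev 2] by simp
          then have "n \<le> card (L s \<inter> B)" using common_lower[OF Ls lev AL] by blast
          then show ?thesis using 2 Ls unfolding compat_def by blast
        qed
      next
        assume lev: "A \<in> level (n + 2)"
        have AL: "L s \<subseteq> A" using L(3)[OF st(1)] A(1) lev by blast
        have "B \<notin> level n"
        proof
          assume P: "B \<in> level n"
          then have "B \<subseteq> A" using compat_less[OF c(2) P lev] by simp
          then have "{B, A} \<in> long_edges" using lev P unfolding long_edges_def by blast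
          then show False using st(2) A(3) B by auto
        qed
        then consider "B \<in> level (n + 2)" | "B \<in> level (n + 1)" using \<open>B \<in> verts\<close> unfolding verts_def by blast
        then show ?thesis
        proof cases
          case 1
          then have "A = B" using compat_same[OF c(1) lev] by simp
          then show ?thesis using AL unfolding compat_def by blast
        next
          case 2
          have "B \<subseteq> A" using compat_less[OF c(2) 2 lev] by simp
          then have "n \<le> card (L s \<inter> B)" using common_upper[OF Ls 2 lev AL] by blast
          then show ?thesis using 2 Ls unfolding compat_def by blast
        qed
      qed
    qed
    \<comment> \<open>A middle set is no end of a long edge, so adding it brings none back.\<close>
    moreover have "\<not> e \<subseteq> insert (L s) t" if e: "e \<in> long_edges" for e
    proof
      assume "e \<subseteq> insert (L s) t"
      moreover have "L s \<notin> e"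
        using e Ls mid_disjoint unfolding long_edges_def by blast
      ultimately have "e \<subseteq> t" by blast
      then show False using st(2) e by blast
    qed
    ultimately show "insert (L s) t \<in> ?K" by blast
  qed auto
  moreover have "{t \<in> ?K. \<forall>s\<in>?S. \<not> s \<subseteq> t} = mid"
  proof (intro equalityI subsetI)
    fix t assume t: "t \<in> {t \<in> ?K. \<forall>s\<in>?S. \<not> s \<subseteq> t}"
    then have sub: "t \<subseteq> level (n + 1)" unfolding big_def verts_def by fastforce
    have "n \<le> card (A \<inter> B)" if "A \<in> t" "B \<in> t" for A B
      using t that sub unfolding big_def by (intro compat_mid) auto
    then show "t \<in> mid" using t sub unfolding mid_def big_def by auto
  next
    fix t assume t: "t \<in> mid"
    then have sub: "t \<subseteq> level (n + 1)" unfolding mid_def by blast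
    have out: "A \<notin> t" if "A \<in> level n \<or> A \<in> level (n + 2)" for A
      using sub mid_disjoint[OF that] by blast
    have "compat A B" if "A \<in> t" "B \<in> t" for A B
      using t that unfolding mid_def compat_def by blast
    then have "t \<in> big" using t sub unfolding big_def mid_def verts_def by blast
    moreover have "\<not> s \<subseteq> t" if "s \<in> long_edges" for s
      using that out unfolding long_edges_def by auto
    ultimately show "t \<in> {t \<in> ?K. \<forall>s\<in>?S. \<not> s \<subseteq> t}" using out by auto
  qed
  ultimately show ?thesis by simp
qed

section \<open>Collapse of the enlarged complex onto the order complex\<close>

definition mid_faces :: "nat \<Rightarrow> nat set set set" where
  "mid_faces k = {s \<in> big. s \<subseteq> level (n + 1) \<and> card s = k}"

lemma finite_mid_faces: "finite (mid_faces k)"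
  using fin_complexD(1)[OF fin_complex_big] unfolding mid_faces_def by simp

text \<open>Three pairwise adjacent members of the middle level either contain a common member of the level
  below or are contained in a common member of the level above; this member serves as the apex.\<close>

lemma mid_triple_apex:
  assumes "s \<in> mid_faces 3"
  shows "\<exists>C. (C \<in> level n \<or> C \<in> level (n + 2)) \<and> (\<forall>t\<in>big. s \<subseteq> t \<longrightarrow> insert C t \<in> big)"
proof -
  have s: "s \<in> big" "s \<subseteq> level (n + 1)" "card s = 3" using assms unfolding mid_faces_def by auto
  obtain X Y Z where XYZ: "s = {X, Y, Z}" "X \<noteq> Y" "X \<noteq> Z" "Y \<noteq> Z"
    using s(3) unfolding card_3_iff by blast
  have lev: "X \<in> level (n + 1)" "Y \<in> level (n + 1)" "Z \<in> level (n + 1)" using s(2) XYZ(1) by auto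
  have near: "n \<le> card (A \<inter> B)" if "A \<in> s" "B \<in> s" for A B
    using s that unfolding big_def by (intro compat_mid) auto
  have XYn: "X \<inter> Y \<in> level n" using meet_level lev XYZ near by auto
  have XY: "\<not> X \<subseteq> Y" "\<not> Y \<subseteq> X" "\<not> X \<subseteq> Z" "\<not> Y \<subseteq> Z" "\<not> Z \<subseteq> X" "\<not> Z \<subseteq> Y"
    using level_subset_eq lev XYZ by metis+
  have card_insert: "card (insert a N) = Suc (card N)" if "finite N" "a \<notin> N" for a and N :: "nat set"
    using that by simp
  show ?thesis
  proof (cases "X \<inter> Y \<subseteq> Z")
    case True
    let ?N = "X \<inter> Y"
    \<comment> \<open>\<open>X\<close>, \<open>Y\<close>, \<open>Z\<close> each add one element to
      \<open>?N\<close>, and these are distinct, so their union has \<open>n + 3\<close> elements. A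
      middle set missing some \<open>d\<close> of \<open>?N\<close> would have to contain the union
      without \<open>d\<close>, which is too large.\<close>
    have "?N \<subseteq> A" if t: "t \<in> big" "s \<subseteq> t" "A \<in> t" "A \<in> level (n + 1)" for t A
    proof (rule ccontr)
      assume "\<not> ?N \<subseteq> A"
      then obtain d where d: "d \<in> X" "d \<in> Y" "d \<in> Z" "d \<notin> A" using True by blast
      have "B - {d} \<subseteq> A" if "B \<in> s" for B
      proof -
        have "compat B A" using t that unfolding big_def by blast
        then show ?thesis
          using almost_subset[of B A d] compat_mid[of B A] t(4) that s(2) d XYZ(1) by auto
      qed
      then have sub: "(X \<union> Y \<union> Z) - {d} \<subseteq> A" using XYZ(1) by auto
      obtain a where a: "a \<in> X" "a \<notin> Y" using XY by blast
      obtain b where b: "b \<in> Y" "b \<notin> X" using XY by blast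
      have "n \<le> card (Z \<inter> X)" "n \<le> card (Z \<inter> Y)" using near XYZ(1) by auto
      obtain c where c: "c \<in> Z" "c \<notin> X" using XY by blast
      have "c \<notin> Y"
      proof
        assume "c \<in> Y"
        have "insert c ?N \<subseteq> Z \<inter> Y" using True c \<open>c \<in> Y\<close> by blast
        moreover have "finite (Z \<inter> Y)" "card (insert c ?N) = n + 1"
          using levelD[OF XYn] levelD(1)[OF lev(2)] c by auto
        ultimately have "n + 1 \<le> card (Z \<inter> Y)" using card_mono by metis
        then have "Z \<inter> Y = Y" using levelD[OF lev(2)] by (intro card_seteq) auto
        then show False using XY by blast
      qed
      have abc: "a \<notin> ?N" "b \<notin> insert a ?N" "c \<notin> insert b (insert a ?N)"
        using a b c \<open>c \<notin> Y\<close> by auto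
      have "insert c (insert b (insert a ?N)) - {d} \<subseteq> A" using sub a b c by blast
      moreover have "card (insert c (insert b (insert a ?N)) - {d}) = n + 2"
        using abc d levelD[OF XYn] by (subst card_Diff_singleton) auto
      ultimately have "n + 2 \<le> card A" using card_mono[OF levelD(1)[OF t(4)]] by metis
      then show False using levelD(3)[OF t(4)] by simp
    qed
    note mid_A = this
    have "insert ?N t \<in> big" if t: "t \<in> big" "s \<subseteq> t" for t
    proof (rule insert_big[OF t(1)])
      show "?N \<in> verts" using XYn unfolding verts_def by blast
      fix A assume A: "A \<in> t"
      have c: "compat A X" "compat A Y" using A t XYZ(1) unfolding big_def by auto
      have "A \<in> verts" using A t unfolding big_def by blast
      then consider "A \<in> level n" | "A \<in> level (n + 1)" | "A \<in> level (n + 2)" unfolding verts_def by blast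
      then show "compat ?N A"
      proof cases
        case 1
        then have "A \<subseteq> ?N" using compat_less[OF c(1) 1 lev(1)] compat_less[OF c(2) 1 lev(2)] by simp
        then show ?thesis unfolding compat_def by blast
      next
        case 2
        then show ?thesis using mid_A[OF t A] unfolding compat_def by blast
      next
        case 3
        then have "X \<subseteq> A" using compat_less[OF compat_sym[OF c(1)] lev(1) 3] by simp
        then show ?thesis unfolding compat_def by blast
      qed
    qed
    then show ?thesis using XYn by blast
  next
    case False
    let ?P = "X \<union> Y"
    have cP: "card ?P = n + 2"
      using card_Un_Int[of X Y] levelD[OF lev(1)] levelD[OF lev(2)] levelD(3)[OF XYn] by simp
    then have P: "?P \<in> level (n + 2)"
      using levelD[OF lev(1)] levelD[OF lev(2)] down_closed_Un unfolding level_def by simp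
    \<comment> \<open>As \<open>Z\<close> misses only \<open>d\<close> from \<open>X\<close> and
      only \<open>d\<close> from \<open>Y\<close>, counting gives
      \<open>Z = X \<union> Y - {d}\<close>; so all three lie in \<open>?P\<close>.\<close>
    obtain d where d: "d \<in> X" "d \<in> Y" "d \<notin> Z" using False by blast
    have XZ: "X - {d} \<subseteq> Z" "Y - {d} \<subseteq> Z"
      using almost_subset[of X Z d] almost_subset[of Y Z d] lev d near XYZ(1) by auto
    then have "?P - {d} \<subseteq> Z" by blast
    moreover have "card (?P - {d}) = n + 1" using cP d by simp
    ultimately have Z: "?P - {d} = Z"
      using levelD[OF lev(3)] by (intro card_seteq) auto
    \<comment> \<open>An element \<open>e\<close> of \<open>A\<close> outside \<open>?P\<close>
      would force the \<open>n\<close> other elements of \<open>A\<close> into the intersection of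
      \<open>X\<close>, \<open>Y\<close> and \<open>Z\<close>, which has fewer than \<open>n\<close>
      elements.\<close>
    have "A \<subseteq> ?P" if t: "t \<in> big" "s \<subseteq> t" "A \<in> t" "A \<in> level (n + 1)" for t A
    proof (rule ccontr)
      assume "\<not> A \<subseteq> ?P"
      then obtain e where e: "e \<in> A" "e \<notin> X" "e \<notin> Y" by blast
      then have eZ: "e \<notin> Z" using Z by blast
      have "A - {e} \<subseteq> B" if "B \<in> s" for B
      proof -
        have "compat A B" using t that unfolding big_def by blast
        then show ?thesis
          using almost_subset[of A B e] compat_mid[of A B] t(4) that s(2) e eZ XYZ(1) by auto
      qed
      then have "A - {e} \<subseteq> (X \<inter> Y) - {d}" using XYZ(1) d by auto
      then have "card (A - {e}) \<le> card ((X \<inter> Y) - {d})"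
        using levelD(1)[OF XYn] by (intro card_mono) auto
      moreover have "card (A - {e}) = n" using levelD[OF t(4)] e(1) by simp
      moreover have "card ((X \<inter> Y) - {d}) < n"
        using levelD[OF XYn] d card_Diff1_less[of "X \<inter> Y" d] by auto
      ultimately show False by simp
    qed
    note mid_A = this
    have "insert ?P t \<in> big" if t: "t \<in> big" "s \<subseteq> t" for t
    proof (rule insert_big[OF t(1)])
      show "?P \<in> verts" using P unfolding verts_def by blast
      fix A assume A: "A \<in> t"
      have c: "compat A X" "compat A Y" using A t XYZ(1) unfolding big_def by auto
      have "A \<in> verts" using A t unfolding big_def by blast
      then consider "A \<in> level n" | "A \<in> level (n + 1)" | "A \<in> level (n + 2)" unfolding verts_def by blast
      then show "compat ?P A"
      proof cases
        case 1
        then have "A \<subseteq> X" using compat_less[OF c(1) 1 lev(1)] by simp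
        then show ?thesis unfolding compat_def by blast
      next
        case 2
        then show ?thesis using mid_A[OF t A] unfolding compat_def by blast
      next
        case 3
        then have "?P \<subseteq> A"
          using compat_less[OF compat_sym[OF c(1)] lev(1) 3] compat_less[OF compat_sym[OF c(2)] lev(2) 3] by simp
        then show ?thesis unfolding compat_def by blast
      qed
    qed
    then show ?thesis using P by blast
  qed
qed

lemma mid_faces_no_outer: "s \<in> mid_faces k \<Longrightarrow> C \<in> level n \<or> C \<in> level (n + 2) \<Longrightarrow> C \<notin> s"
  unfolding mid_faces_def using mid_disjoint by blast

text \<open>Triples must go before pairs: next to a pair \<open>X\<close>, \<open>Y\<close> there
  may be a third middle set that does not contain \<open>X \<inter> Y\<close>, whereas a triple
  decides between a lower and an upper apex for all simplices containing it.\<close>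

lemma remove_mid_triples: "cx_equiv big {t \<in> big. \<forall>s\<in>mid_faces 3. \<not> s \<subseteq> t}"
proof -
  obtain C where C: "\<And>s. s \<in> mid_faces 3 \<Longrightarrow> C s \<in> level n \<or> C s \<in> level (n + 2)"
    "\<And>s t. s \<in> mid_faces 3 \<Longrightarrow> t \<in> big \<Longrightarrow> s \<subseteq> t \<Longrightarrow> insert (C s) t \<in> big"
    using bchoice[of "mid_faces 3" "\<lambda>s C. (C \<in> level n \<or> C \<in> level (n + 2)) \<and> (\<forall>t\<in>big. s \<subseteq> t \<longrightarrow> insert C t \<in> big)"]
      mid_triple_apex by (metis (no_types, lifting))
  show ?thesis
  proof (rule cone_removals[OF fin_complex_big finite_mid_faces, where a = C])
    show "s \<noteq> {} \<and> finite s" if "s \<in> mid_faces 3" for s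
      using that fin_complexD(2,3)[OF fin_complex_big] unfolding mid_faces_def by auto
    show "C s \<notin> s'" if "s \<in> mid_faces 3" "s' \<in> mid_faces 3" for s s'
      using mid_faces_no_outer[OF that(2)] C(1)[OF that(1)] by blast
  qed (rule C(2))
qed

text \<open>With the triples gone, \<open>X\<close> and \<open>Y\<close> are the only middle members
  of a simplex containing both, and \<open>X \<inter> Y\<close> is an apex. Afterwards no
  incomparable members are left in any simplex.\<close>

lemma remove_mid_pairs: "cx_equiv {t \<in> big. \<forall>s\<in>mid_faces 3. \<not> s \<subseteq> t} cx"
proof -
  let ?K = "{t \<in> big. \<forall>s\<in>mid_faces 3. \<not> s \<subseteq> t}"
  have K: "fin_complex ?K" using fin_complex_big unfolding fin_complex_def by auto
  have pair: "\<exists>X Y. s = {X, Y} \<and> X \<noteq> Y \<and> X \<in> level (n + 1) \<and> Y \<in> level (n + 1) \<and> X \<inter> Y \<in> level n"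
    if s: "s \<in> mid_faces 2" for s
  proof -
    have "card s = 2" using s unfolding mid_faces_def by blast
    then obtain X Y where XY: "s = {X, Y}" "X \<noteq> Y" unfolding card_2_iff by blast
    have lev: "X \<in> level (n + 1)" "Y \<in> level (n + 1)" and "compat X Y"
      using that XY unfolding mid_faces_def big_def by auto
    then have "X \<inter> Y \<in> level n" using meet_level[OF lev XY(2)] compat_mid by blast
    then show ?thesis using XY lev by blast
  qed
  have Inter: "\<Inter>s \<in> level n" if "s \<in> mid_faces 2" for s using pair[OF that] by auto
  have "cx_equiv ?K {t \<in> ?K. \<forall>s\<in>mid_faces 2. \<not> s \<subseteq> t}"
  proof (rule cone_removals[OF K finite_mid_faces, where a = Inter])
    show "s \<noteq> {} \<and> finite s" if "s \<in> mid_faces 2" for s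
      using that fin_complexD(2,3)[OF fin_complex_big] unfolding mid_faces_def by auto
    show "\<Inter>s \<notin> s'" if "s \<in> mid_faces 2" "s' \<in> mid_faces 2" for s s'
      using mid_faces_no_outer[OF that(2)] Inter[OF that(1)] by blast
    fix s t assume st: "s \<in> mid_faces 2" "t \<in> ?K" "s \<subseteq> t"
    obtain X Y where XY: "s = {X, Y}" "X \<noteq> Y" "X \<in> level (n + 1)" "Y \<in> level (n + 1)" "X \<inter> Y \<in> level n"
      using pair[OF st(1)] by blast
    have t: "t \<in> big" "X \<in> t" "Y \<in> t" using st XY(1) by auto
    have "insert (X \<inter> Y) t \<in> big"
    proof (rule insert_big[OF t(1)])
      show "X \<inter> Y \<in> verts" using XY(5) unfolding verts_def by blast
      fix A assume A: "A \<in> t"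
      have c: "compat A X" "compat A Y" using A t unfolding big_def by auto
      have "A \<in> verts" using A t unfolding big_def by blast
      then consider "A \<in> level n" | "A \<in> level (n + 1)" | "A \<in> level (n + 2)" unfolding verts_def by blast
      then show "compat (X \<inter> Y) A"
      proof cases
        case 1
        then have "A \<subseteq> X \<inter> Y" using compat_less[OF c(1) 1 XY(3)] compat_less[OF c(2) 1 XY(4)] by simp
        then show ?thesis unfolding compat_def by blast
      next
        case 2
        have "A = X \<or> A = Y"
        proof (rule ccontr)
          assume ne: "\<not> (A = X \<or> A = Y)"
          have sub: "{A, X, Y} \<subseteq> t" using A t by blast
          have "{A, X, Y} \<in> big" using fin_complexD(4)[OF fin_complex_big t(1) sub] by blast
          then have "{A, X, Y} \<in> mid_faces 3" using 2 XY ne unfolding mid_faces_def by auto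
          then show False using st(2) sub by blast
        qed
        then show ?thesis unfolding compat_def by blast
      next
        case 3
        then have "X \<subseteq> A" using compat_less[OF compat_sym[OF c(1)] XY(3) 3] by simp
        then show ?thesis unfolding compat_def by blast
      qed
    qed
    moreover have "\<not> e \<subseteq> insert (X \<inter> Y) t" if e: "e \<in> mid_faces 3" for e
    proof
      assume "e \<subseteq> insert (X \<inter> Y) t"
      moreover have "X \<inter> Y \<notin> e" using mid_faces_no_outer[OF e] XY(5) by blast
      ultimately have "e \<subseteq> t" by blast
      then show False using st(2) e by blast
    qed
    ultimately show "insert (\<Inter>s) t \<in> ?K" using XY(1) by simp
  qed
  moreover have "{t \<in> ?K. \<forall>s\<in>mid_faces 2. \<not> s \<subseteq> t} = cx"
  proof (intro equalityI subsetI)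
    fix t assume t: "t \<in> {t \<in> ?K. \<forall>s\<in>mid_faces 2. \<not> s \<subseteq> t}"
    then have tb: "t \<in> big" "t \<noteq> {}" "t \<subseteq> verts" unfolding big_def by auto
    have no_pair: "\<not> {A, B} \<subseteq> t" if "{A, B} \<in> mid_faces 2" for A B using t that by blast
    have "A \<subseteq> B \<or> B \<subseteq> A" if AB: "A \<in> t" "B \<in> t" for A B
    proof (rule ccontr)
      assume ne: "\<not> (A \<subseteq> B \<or> B \<subseteq> A)"
      have "compat A B" using tb AB unfolding big_def by blast
      then have lev: "A \<in> level (n + 1)" "B \<in> level (n + 1)" using ne unfolding compat_def by auto
      have "{A, B} \<in> big" using fin_complexD(4)[OF fin_complex_big tb(1), of "{A, B}"] AB by blast
      then have "{A, B} \<in> mid_faces 2" using lev ne unfolding mid_faces_def by (auto simp: card_insert_if)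
      then show False using no_pair[of A B] AB by simp
    qed
    then show "t \<in> cx" using tb(2,3) unfolding order_complex verts_def by simp
  next
    fix t assume "t \<in> cx"
    then have t: "t \<noteq> {}" "t \<subseteq> verts" "\<And>A B. A \<in> t \<Longrightarrow> B \<in> t \<Longrightarrow> A \<subseteq> B \<or> B \<subseteq> A"
      unfolding order_complex verts_def by auto
    have "\<forall>A\<in>t. \<forall>B\<in>t. compat A B" using t(3) unfolding compat_def by blast
    then have "t \<in> big" using t(1,2) unfolding big_def by simp
    have le1: "card s \<le> Suc 0" if "s \<subseteq> t" "s \<subseteq> level (n + 1)" for s
    proof -
      have "A = B" if "A \<in> s" "B \<in> s" for A B
      proof -
        have AB: "A \<in> t" "B \<in> t" "A \<in> level (n + 1)" "B \<in> level (n + 1)"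
          using that \<open>s \<subseteq> t\<close> \<open>s \<subseteq> level (n + 1)\<close> by auto
        show ?thesis
          using t(3)[OF AB(1,2)] level_subset_eq[OF AB(3,4)] level_subset_eq[OF AB(4,3)] by auto
      qed
      moreover have "finite s" using finite_subset[OF that(2) finite_level] .
      ultimately show ?thesis using card_le_Suc0_iff_eq by metis
    qed
    have "\<not> s \<subseteq> t" if "s \<in> mid_faces k" "k \<ge> 2" for s k
      using le1[of s] that unfolding mid_faces_def by auto
    from this[of _ 2] this[of _ 3] show "t \<in> {t \<in> ?K. \<forall>s\<in>mid_faces 2. \<not> s \<subseteq> t}"
      using \<open>t \<in> big\<close> by simp
  qed
  ultimately show ?thesis by simp
qed

theorem mid_wedge:
  "\<exists>b. int b = euler_char mid - 1 \<and> geometric_realization mid homotopy_equivalent_space wedge_of_2_spheres b"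
proof -
  have "cx_equiv mid cx"
    using remove_long_edges remove_outer_vertices remove_mid_triples remove_mid_pairs
      cx_equiv_trans cx_equiv_sym by meson
  then show ?thesis using wedge homotopy_eqv_trans unfolding cx_equiv_def by metis
qed

end

section \<open>Young diagrams\<close>

text \<open>The cell \<open>(i, j)\<close> of a diagram is encoded as \<open>prod_encode (i, j)\<close>; by the definition of this
  function, the usual order of the codes is a linear extension of the order of cells.\<close>

definition cell_below :: "nat \<Rightarrow> nat \<Rightarrow> bool" where
  "cell_below a b \<longleftrightarrow> (\<exists>i j. a = prod_encode (i, j) \<and>
     (b = prod_encode (Suc i, j) \<or> b = prod_encode (i, Suc j)))"

interpretation young: down_sets cell_below
proof
  fix a b assume "cell_below a b"
  then show "a < b" unfolding cell_below_def prod_encode_def by auto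
qed

text \<open>The conjugate partition, with columns counted from 0. Column heights can be read off a
  multiset without sorting its parts into rows.\<close>

definition col_height :: "nat multiset \<Rightarrow> nat \<Rightarrow> nat" where
  "col_height p j = size {#a \<in># p. j < a#}"

definition diagram :: "nat multiset \<Rightarrow> nat set" where
  "diagram p = prod_encode ` {(i, j). i < col_height p j}"

lemma mem_diagram: "prod_encode (i, j) \<in> diagram p \<longleftrightarrow> i < col_height p j"
  unfolding diagram_def by auto

lemma col_height_empty [simp]: "col_height {#} j = 0"
  unfolding col_height_def by simp

lemma col_height_add_mset [simp]:
  "col_height (add_mset a p) j = col_height p j + (if j < a then 1 else 0)"
  unfolding col_height_def by simp

lemma col_height_Suc: "col_height p j = col_height p (Suc j) + count p (Suc j)"
  by (induction p) auto

lemma col_height_beyond: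
  assumes "sum_mset p \<le> j"
  shows "col_height p j = 0"
  using assms by (induction p) auto

lemma sum_col_height:
  assumes "sum_mset p \<le> m"
  shows "(\<Sum>j<m. col_height p j) = sum_mset p"
  using assms
proof (induction p)
  case (add a p)
  have "(\<Sum>j<m. if j < a then 1 else 0) = card ({..<m} \<inter> {j. j < a})"
    by (simp add: sum.If_cases)
  also have "{..<m} \<inter> {j. j < a} = {..<a}" using add.prems by auto
  finally show ?case using add by (simp add: sum.distrib)
qed simp

lemma finite_diagram: "finite (diagram p)" and card_diagram: "card (diagram p) = sum_mset p"
proof -
  let ?m = "sum_mset p"
  have eq: "{(i, j). i < col_height p j} = prod.swap ` (SIGMA j:{..<?m}. {..<col_height p j})"
    using col_height_beyond[of p] by (force simp: not_less[symmetric])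
  show "finite (diagram p)" unfolding diagram_def eq by simp
  have "card (diagram p) = card (SIGMA j:{..<?m}. {..<col_height p j})"
    unfolding diagram_def eq by (simp add: card_image inj_on_def)
  then show "card (diagram p) = sum_mset p" by (simp add: sum_col_height)
qed

lemma down_closed_diagram: "young.down_closed (diagram p)"
proof -
  have "a \<in> diagram p" if b: "b \<in> diagram p" "cell_below a b" for a b
  proof -
    obtain i j where a: "a = prod_encode (i, j)"
      and "b = prod_encode (Suc i, j) \<or> b = prod_encode (i, Suc j)"
      using b(2) unfolding cell_below_def by blast
    then have "Suc i < col_height p j \<or> i < col_height p (Suc j)" using b(1) mem_diagram by blast
    then have "i < col_height p j" using col_height_Suc[of p j] by auto
    then show ?thesis unfolding a mem_diagram .
  qed
  then show ?thesis unfolding young.down_closed_def by blast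
qed

text \<open>The multiplicity of a part \<open>Suc j\<close> is the drop in height from column
  \<open>j\<close> to the next one. Parts 0 leave no trace in the diagram.\<close>

lemma diagram_inj:
  assumes "diagram p = diagram q" "0 \<notin># p" "0 \<notin># q"
  shows "p = q"
proof (rule multiset_eqI)
  have h: "col_height p j = col_height q j" for j
    using assms(1) mem_diagram[of _ j p] mem_diagram[of _ j q] by (metis linorder_neqE_nat less_irrefl)
  fix a
  show "count p a = count q a"
  proof (cases a)
    case 0
    then show ?thesis using assms(2,3) by (simp add: not_in_iff)
  next
    case (Suc j)
    then show ?thesis using col_height_Suc[of p j] col_height_Suc[of q j] by (simp add: h)
  qed
qed

section \<open>Adding a cell on top of column \<open>b\<close>; creating a part is the case of
  column 0\<close>

definition grow :: "nat \<Rightarrow> nat multiset \<Rightarrow> nat multiset" where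
  "grow b r = (if b = 0 then add_mset 1 r else add_mset (Suc b) (r - {#b#}))"

definition growable :: "nat \<Rightarrow> nat multiset \<Rightarrow> bool" where
  "growable b r \<longleftrightarrow> b = 0 \<or> b \<in># r"

lemma col_height_grow:
  assumes "growable b r"
  shows "col_height (grow b r) j = col_height r j + (if j = b then 1 else 0)"
proof (cases "b = 0")
  case False
  then obtain r' where "r = add_mset b r'" using assms unfolding growable_def by (metis mset_add)
  then show ?thesis using False unfolding grow_def by auto
qed (simp add: grow_def)

lemma diagram_grow:
  assumes "growable b r"
  shows "diagram (grow b r) = insert (prod_encode (col_height r b, b)) (diagram r)"
proof -
  have "{(i, j). i < col_height (grow b r) j} = insert (col_height r b, b) {(i, j). i < col_height r j}"
    unfolding col_height_grow[OF assms] by (auto split: if_splits)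
  then show ?thesis unfolding diagram_def by simp
qed

lemma sum_grow:
  assumes "growable b r"
  shows "sum_mset (grow b r) = Suc (sum_mset r)"
proof (cases "b = 0")
  case False
  then obtain r' where "r = add_mset b r'" using assms unfolding growable_def by (metis mset_add)
  then show ?thesis using False unfolding grow_def by simp
qed (simp add: grow_def)

lemma zero_notin_grow: "0 \<notin># r \<Longrightarrow> 0 \<notin># grow b r"
  unfolding grow_def by (auto dest: in_diffD)

text \<open>The neighbour of the new cell within its column forces it to sit directly on that
  column. The neighbour in the preceding column makes that column strictly higher, so a part of size
  \<open>j\<close> exists.\<close>

lemma insert_cell_diagram:
  assumes "c \<notin> diagram r" "young.down_closed (insert c (diagram r))"
  shows "\<exists>b. growable b r \<and> insert c (diagram r) = diagram (grow b r)"
proof -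
  obtain i j where c: "c = prod_encode (i, j)" by (metis prod_decode_inverse surj_pair)
  have below: "a \<in> diagram r" if "cell_below a c" for a
    using assms(2) that young.below_less[OF that] unfolding young.down_closed_def by blast
  have "col_height r j \<le> i" using assms(1) unfolding c mem_diagram by simp
  moreover have "i \<le> col_height r j"
  proof (cases i)
    case (Suc i')
    have "cell_below (prod_encode (i', j)) c" unfolding c Suc cell_below_def by blast
    then have "i' < col_height r j" using below mem_diagram by blast
    then show ?thesis using Suc by simp
  qed simp
  ultimately have i: "i = col_height r j" by simp
  have "growable j r"
  proof (cases j)
    case (Suc j')
    have "cell_below (prod_encode (i, j')) c" unfolding c Suc cell_below_def by blast
    then have "i < col_height r j'" using below mem_diagram by blast
    then have "count r j > 0" using col_height_Suc[of r j'] i Suc by simp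
    then show ?thesis unfolding growable_def by simp
  qed (simp add: growable_def)
  then show ?thesis using diagram_grow i c by metis
qed

lemma diagram_level: "p \<in> partitions_of m \<Longrightarrow> diagram p \<in> young.level m"
  unfolding young.level_def partitions_of_def
  using finite_diagram card_diagram down_closed_diagram by auto

text \<open>Removing the cell with the greatest code leaves a down-set, and putting it back enlarges
  the partition found by induction.\<close>

lemma diagram_surj: "A \<in> young.level m \<Longrightarrow> \<exists>p\<in>partitions_of m. diagram p = A"
proof (induction m arbitrary: A)
  case 0
  then have "A = {}" unfolding young.level_def by auto
  moreover have "diagram {#} = {}" unfolding diagram_def by simp
  ultimately show ?case by (intro bexI[of _ "{#}"]) (simp_all add: partitions_of_def)
next
  case (Suc m)
  obtain c where c: "c \<in> A" "A - {c} \<in> young.level m" using young.remove_max[OF Suc.prems] by blast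
  then obtain r where r: "r \<in> partitions_of m" "diagram r = A - {c}" using Suc.IH by blast
  have ins: "insert c (diagram r) = A" using c(1) r(2) by blast
  obtain b where b: "growable b r" "insert c (diagram r) = diagram (grow b r)"
    using insert_cell_diagram[of c r] r(2) young.levelD(2)[OF Suc.prems] ins by auto
  then have "grow b r \<in> partitions_of (Suc m)"
    using r(1) sum_grow zero_notin_grow unfolding partitions_of_def by simp
  then show ?case using b(2) ins by metis
qed

lemma bij_diagram: "bij_betw diagram (partitions_of m) (young.level m)"
proof (rule bij_betw_imageI)
  show "inj_on diagram (partitions_of m)"
    using diagram_inj unfolding inj_on_def partitions_of_def by blast
  show "diagram ` partitions_of m = young.level m" using diagram_level diagram_surj by blast
qed

lemma finite_young_level: "finite (young.level m)"
proof -
  have "A \<subseteq> prod_encode ` ({..<m} \<times> {..<m})" if "A \<in> young.level m" for A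
  proof -
    obtain p where p: "0 \<notin># p" "sum_mset p = m" "A = diagram p"
      using diagram_surj[OF \<open>A \<in> young.level m\<close>] unfolding partitions_of_def by blast
    have "size p \<le> sum_mset p"
      using p(1) by (induction p) (auto simp: Suc_le_eq add_less_le_mono)
    moreover have "col_height p j \<le> size p" for j
      unfolding col_height_def by (rule size_filter_mset_lesseq)
    ultimately have "col_height p j \<le> m" for j using p(2) le_trans by metis
    moreover have "j < m" if "i < col_height p j" for i j
      using that col_height_beyond[of p j] p(2) by (metis less_nat_zero_code not_less)
    ultimately have "{(i, j). i < col_height p j} \<subseteq> {..<m} \<times> {..<m}" using less_le_trans by blast
    then show ?thesis unfolding p(3) diagram_def by (rule image_mono)
  qed
  then have "young.level m \<subseteq> Pow (prod_encode ` ({..<m} \<times> {..<m}))" by blast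
  then show ?thesis using finite_subset by fastforce
qed

lemma finite_partitions_of: "finite (partitions_of m)"
  using bij_betw_finite[OF bij_diagram] finite_young_level by blast

lemma grow_remove:
  assumes "a \<in># p" "0 \<notin># p"
  shows "growable (a - 1) (p - {#a#} + decr_part a)" "grow (a - 1) (p - {#a#} + decr_part a) = p"
proof -
  obtain p' where p': "p = add_mset a p'" using assms(1) by (metis mset_add)
  have "a \<noteq> 0" using assms by metis
  then have "a = 1 \<or> a - 1 \<noteq> 0 \<and> Suc (a - 1) = a" by linarith
  then show "growable (a - 1) (p - {#a#} + decr_part a)" "grow (a - 1) (p - {#a#} + decr_part a) = p"
    unfolding p' growable_def grow_def decr_part_def by auto
qed

text \<open>\<open>r\<close> is \<open>p\<close> after its part has been decreased, so a transfer
  removes one cell and adds another. Since \<open>p \<noteq> q\<close> the columns \<open>b\<close>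
  and \<open>c\<close> differ; hence a part of size \<open>c\<close> is still available in
  \<open>p\<close> apart from the decreased one.\<close>

lemma elementary_transfer_iff:
  assumes "0 \<notin># p" "p \<noteq> q"
  shows "elementary_transfer p q \<longleftrightarrow>
    (\<exists>r b c. 0 \<notin># r \<and> growable b r \<and> growable c r \<and> p = grow b r \<and> q = grow c r)"
proof
  assume "elementary_transfer p q"
  then obtain a where a: "a \<in># p" and
    q: "(\<exists>b. b \<in># p - {#a#} \<and> q = p - {#a#} - {#b#} + decr_part a + {#b + 1#}) \<or>
         q = p - {#a#} + decr_part a + {#1#}"
    unfolding elementary_transfer_def by blast
  let ?r = "p - {#a#} + decr_part a"
  have "a \<noteq> 0" using a assms(1) by metis
  then have r0: "0 \<notin># ?r" using assms(1) unfolding decr_part_def by (auto dest: in_diffD)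
  have "\<exists>c. growable c ?r \<and> q = grow c ?r"
    using q
  proof
    assume "\<exists>b. b \<in># p - {#a#} \<and> q = p - {#a#} - {#b#} + decr_part a + {#b + 1#}"
    then obtain b where b: "b \<in># p - {#a#}" "q = p - {#a#} - {#b#} + decr_part a + {#b + 1#}" by blast
    have "b \<noteq> 0" using b(1) assms(1) in_diffD by metis
    obtain p' where p': "p - {#a#} = add_mset b p'" using b(1) by (metis mset_add)
    show ?thesis
      using b(2) \<open>b \<noteq> 0\<close> unfolding p' by (intro exI[of _ b]) (simp add: growable_def grow_def)
  next
    assume "q = p - {#a#} + decr_part a + {#1#}"
    then show ?thesis by (intro exI[of _ 0]) (simp add: growable_def grow_def)
  qed
  then show "\<exists>r b c. 0 \<notin># r \<and> growable b r \<and> growable c r \<and> p = grow b r \<and> q = grow c r"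
    using grow_remove[OF a assms(1)] r0 by metis
next
  assume "\<exists>r b c. 0 \<notin># r \<and> growable b r \<and> growable c r \<and> p = grow b r \<and> q = grow c r"
  then obtain r b c where r: "0 \<notin># r" "growable b r" "growable c r" "p = grow b r" "q = grow c r" by blast
  have bc: "b \<noteq> c" using r assms(2) by blast
  have a: "Suc b \<in># p" unfolding r(4) grow_def by simp
  have pr: "p - {#Suc b#} = r - (if b = 0 then {#} else {#b#})"
    unfolding r(4) grow_def by simp
  have pr': "p - {#Suc b#} + decr_part (Suc b) = r"
    unfolding pr decr_part_def using r(2) by (auto simp: growable_def)
  show "elementary_transfer p q"
  proof (cases "c = 0")
    case True
    then have "q = p - {#Suc b#} + decr_part (Suc b) + {#1#}" unfolding pr' r(5) grow_def by simp
    then show ?thesis using a unfolding elementary_transfer_def by blast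
  next
    case False
    then have c: "c \<in># r" using r(3) unfolding growable_def by simp
    then have c': "c \<in># p - {#Suc b#}" unfolding pr using bc by (auto simp: in_diff_count)
    then have "p - {#Suc b#} - {#c#} + decr_part (Suc b) = r - {#c#}"
      using pr' by (metis add.commute diff_union_single_conv)
    then have "q = p - {#Suc b#} - {#c#} + decr_part (Suc b) + {#c + 1#}"
      using False unfolding r(5) grow_def by simp
    then show ?thesis using a c' unfolding elementary_transfer_def by blast
  qed
qed

text \<open>The common partition \<open>r\<close> of a transfer corresponds to the intersection of
  the two diagrams, which is itself a diagram.\<close>

lemma elementary_transfer_diagram:
  assumes p: "p \<in> partitions_of (Suc m)" and q: "q \<in> partitions_of (Suc m)" and "p \<noteq> q"
  shows "elementary_transfer p q \<longleftrightarrow> m \<le> card (diagram p \<inter> diagram q)"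
proof
  have pq0: "0 \<notin># p" "0 \<notin># q" using p q unfolding partitions_of_def by auto
  assume "elementary_transfer p q"
  then obtain r b c where r: "growable b r" "growable c r" "p = grow b r" "q = grow c r"
    using elementary_transfer_iff[OF pq0(1) assms(3)] by blast
  have "diagram r \<subseteq> diagram p \<inter> diagram q" using diagram_grow r by auto
  then have "card (diagram r) \<le> card (diagram p \<inter> diagram q)"
    using finite_diagram by (intro card_mono) auto
  moreover have "sum_mset r = m" using sum_grow[OF r(1)] p r(3) unfolding partitions_of_def by simp
  ultimately show "m \<le> card (diagram p \<inter> diagram q)" by (simp add: card_diagram)
next
  have pq0: "0 \<notin># p" "0 \<notin># q" using p q unfolding partitions_of_def by auto
  let ?D = "diagram p \<inter> diagram q"
  assume le: "m \<le> card ?D"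
  have lev: "diagram p \<in> young.level (Suc m)" "diagram q \<in> young.level (Suc m)"
    using diagram_level p q by auto
  have ne: "diagram p \<noteq> diagram q" using diagram_inj pq0 assms(3) by blast
  have "?D \<subset> diagram p"
    using ne card_subset_eq[of "diagram q" "diagram p"] young.levelD[OF lev(1)] young.levelD[OF lev(2)] by auto
  then have "card ?D < Suc m" using psubset_card_mono young.levelD[OF lev(1)] by metis
  then have card: "card ?D = m" using le by simp
  then have "?D \<in> young.level m"
    using young.down_closed_Int down_closed_diagram finite_diagram unfolding young.level_def by simp
  then obtain r where r: "r \<in> partitions_of m" "diagram r = ?D" using diagram_surj by blast
  have step: "\<exists>b. growable b r \<and> u = grow b r"
    if u: "u \<in> partitions_of (Suc m)" "?D \<subseteq> diagram u" for u
  proof -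
    have levu: "diagram u \<in> young.level (Suc m)" using diagram_level u(1) .
    have "card (diagram u - ?D) = 1"
      using card young.levelD[OF levu] u(2) finite_diagram by (simp add: card_Diff_subset)
    then obtain c where c: "diagram u - ?D = {c}" by (meson card_1_singletonE)
    have ins: "insert c (diagram r) = diagram u" using c u(2) r(2) by blast
    have "c \<notin> diagram r" using c r(2) by blast
    then obtain b where b: "growable b r" "diagram u = diagram (grow b r)"
      using insert_cell_diagram[of c r] down_closed_diagram[of u] ins by auto
    have "u = grow b r"
      using diagram_inj[OF b(2)] zero_notin_grow u(1) r(1) unfolding partitions_of_def by simp
    then show ?thesis using b(1) by blast
  qed
  obtain b c where "growable b r" "p = grow b r" "growable c r" "q = grow c r"
    using step[OF p] step[OF q] by auto
  moreover have "0 \<notin># r" using r(1) unfolding partitions_of_def by simp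
  ultimately show "elementary_transfer p q"
    using elementary_transfer_iff[OF pq0(1) assms(3)] by blast
qed

interpretation young: graded_down_sets cell_below n for n
  by unfold_locales (rule finite_young_level)

section \<open>The partition complex as the middle level of diagrams\<close>

lemma partition_edge_iff:
  assumes "p \<in> partitions_of (Suc m)" "q \<in> partitions_of (Suc m)" "p \<noteq> q"
  shows "{p, q} \<in> partition_edges (Suc m) \<longleftrightarrow> m \<le> card (diagram p \<inter> diagram q)"
proof -
  have "{p, q} \<in> partition_edges (Suc m) \<longleftrightarrow> elementary_transfer p q \<or> elementary_transfer q p"
    using assms unfolding partition_edges_def by (auto simp: doubleton_eq_iff)
  then show ?thesis
    using elementary_transfer_diagram[OF assms] elementary_transfer_diagram[OF assms(2,1) assms(3)[symmetric]]
    by (simp add: Int_commute)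
qed

lemma fin_complex_partition_complex: "fin_complex (partition_complex n)"
proof -
  have "partition_complex n \<subseteq> Pow (partitions_of n)"
    unfolding partition_complex_def clique_complex_def by blast
  then have "finite (partition_complex n)" using finite_partitions_of finite_subset by blast
  moreover have "t \<in> partition_complex n" if "s \<in> partition_complex n" "t \<subseteq> s" "t \<noteq> {}" for s t
  proof -
    have s: "finite s" "s \<subseteq> partitions_of n" "clique s (partition_edges n)"
      using that(1) unfolding partition_complex_def clique_complex_def by auto
    have "finite t" using s(1) that(2) finite_subset by blast
    moreover have "clique t (partition_edges n)" using s(3) that(2) unfolding clique_def by blast
    ultimately show ?thesis
      using s(2) that(2,3) unfolding partition_complex_def clique_complex_def by blast
  qed
  moreover have "finite s \<and> s \<noteq> {}" if "s \<in> partition_complex n" for s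
    using that unfolding partition_complex_def clique_complex_def by blast
  ultimately show ?thesis unfolding fin_complex_def by blast
qed

lemma partition_complex_diagrams: "(`) diagram ` partition_complex (Suc m) = young.mid m"
proof (intro equalityI subsetI)
  fix t assume "t \<in> (`) diagram ` partition_complex (Suc m)"
  then obtain s where s: "t = diagram ` s" "s \<noteq> {}" "s \<subseteq> partitions_of (Suc m)"
    "clique s (partition_edges (Suc m))"
    unfolding partition_complex_def clique_complex_def by blast
  have "m \<le> card (diagram p \<inter> diagram q)" if "p \<in> s" "q \<in> s" for p q
  proof (cases "p = q")
    case True
    then show ?thesis using card_diagram[of p] that s(3) unfolding partitions_of_def by auto
  next
    case False
    then show ?thesis using partition_edge_iff[of p m q] s(3,4) that unfolding clique_def by blast
  qed
  then show "t \<in> young.mid m" using s(1-3) diagram_level unfolding young.mid_def by auto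
next
  fix t assume t: "t \<in> young.mid m"
  define s where "s = {p \<in> partitions_of (Suc m). diagram p \<in> t}"
  have ts: "t = diagram ` s"
  proof (intro equalityI subsetI)
    fix A assume "A \<in> t"
    moreover from this have "A \<in> young.level (Suc m)" using t unfolding young.mid_def by auto
    ultimately show "A \<in> diagram ` s" using diagram_surj unfolding s_def by blast
  qed (auto simp: s_def)
  have "{p, q} \<in> partition_edges (Suc m)" if "p \<in> s" "q \<in> s" "p \<noteq> q" for p q
    using partition_edge_iff[of p m q] that t unfolding s_def young.mid_def by blast
  then have "clique s (partition_edges (Suc m))" unfolding clique_def by blast
  moreover have "s \<noteq> {}" using t ts unfolding young.mid_def by auto
  moreover have "finite s" using finite_partitions_of unfolding s_def by simp
  ultimately have "s \<in> partition_complex (Suc m)"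
    unfolding partition_complex_def clique_complex_def s_def by blast
  then show "t \<in> (`) diagram ` partition_complex (Suc m)" using ts by blast
qed

lemma partition_complex_wedge:
  "\<exists>b. int b = euler_char (partition_complex (Suc m)) - 1 \<and>
     geometric_realization (partition_complex (Suc m)) homotopy_equivalent_space wedge_of_2_spheres b"
proof -
  have "\<Union>(partition_complex (Suc m)) \<subseteq> partitions_of (Suc m)"
    unfolding partition_complex_def clique_complex_def by blast
  then have "inj_on diagram (\<Union>(partition_complex (Suc m)))"
    using bij_diagram unfolding bij_betw_def by (meson inj_on_subset)
  from cx_equiv_rename[OF fin_complex_partition_complex this]
  have "cx_equiv (partition_complex (Suc m)) (young.mid m)" unfolding partition_complex_diagrams .
  then show ?thesis using young.mid_wedge[of m] homotopy_eqv_trans unfolding cx_equiv_def by metis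
qed

text \<open>The codes up to \<open>triangle (Suc t)\<close> form the staircase with one more cell \<open>(0, t + 1)\<close>. Of the last
  diagonal of the staircase only the cell \<open>(0, t)\<close> is not removable; its code is \<open>triangle t\<close>.\<close>

lemma staircase_clique:
  "\<exists>s\<in>partition_complex (triangle (Suc t)). card s = Suc t"
proof -
  let ?T = "triangle (Suc t)"
  define m where "m = ?T - 1"
  have m: "?T = Suc m" unfolding m_def by simp
  let ?S = "{triangle t <.. ?T}"
  have lev: "{..?T} - {c} \<in> young.level ?T" if c: "c \<in> ?S" for c
  proof -
    have "\<not> cell_below c b" if "b \<le> ?T" for b
    proof
      assume "cell_below c b"
      then obtain i j where ij: "c = triangle (i + j) + i"
        "b = triangle (Suc (i + j)) + Suc i \<or> b = triangle (Suc (i + j)) + i"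
        unfolding cell_below_def prod_encode_def by auto
      have mono: "triangle k \<le> triangle l" if "k \<le> l" for k l
        using that by (induction l) (auto simp: le_Suc_eq)
      have "\<not> Suc (i + j) \<le> t" using c ij(1) mono[of "Suc (i + j)" t] by auto
      \<comment> \<open>\<open>c\<close> lies on diagonal \<open>t\<close> or later, so
        \<open>b\<close> lies on diagonal \<open>t + 1\<close> or later, where the least code is
        \<open>?T\<close>. With \<open>b \<le> ?T\<close> only the cell \<open>(0, t + 1)\<close>
        remains for \<open>b\<close>, and \<open>c\<close> is \<open>(0, t)\<close>.\<close>
      then have le: "?T \<le> triangle (Suc (i + j))" by (intro mono) simp
      then have "b = triangle (Suc (i + j)) + i" "i = 0" "triangle (Suc (i + j)) = ?T"
        using ij(2) that by auto
      moreover from this have "\<not> Suc (Suc t) \<le> Suc (i + j)" using mono[of "Suc (Suc t)" "Suc (i + j)"] by auto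
      ultimately have "c = triangle t" using ij(1) \<open>\<not> Suc (i + j) \<le> t\<close>
        by (metis add_0_right le_antisym not_less_eq_eq Suc_le_mono)
      then show False using c by simp
    qed
    moreover have "young.down_closed {..?T}"
      using young.initial_segment_level[of "Suc ?T"] young.levelD(2) by (metis lessThan_Suc_atMost)
    ultimately have "young.down_closed ({..?T} - {c})" unfolding young.down_closed_def by auto
    moreover have "card ({..?T} - {c}) = ?T" using c by simp
    ultimately show ?thesis unfolding young.level_def by simp
  qed
  let ?t = "(\<lambda>c. {..?T} - {c}) ` ?S"
  have inj: "inj_on (\<lambda>c. {..?T} - {c}) ?S"
  proof (rule inj_onI)
    fix c d assume cd: "c \<in> ?S" "d \<in> ?S" "{..?T} - {c} = {..?T} - {d}"
    then have "c \<notin> {..?T} - {d}" by blast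
    then show "c = d" using cd(1) by simp
  qed
  have "m \<le> card (({..?T} - {c}) \<inter> ({..?T} - {d}))" if "c \<in> ?S" "d \<in> ?S" for c d
  proof -
    have "({..?T} - {c}) \<inter> ({..?T} - {d}) = {..?T} - {c, d}" by blast
    moreover have "card {..?T} - card {c, d} \<le> card ({..?T} - {c, d})" by (rule diff_card_le_card_Diff) simp
    moreover have "card {c, d} \<le> 2" by (simp add: card_insert_if)
    ultimately show ?thesis unfolding m by simp
  qed
  then have "?t \<in> young.mid m"
    using lev unfolding young.mid_def m by (auto simp: m[symmetric])
  then obtain s where s: "s \<in> partition_complex ?T" "?t = diagram ` s"
    unfolding partition_complex_diagrams[symmetric] m by blast
  have "s \<subseteq> partitions_of ?T" using s(1) unfolding partition_complex_def clique_complex_def by blast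
  then have "inj_on diagram s" using bij_diagram unfolding bij_betw_def by (meson inj_on_subset)
  then have "card s = card ?t" unfolding s(2) by (simp add: card_image)
  also have "\<dots> = Suc t" using card_image[OF inj] by simp
  finally show ?thesis using s(1) by blast
qed

lemma complex_dim_partition_complex:
  assumes "t \<ge> 1"
  shows "t - 1 \<le> complex_dim (partition_complex (t * (t + 1) div 2))"
proof -
  obtain u where u: "t = Suc u" using assms by (cases t) auto
  obtain s where s: "s \<in> partition_complex (triangle t)" "card s = t"
    using staircase_clique[of u] u by blast
  have "card s - 1 \<le> complex_dim (partition_complex (triangle t))"
    unfolding complex_dim_def
    using s(1) fin_complexD(1)[OF fin_complex_partition_complex] by (intro Max_ge) auto
  then show ?thesis using s(2) unfolding triangle_def by simp
qed

theorem theorem2p3: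
  shows "(\<forall>t\<ge>1. complex_dim (partition_complex (t * (t + 1) div 2)) \<ge> t - 1) \<and>
    \<not> bdd_above ((\<lambda>n. complex_dim (partition_complex n)) ` {1..}) \<and>
    (\<forall>n\<ge>1. \<exists>b::nat. int b = euler_char (partition_complex n) - 1 \<and>
       geometric_realization (partition_complex n) homotopy_equivalent_space wedge_of_2_spheres b)"
proof (intro conjI allI impI)
  show "complex_dim (partition_complex (t * (t + 1) div 2)) \<ge> t - 1" if "t \<ge> 1" for t
    using complex_dim_partition_complex[OF that] .
  show "\<not> bdd_above ((\<lambda>n. complex_dim (partition_complex n)) ` {1..})"
  proof
    assume "bdd_above ((\<lambda>n. complex_dim (partition_complex n)) ` {1..})"
    then obtain B where B: "\<And>n. n \<ge> 1 \<Longrightarrow> complex_dim (partition_complex n) \<le> B"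
      unfolding bdd_above_def by auto
    let ?t = "B + 2"
    have "?t * (?t + 1) div 2 \<ge> 1" by (simp add: div_le_mono[of 2, simplified])
    from B[OF this] complex_dim_partition_complex[of ?t] show False by simp
  qed
  show "\<exists>b::nat. int b = euler_char (partition_complex n) - 1 \<and>
       geometric_realization (partition_complex n) homotopy_equivalent_space wedge_of_2_spheres b"
    if "n \<ge> 1" for n
    using partition_complex_wedge[of "n - 1"] that by simp
qed

end
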